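(* Let $\mathcal{T}=(T(t))_{t\ge0}$ be a bounded $C_0$-semigroup on a Banach space $X$ with infinitesimal generator $A$ such that $\sigma_{PF}(A)$ is countable. Then $\mathcal{T}$ is almost periodic if and only if there is a dense subspace $M\subseteq X$ such that $\lim_{\alpha\to0^+}\alpha R(\alpha+i\xi,A)x$ exists for all $i\xi\in\sigma_{PF}(A)$ and all $x\in M$.
   Context: Vector-valued distributions: for a Banach space $Z$ and an open set $I\subseteq\mathbb{R}$, $\mathcal{D}'(I;Z)$ is the space of continuous linear maps $\mathcal{D}(I)=C_c^\infty(I)\to Z$, and $\mathcal{S}'(\mathbb{R};Z)$ is the space of continuous linear maps $\mathcal{S}(\mathbb{R})\to Z$ (Schwartz space). The Fourier transform is $\widehat{\varphi}(\xi)=\int_{-\infty}^{\infty}e^{-i\xi t}\varphi(t)\,dt$ on $\mathcal{S}(\mathbb{R})$, extended to $\mathcal{S}'(\mathbb{R};Z)$ by $\langle\widehat f,\varphi\rangle=\langle f,\widehat\varphi\rangle$. $C_0(\mathbb{R};Z)$ is the space of continuous $Z$-valued functions vanishing at infinity, and $PF(\mathbb{R};Z)=\{\widehat g: g\in C_0(\mathbb{R};Z)\}$. A distribution $f\in\mathcal{D}'(I;Z)$ is a local pseudofunction on $I$, written $f\in PF_{\mathrm{loc}}(I;Z)$, if each $\xi_0\in I$ has an open neighborhood $I'\subseteq I$ on which $f$ coincides with an element of $PF(\mathbb{R};Z)$. Semigroups: $\mathcal{T}$ is bounded if $\sup_{t\ge0}\|T(t)\|_{L(X)}<\infty$; it is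 almost periodic if for each $x\in X$ the orbit $\{T(t)x:t\ge0\}$ is relatively compact in $X$; $R(\lambda,A)=(\lambda-A)^{-1}$ is the resolvent. For bounded $\mathcal{T}$ and $x\in X$, the limit $\langle R(i\xi,A)x,\varphi(\xi)\rangle=\lim_{\alpha\to0^+}\int_{-\infty}^\infty\varphi(\xi)R(\alpha+i\xi,A)x\,d\xi$ defines $R(i\,\cdot,A)x\in\mathcal{S}'(\mathbb{R};X)$ (it is the Fourier transform of $t\mapsto T(t)x$, extended by $0$ to $t<0$). The local pseudofunction spectrum $\sigma_{PF}(A)\subseteq i\mathbb{R}$ is the complement in $i\mathbb{R}$ of the largest set $iI$, with $I\subseteq\mathbb{R}$ open, such that $R(i\,\cdot,A)x\in PF_{\mathrm{loc}}(I;X)$ for every $x\in X$. Countable includes finite and empty. *)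

theory Defs
  imports "HOL-Analysis.Analysis"
begin

section \<open>Complex Banach spaces\<close>

class complex_banach = banach +
  fixes scaleC :: "complex \<Rightarrow> 'a \<Rightarrow> 'a"  (infixr "*\<^sub>C" 75)
  assumes scaleC_add_right: "c *\<^sub>C (x + y) = c *\<^sub>C x + c *\<^sub>C y"
    and scaleC_add_left: "(c + d) *\<^sub>C x = c *\<^sub>C x + d *\<^sub>C x"
    and scaleC_scaleC: "c *\<^sub>C d *\<^sub>C x = (c * d) *\<^sub>C x"
    and scaleR_scaleC: "r *\<^sub>R x = complex_of_real r *\<^sub>C x"
    and norm_scaleC: "norm (c *\<^sub>C x) = cmod c * norm x"

instantiation complex :: complex_banach
begin

definition scaleC_complex :: "complex \<Rightarrow> complex \<Rightarrow> complex"
  where "scaleC_complex c x = c * x"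

instance
  by standard (auto simp: scaleC_complex_def algebra_simps norm_mult scaleR_conv_of_real)

end

definition csubspace :: "'a::complex_banach set \<Rightarrow> bool"
  where "csubspace M \<longleftrightarrow>
    0 \<in> M \<and> (\<forall>x\<in>M. \<forall>y\<in>M. x + y \<in> M) \<and> (\<forall>c. \<forall>x\<in>M. c *\<^sub>C x \<in> M)"

definition bounded_clinear :: "('a::complex_banach \<Rightarrow> 'b::complex_banach) \<Rightarrow> bool"
  where "bounded_clinear f \<longleftrightarrow> bounded_linear f \<and> (\<forall>c x. f (c *\<^sub>C x) = c *\<^sub>C f x)"


section \<open>Semigroups, generators and resolvents\<close>

text \<open>Only the values \<open>T t\<close> for \<open>t \<ge> 0\<close> matter.\<close>

definition C0_semigroup :: "(real \<Rightarrow> 'a::complex_banach \<Rightarrow> 'a) \<Rightarrow> bool"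
  where "C0_semigroup T \<longleftrightarrow>
    (\<forall>t\<ge>0. bounded_clinear (T t)) \<and>
    T 0 = id \<and>
    (\<forall>s\<ge>0. \<forall>t\<ge>0. T (s + t) = T s \<circ> T t) \<and>
    (\<forall>x. ((\<lambda>t. T t x) \<longlongrightarrow> x) (at_right 0))"

definition bounded_semigroup :: "(real \<Rightarrow> 'a::complex_banach \<Rightarrow> 'a) \<Rightarrow> bool"
  where "bounded_semigroup T \<longleftrightarrow> bdd_above ((\<lambda>t. onorm (T t)) ` {0..})"

definition almost_periodic :: "(real \<Rightarrow> 'a::complex_banach \<Rightarrow> 'a) \<Rightarrow> bool"
  where "almost_periodic T \<longleftrightarrow> (\<forall>x. compact (closure ((\<lambda>t. T t x) ` {0..})))"

text \<open>An unbounded operator is a partial function \<open>A\<close> with domain \<open>dom A\<close>.\<close>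

definition generator :: "(real \<Rightarrow> 'a::complex_banach \<Rightarrow> 'a) \<Rightarrow> ('a \<rightharpoonup> 'a)"
  where "generator T x =
    (if \<exists>y. ((\<lambda>h. (T h x - x) /\<^sub>R h) \<longlongrightarrow> y) (at_right 0)
     then Some (Lim (at_right 0) (\<lambda>h. (T h x - x) /\<^sub>R h)) else None)"

text \<open>
  The inverse of \<open>\<mu> - A : dom A \<rightarrow> X\<close>; meaningful for \<open>\<mu>\<close> in the resolvent set of \<open>A\<close>, which
  contains the open right half-plane when \<open>A\<close> generates a bounded semigroup.
\<close>

definition resolvent :: "('a::complex_banach \<rightharpoonup> 'a) \<Rightarrow> complex \<Rightarrow> 'a \<Rightarrow> 'a"
  where "resolvent A \<mu> = inv_into (dom A) (\<lambda>x. \<mu> *\<^sub>C x - the (A x))"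


section \<open>Test functions\<close>

definition nth_deriv :: "nat \<Rightarrow> (real \<Rightarrow> complex) \<Rightarrow> real \<Rightarrow> complex"
  where "nth_deriv n = (\<lambda>f t. vector_derivative f (at t)) ^^ n"

definition smooth :: "(real \<Rightarrow> complex) \<Rightarrow> bool"
  where "smooth \<phi> \<longleftrightarrow> (\<forall>n t. nth_deriv n \<phi> differentiable (at t))"

definition support :: "(real \<Rightarrow> complex) \<Rightarrow> real set"
  where "support \<phi> = closure {t. \<phi> t \<noteq> 0}"

definition test_functions :: "real set \<Rightarrow> (real \<Rightarrow> complex) set"
  where "test_functions I = {\<phi>. smooth \<phi> \<and> compact (support \<phi>) \<and> support \<phi> \<subseteq> I}"

definition schwartz :: "(real \<Rightarrow> complex) set"
  where "schwartz = {\<phi>. smooth \<phi> \<and> (\<forall>k n. bounded (range (\<lambda>t. t ^ k *\<^sub>R nth_deriv n \<phi> t)))}"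

text \<open>
  The inductive limit topology on \<open>C\<^sub>c\<^sup>\<infinity>(I)\<close>: an absolutely convex set is a neighbourhood of \<open>0\<close>
  iff, for every compact \<open>K \<subseteq> I\<close>, it contains a basic \<open>C\<^sup>\<infinity>\<close>-neighbourhood of \<open>0\<close> in the space
  of test functions supported in \<open>K\<close>.
\<close>

definition test_nhd0 :: "real set \<Rightarrow> (real \<Rightarrow> complex) set \<Rightarrow> bool"
  where "test_nhd0 I V \<longleftrightarrow>
    V \<subseteq> test_functions I \<and>
    (\<forall>\<phi>\<in>V. \<forall>\<psi>\<in>V. \<forall>a b. cmod a + cmod b \<le> 1 \<longrightarrow> (\<lambda>t. a * \<phi> t + b * \<psi> t) \<in> V) \<and>
    (\<forall>K. compact K \<and> K \<subseteq> I \<longrightarrow>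
      (\<exists>N. \<exists>e>0. {\<phi> \<in> test_functions K. \<forall>n\<le>N. \<forall>t. cmod (nth_deriv n \<phi> t) \<le> e} \<subseteq> V))"

definition test_topology :: "real set \<Rightarrow> (real \<Rightarrow> complex) topology"
  where "test_topology I = topology (\<lambda>U. U \<subseteq> test_functions I \<and>
    (\<forall>\<phi>\<in>U. \<exists>V. test_nhd0 I V \<and> (\<lambda>\<psi> t. \<phi> t + \<psi> t) ` V \<subseteq> U))"

lemma test_nhd0_Int:
  assumes "test_nhd0 I V" "test_nhd0 I W"
  shows "test_nhd0 I (V \<inter> W)"
  unfolding test_nhd0_def
proof (intro conjI allI impI)
  show "V \<inter> W \<subseteq> test_functions I"
    using assms by (simp add: test_nhd0_def le_infI1)
  show "\<forall>\<phi>\<in>V \<inter> W. \<forall>\<psi>\<in>V \<inter> W. \<forall>a b. cmod a + cmod b \<le> 1 \<longrightarrow>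
      (\<lambda>t. a * \<phi> t + b * \<psi> t) \<in> V \<inter> W"
    using assms by (simp add: test_nhd0_def)
  fix K assume K: "compact K \<and> K \<subseteq> I"
  let ?B = "\<lambda>N e. {\<phi> \<in> test_functions K. \<forall>n\<le>N. \<forall>t. cmod (nth_deriv n \<phi> t) \<le> e}"
  have "\<exists>N. \<exists>e>0. ?B N e \<subseteq> V" "\<exists>N. \<exists>e>0. ?B N e \<subseteq> W"
    using assms K by (simp_all only: test_nhd0_def)
  then obtain N e M d where V: "e > 0" "?B N e \<subseteq> V" and W: "d > 0" "?B M d \<subseteq> W"
    by (elim exE conjE)
  have "?B (max N M) (min e d) \<subseteq> ?B N e" "?B (max N M) (min e d) \<subseteq> ?B M d"
    by (auto simp: le_max_iff_disj)
  then have "?B (max N M) (min e d) \<subseteq> V \<inter> W"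
    using V(2) W(2) by (intro Int_greatest) (rule subset_trans, assumption+)+
  moreover have "min e d > 0"
    using V(1) W(1) by simp
  ultimately show "\<exists>N. \<exists>e>0. ?B N e \<subseteq> V \<inter> W"
    by (intro exI conjI)
qed

lemma openin_test_topology:
  "openin (test_topology I) U \<longleftrightarrow> U \<subseteq> test_functions I \<and>
    (\<forall>\<phi>\<in>U. \<exists>V. test_nhd0 I V \<and> (\<lambda>\<psi> t. \<phi> t + \<psi> t) ` V \<subseteq> U)"
proof -
  let ?P = "\<lambda>U. U \<subseteq> test_functions I \<and>
    (\<forall>\<phi>\<in>U. \<exists>V. test_nhd0 I V \<and> (\<lambda>\<psi> t. \<phi> t + \<psi> t) ` V \<subseteq> U)"
  have "istopology ?P"
    unfolding istopology_def
  proof (intro conjI allI impI)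
    fix S U assume S: "?P S" and U: "?P U"
    show "S \<inter> U \<subseteq> test_functions I"
      using S by blast
    show "\<forall>\<phi>\<in>S \<inter> U. \<exists>V. test_nhd0 I V \<and> (\<lambda>\<psi> t. \<phi> t + \<psi> t) ` V \<subseteq> S \<inter> U"
    proof
      fix \<phi> assume "\<phi> \<in> S \<inter> U"
      then obtain V W where "test_nhd0 I V" "(\<lambda>\<psi> t. \<phi> t + \<psi> t) ` V \<subseteq> S"
        "test_nhd0 I W" "(\<lambda>\<psi> t. \<phi> t + \<psi> t) ` W \<subseteq> U"
        using S U by blast
      then show "\<exists>V. test_nhd0 I V \<and> (\<lambda>\<psi> t. \<phi> t + \<psi> t) ` V \<subseteq> S \<inter> U"
        by (intro exI[of _ "V \<inter> W"] conjI test_nhd0_Int) blast+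
    qed
  next
    fix \<U> assume "\<forall>U\<in>\<U>. ?P U"
    then have \<U>: "?P U" if "U \<in> \<U>" for U
      using that by (rule bspec)
    show "\<Union>\<U> \<subseteq> test_functions I"
      using \<U> by (intro Union_least) (rule conjunct1)
    show "\<forall>\<phi>\<in>\<Union>\<U>. \<exists>V. test_nhd0 I V \<and> (\<lambda>\<psi> t. \<phi> t + \<psi> t) ` V \<subseteq> \<Union>\<U>"
    proof
      fix \<phi> assume "\<phi> \<in> \<Union>\<U>"
      then obtain U where U: "U \<in> \<U>" "\<phi> \<in> U"
        by (rule UnionE)
      then obtain V where V: "test_nhd0 I V" "(\<lambda>\<psi> t. \<phi> t + \<psi> t) ` V \<subseteq> U"
        using \<U>[OF U(1)] by blast
      have "U \<subseteq> \<Union>\<U>"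
        using U(1) by (rule Union_upper)
      with V show "\<exists>V. test_nhd0 I V \<and> (\<lambda>\<psi> t. \<phi> t + \<psi> t) ` V \<subseteq> \<Union>\<U>"
        by (intro exI[of _ V] conjI) (rule V(1), rule subset_trans)
    qed
  qed
  then show ?thesis
    by (simp add: test_topology_def)
qed

lemma nth_deriv_Suc: "nth_deriv (Suc n) f t = vector_derivative (nth_deriv n f) (at t)"
  by (simp add: nth_deriv_def)

lemma nth_deriv_outside_support:
  assumes "t \<notin> support \<phi>"
  shows "nth_deriv n \<phi> t = 0"
  using assms
proof (induction n arbitrary: t)
  case 0
  then show ?case
    using closure_subset[of "{t. \<phi> t \<noteq> 0}"] by (auto simp: nth_deriv_def support_def)
next
  case (Suc n)
  have "((\<lambda>_. 0) has_vector_derivative 0) (at t)"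
    by simp
  moreover have "open (- support \<phi>)"
    by (simp add: support_def open_Compl)
  ultimately have "(nth_deriv n \<phi> has_vector_derivative 0) (at t)"
    by (rule has_vector_derivative_transform_within_open) (use Suc in auto)
  then show ?case
    by (simp add: nth_deriv_Suc vector_derivative_at)
qed

lemma test_functions_subset_schwartz: "test_functions I \<subseteq> schwartz"
proof
  fix \<phi> assume \<phi>: "\<phi> \<in> test_functions I"
  then have *: "smooth \<phi>" "compact (support \<phi>)"
    by (auto simp: test_functions_def)
  have "bounded (range (\<lambda>t. t ^ k *\<^sub>R nth_deriv n \<phi> t))" for k n
  proof -
    let ?f = "\<lambda>t. t ^ k *\<^sub>R nth_deriv n \<phi> t"
    have "continuous_on (support \<phi>) (nth_deriv n \<phi>)"
      using *(1) unfolding smooth_def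
      by (meson continuous_at_imp_continuous_on differentiable_imp_continuous_within)
    then have "bounded (?f ` support \<phi>)"
      by (intro compact_imp_bounded compact_continuous_image continuous_intros *)
    moreover have "range ?f \<subseteq> insert 0 (?f ` support \<phi>)"
    proof
      fix y assume "y \<in> range ?f"
      then obtain t where "y = ?f t"
        by blast
      then show "y \<in> insert 0 (?f ` support \<phi>)"
        by (cases "t \<in> support \<phi>") (simp_all add: nth_deriv_outside_support)
    qed
    ultimately show ?thesis
      by (meson bounded_insert bounded_subset)
  qed
  with * show "\<phi> \<in> schwartz"
    by (simp add: schwartz_def)
qed


section \<open>Vector-valued distributions\<close>

definition distributions :: "real set \<Rightarrow> ((real \<Rightarrow> complex) \<Rightarrow> 'z::complex_banach) set"
  where "distributions I = {f.
    (\<forall>\<phi>\<in>test_functions I. \<forall>\<psi>\<in>test_functions I. \<forall>a b.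
      f (\<lambda>t. a * \<phi> t + b * \<psi> t) = a *\<^sub>C f \<phi> + b *\<^sub>C f \<psi>) \<and>
    continuous_map (test_topology I) euclidean f}"

text \<open>
  Integrals are Henstock--Kurzweil integrals, as the library's Bochner integral requires
  separable target spaces. All integrands below are continuous with integrable norm, so both
  integrals coincide.
\<close>

definition fourier :: "(real \<Rightarrow> complex) \<Rightarrow> real \<Rightarrow> complex"
  where "fourier \<phi> \<xi> = integral UNIV (\<lambda>t. exp (- \<i> * of_real \<xi> * of_real t) * \<phi> t)"

definition dist_of_fun :: "(real \<Rightarrow> 'z::complex_banach) \<Rightarrow> (real \<Rightarrow> complex) \<Rightarrow> 'z"
  where "dist_of_fun g \<phi> = integral UNIV (\<lambda>t. \<phi> t *\<^sub>C g t)"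

definition fourier_dist :: "((real \<Rightarrow> complex) \<Rightarrow> 'z) \<Rightarrow> (real \<Rightarrow> complex) \<Rightarrow> 'z::complex_banach"
  where "fourier_dist u = (\<lambda>\<phi>\<in>schwartz. u (fourier \<phi>))"

definition C0_functions :: "(real \<Rightarrow> 'z::complex_banach) set"
  where "C0_functions = {g. continuous_on UNIV g \<and> (g \<longlongrightarrow> 0) at_infinity}"

definition PF :: "((real \<Rightarrow> complex) \<Rightarrow> 'z::complex_banach) set"
  where "PF = (\<lambda>g. fourier_dist (dist_of_fun g)) ` C0_functions"

definition PF_loc :: "real set \<Rightarrow> ((real \<Rightarrow> complex) \<Rightarrow> 'z::complex_banach) set"
  where "PF_loc I = {f \<in> distributions I.
    \<forall>\<xi>\<^sub>0\<in>I. \<exists>I'. open I' \<and> \<xi>\<^sub>0 \<in> I' \<and> I' \<subseteq> I \<and>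
      (\<exists>u\<in>PF. \<forall>\<phi>\<in>test_functions I'. f \<phi> = u \<phi>)}"


section \<open>The local pseudofunction spectrum\<close>

definition boundary_resolvent ::
    "('a::complex_banach \<rightharpoonup> 'a) \<Rightarrow> 'a \<Rightarrow> (real \<Rightarrow> complex) \<Rightarrow> 'a"
  where "boundary_resolvent A x = (\<lambda>\<phi>\<in>schwartz. Lim (at_right 0)
    (\<lambda>\<alpha>. integral UNIV (\<lambda>\<xi>. \<phi> \<xi> *\<^sub>C resolvent A (of_real \<alpha> + \<i> * of_real \<xi>) x)))"

text \<open>
  Being a local pseudofunction is a local property, so the union of all admissible open sets is
  the largest admissible one.
\<close>

definition PF_spectrum :: "('a::complex_banach \<rightharpoonup> 'a) \<Rightarrow> complex set"
  where "PF_spectrum A = (\<lambda>\<xi>. \<i> * complex_of_real \<xi>) `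
    (- \<Union> {I. open I \<and> (\<forall>x. boundary_resolvent A x \<in> PF_loc I)})"

end

theory Submission
  imports Defs
begin

text \<open>
  If the orbits of \<open>T\<close> are relatively compact, then the Abel means \<open>\<alpha> R(\<alpha> + \<i> \<xi>, A) x\<close> converge for every
  \<open>\<xi>\<close> and \<open>x\<close>; this is the mean ergodic theorem for the bounded semigroup \<open>exp (- \<i> \<xi> t) T(t)\<close>
  (\<open>abel_convergent\<close>), and \<open>M\<close> may be the whole space.

  For the converse, let \<open>X\<^sub>0\<close> be the set of all vectors with relatively compact orbit
  (\<open>ap_vectors\<close>). A vector belongs to \<open>X\<^sub>0\<close> as soon as its orbit comes arbitrarily close to \<open>X\<^sub>0\<close>, because
  a bounded piece of an orbit is compact (\<open>ap_vectorsI_late\<close>). So everything may be computed modulo \<open>X\<^sub>0\<close>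
  and modulo functions that vanish at infinity, and the proof is a spectral analysis of orbits in this
  quotient. The orbit is filtered by a test function \<open>\<phi>\<close> on the frequency axis; the filtered orbit is
  called \<open>smear \<phi> x\<close>, and \<open>x\<close> is tame for \<open>\<phi>\<close> if the filtered orbit approaches \<open>X\<^sub>0\<close>. A frequency is
  regular if, for all \<open>\<phi>\<close> supported near it, every vector is tame.

  Frequencies off the local pseudofunction spectrum are regular: there the boundary values of
  the resolvent agree with the Fourier transform of a function in \<open>C\<^sub>0\<close>, and the filtered orbit
  tends to \<open>0\<close> (\<open>pseudofunction_tame\<close>). Hence the exceptional frequencies form a closed countable set. If
  it is not empty, it has an isolated point \<open>\<xi>\<close>. A test function that vanishes at \<open>\<xi>\<close> can be approximated
  by test functions that vanish near \<open>\<xi>\<close>, so every vector is tame for it (\<open>tame_vanishing\<close>). Replacing \<open>z\<close>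
  by \<open>exp (- \<i> \<xi> h) T(h) z - z\<close> multiplies \<open>\<phi>\<close> by a function that vanishes at \<open>\<xi>\<close>; it follows that such
  vectors are tame for every \<open>\<phi>\<close> supported near \<open>\<xi>\<close>, and so are the vectors \<open>x - \<alpha> R(\<alpha> + \<i> \<xi>, A) x\<close>
  (\<open>abel_diff_tame\<close>). For \<open>x \<in> M\<close> the means converge to an eigenvector, which lies in \<open>X\<^sub>0\<close>. Therefore \<open>M\<close>,
  and by density the whole space, is tame for \<open>\<phi>\<close>, which makes \<open>\<xi>\<close> regular, a contradiction
  (\<open>regular_UNIV\<close>).

  Once all frequencies are regular, every orbit is a uniform limit of filtered orbits, up to constant
  factors, and thus approaches \<open>X\<^sub>0\<close> (\<open>regular_imp_ap\<close>).
\<close>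

section \<open>Scalar multiplication and improper integrals\<close>

interpretation scaleC: bounded_bilinear "scaleC :: complex \<Rightarrow> 'a::complex_banach \<Rightarrow> 'a"
proof
  fix a b :: complex and x y :: 'a and r :: real
  show "(a + b) *\<^sub>C x = a *\<^sub>C x + b *\<^sub>C x" "a *\<^sub>C (x + y) = a *\<^sub>C x + a *\<^sub>C y"
    by (simp_all add: scaleC_add_left scaleC_add_right)
  show "(r *\<^sub>R a) *\<^sub>C x = r *\<^sub>R a *\<^sub>C x"
    by (simp add: scaleR_scaleC[of r "a *\<^sub>C x"] scaleC_scaleC scaleR_conv_of_real)
  show "a *\<^sub>C (r *\<^sub>R x) = r *\<^sub>R a *\<^sub>C x"
    by (simp add: scaleR_scaleC[of r "a *\<^sub>C x"] scaleR_scaleC[of r x] scaleC_scaleC mult.commute)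
  show "\<exists>K. \<forall>(a::complex) x::'a. norm (a *\<^sub>C x) \<le> norm a * norm x * K"
    by (intro exI[of _ 1]) (simp add: norm_scaleC)
qed

lemmas scaleC_continuous_on [continuous_intros] = scaleC.continuous_on
lemmas scaleC_tendsto [tendsto_intros] = scaleC.tendsto

lemma scaleC_one [simp]: "1 *\<^sub>C x = x"
  using scaleR_scaleC[of 1 x] by simp

lemma bounded_linear_scaleC_right: "bounded_linear (\<lambda>x::'a::complex_banach. c *\<^sub>C x)"
  by (rule scaleC.bounded_linear_right)

text \<open>Domination by an integrable real function takes the place of absolute integrability, since the
  target space may be nonseparable.\<close>

lemma integrable_dominated:
  fixes F :: "real \<Rightarrow> 'b::banach"
  assumes F: "continuous_on S F" and S: "closed S" "is_interval S"
    and le: "\<And>x. x \<in> S \<Longrightarrow> norm (F x) \<le> g x" and g: "g integrable_on S"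
  shows "F integrable_on S"
proof (rule integrable_on_all_intervals_integrable_bound[OF _ le g])
  fix a b :: real
  have "compact (S \<inter> {a..b})" "connected (S \<inter> {a..b})"
    using S by (auto simp: closed_Int_compact is_interval_connected_1 [symmetric] is_interval_Int is_interval_cc)
  then obtain c d where cd: "S \<inter> {a..b} = {c..d}"
    using connected_compact_interval_1 by metis
  then have "F integrable_on S \<inter> {a..b}"
    unfolding cd by (intro integrable_continuous_real continuous_on_subset[OF F]) (use cd in blast)
  then show "(\<lambda>x. if x \<in> S then F x else 0) integrable_on cbox a b"
    by (simp only: integrable_restrict_Int box_real)
qed

lemma has_integral_UNIV_iff:
  fixes f :: "real \<Rightarrow> 'b::banach"
  shows "(f has_integral I) UNIV \<longleftrightarrow> (\<forall>e>0. \<exists>B>0. \<forall>a b. a \<le> - B \<and> B \<le> b \<longrightarrow>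
      (\<exists>z. (f has_integral z) {a..b} \<and> norm (z - I) < e))"
proof -
  have "ball 0 B \<subseteq> cbox a b \<longleftrightarrow> a \<le> - B \<and> B \<le> b" if "B > 0" for a b B :: real
    using that by (simp add: ball_eq_greaterThanLessThan greaterThanLessThan_subseteq_atLeastAtMost_iff)
  then show ?thesis
    using has_integral'[of f I UNIV] by (simp only: UNIV_I if_True box_real cong: conj_cong)
qed

lemma has_integral_affine_UNIV:
  fixes f :: "real \<Rightarrow> 'b::banach"
  assumes f: "(f has_integral I) UNIV" and m: "m > 0"
  shows "((\<lambda>x. f (m * x + c)) has_integral I /\<^sub>R m) UNIV"
  unfolding has_integral_UNIV_iff
proof (intro allI impI)
  fix e :: real assume "e > 0"
  then have "m * e > 0" using m by simp
  then obtain B where B: "B > 0" "\<forall>a b. a \<le> - B \<and> B \<le> b \<longrightarrow>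
      (\<exists>z. (f has_integral z) {a..b} \<and> norm (z - I) < m * e)"
    using has_integral_UNIV_iff[THEN iffD1, OF f, rule_format, OF \<open>m * e > 0\<close>] by (elim exE conjE)
  show "\<exists>B>0. \<forall>a b. a \<le> - B \<and> B \<le> b \<longrightarrow> (\<exists>z. ((\<lambda>x. f (m * x + c))
      has_integral z) {a..b} \<and> norm (z - I /\<^sub>R m) < e)"
  proof (intro exI[of _ "(B + \<bar>c\<bar>) / m"] conjI allI impI)
    show "0 < (B + \<bar>c\<bar>) / m" using B(1) m by simp
    fix a b :: real assume ab: "a \<le> - ((B + \<bar>c\<bar>) / m) \<and> (B + \<bar>c\<bar>) / m \<le> b"
    then have "m * a + c \<le> - B" "B \<le> m * b + c"
      using m by (simp_all add: field_simps abs_if split: if_splits)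
    then obtain z where z: "(f has_integral z) {m * a + c..m * b + c}" "norm (z - I) < m * e"
      using B(2) by blast
    have "((\<lambda>x. f (m * x + c)) has_integral z /\<^sub>R m) {a..b}"
      using has_integral_affinity'[of f z "m * a + c" "m * b + c" m c] z(1) m by (simp add: mult.assoc[symmetric])
    moreover have "norm (z /\<^sub>R m - I /\<^sub>R m) < e"
      unfolding scaleR_diff_right[symmetric] norm_scaleR using z(2) m by (simp add: field_simps)
    ultimately show "\<exists>z. ((\<lambda>x. f (m * x + c)) has_integral z) {a..b} \<and> norm (z - I /\<^sub>R m) < e"
      by blast
  qed
qed

lemma integral_shift_UNIV:
  fixes f :: "real \<Rightarrow> 'b::banach"
  assumes "f integrable_on UNIV"
  shows "(\<lambda>x. f (x + c)) integrable_on UNIV" "integral UNIV (\<lambda>x. f (x + c)) = integral UNIV f"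
  using has_integral_affine_UNIV[OF integrable_integral[OF assms], of 1 c]
  by (simp_all add: has_integral_iff)

lemma Poisson_weight_has_integral:
  assumes "s > 0"
  shows "((\<lambda>v. c / (s\<^sup>2 + v\<^sup>2)) has_integral c * pi / s) (UNIV::real set)"
proof -
  have "((\<lambda>v. inverse (1 + v\<^sup>2)) has_integral pi) (UNIV::real set)"
    unfolding has_integral_UNIV_iff
  proof (intro allI impI)
    fix e :: real assume "e > 0"
    have "\<forall>\<^sub>F t in at_top. arctan t > pi / 2 - e / 2"
      using tendsto_arctan_at_top \<open>e > 0\<close> by (intro order_tendstoD(1)[where y="pi/2"]) auto
    then obtain B where B: "\<And>t. t \<ge> B \<Longrightarrow> arctan t > pi / 2 - e / 2"
      by (auto simp: eventually_at_top_linorder)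
    have "((\<lambda>x. inverse (1 + x\<^sup>2)) has_integral arctan b - arctan a) {a..b} \<and>
        norm ((arctan b - arctan a) - pi) < e" if ab: "a \<le> - max B 1" "max B 1 \<le> b" for a b
    proof
      show "((\<lambda>x. inverse (1 + x\<^sup>2)) has_integral arctan b - arctan a) {a..b}"
        using ab by (intro fundamental_theorem_of_calculus)
          (auto intro!: derivative_eq_intros simp flip: has_real_derivative_iff_has_vector_derivative)
      have "B \<le> b" "B \<le> - a"
        using ab max.cobounded1[of B 1] by linarith+
      then show "norm ((arctan b - arctan a) - pi) < e"
        using B[of b] B[of "- a"] arctan_ubound[of b] arctan_lbound[of a]
        by (simp add: arctan_minus abs_less_iff)
    qed
    then show "\<exists>B>0. \<forall>a b. a \<le> - B \<and> B \<le> b \<longrightarrow> (\<exists>z. ((\<lambda>x. inverse (1 + x\<^sup>2))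
        has_integral z) {a..b} \<and> norm (z - pi) < e)"
      by (intro exI[of _ "max B 1"]) auto
  qed
  from has_integral_affine_UNIV[OF this, of "1 / s" 0]
  have "((\<lambda>v. inverse (1 + (v / s)\<^sup>2)) has_integral pi * s) UNIV"
    using assms by (simp add: mult.commute)
  from has_integral_mult_right[OF this, of "c / s\<^sup>2"]
  have "((\<lambda>v. c / s\<^sup>2 * inverse (1 + (v / s)\<^sup>2)) has_integral c * pi / s) UNIV"
    using assms by (simp add: power2_eq_square)
  moreover have "c / s\<^sup>2 * inverse (1 + (v / s)\<^sup>2) = c / (s\<^sup>2 + v\<^sup>2)" for v
    using assms by (simp add: field_simps)
  ultimately show ?thesis by simp
qed

section \<open>Smooth functions and plateau functions\<close>

abbreviation derivf :: "(real \<Rightarrow> complex) \<Rightarrow> real \<Rightarrow> complex"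
  where "derivf f \<equiv> \<lambda>t. vector_derivative f (at t)"

text \<open>Smoothness is always shown by exhibiting a set of functions that is closed under
  differentiation, so no formula for a higher derivative is ever needed.\<close>

lemma smooth_coinduct:
  assumes "f \<in> S"
    and S: "\<And>g. g \<in> S \<Longrightarrow> \<exists>g'\<in>S. \<forall>t. (g has_vector_derivative g' t) (at t)"
  shows "smooth f"
proof -
  have D: "derivf g \<in> S \<and> (\<forall>t. g differentiable (at t))" if "g \<in> S" for g
  proof -
    obtain g' where g': "g' \<in> S" "\<And>t. (g has_vector_derivative g' t) (at t)"
      using S[OF \<open>g \<in> S\<close>] by metis
    have "derivf g = g'"
      by (intro ext vector_derivative_at g')
    with g' show ?thesis
      using differentiableI_vector by metis
  qed
  have "nth_deriv n f \<in> S" for n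
    by (induction n) (use assms(1) D in \<open>auto simp: nth_deriv_def\<close>)
  then show ?thesis
    using D unfolding smooth_def by blast
qed

lemma smooth_derivf:
  assumes "smooth f"
  shows "smooth (derivf f)"
proof -
  have "nth_deriv n (derivf f) = nth_deriv (Suc n) f" for n
    unfolding nth_deriv_def funpow_Suc_right by simp
  then show ?thesis
    using assms unfolding smooth_def by metis
qed

lemma smooth_has_derivative:
  assumes "smooth f"
  shows "(f has_vector_derivative derivf f t) (at t)"
proof -
  have "nth_deriv 0 f differentiable (at t)"
    using assms unfolding smooth_def by blast
  then show ?thesis
    by (simp add: nth_deriv_def vector_derivative_works)
qed

lemma smooth_imp_continuous_on: "smooth f \<Longrightarrow> continuous_on S f"
  using smooth_has_derivative has_vector_derivative_continuous
  by (metis continuous_at_imp_continuous_on)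

inductive_set smooth_algebra :: "(real \<Rightarrow> complex) set" where
  base: "smooth f \<Longrightarrow> f \<in> smooth_algebra"
| add: "f \<in> smooth_algebra \<Longrightarrow> g \<in> smooth_algebra \<Longrightarrow> (\<lambda>t. f t + g t) \<in> smooth_algebra"
| mult: "f \<in> smooth_algebra \<Longrightarrow> g \<in> smooth_algebra \<Longrightarrow> (\<lambda>t. f t * g t) \<in> smooth_algebra"

lemma smooth_algebra_derivative:
  "f \<in> smooth_algebra \<Longrightarrow> \<exists>f'\<in>smooth_algebra. \<forall>t. (f has_vector_derivative f' t) (at t)"
proof (induction rule: smooth_algebra.induct)
  case (base f)
  then show ?case
    by (intro bexI[of _ "derivf f"]) (auto intro: smooth_has_derivative smooth_algebra.base smooth_derivf)
next
  case (add f g)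
  then obtain f' g' where "f' \<in> smooth_algebra" "g' \<in> smooth_algebra"
    "\<forall>t. (f has_vector_derivative f' t) (at t)" "\<forall>t. (g has_vector_derivative g' t) (at t)" by blast
  then show ?case
    by (intro bexI[of _ "\<lambda>t. f' t + g' t"]) (auto intro: smooth_algebra.add has_vector_derivative_add)
next
  case (mult f g)
  then obtain f' g' where "f' \<in> smooth_algebra" "g' \<in> smooth_algebra"
    "\<forall>t. (f has_vector_derivative f' t) (at t)" "\<forall>t. (g has_vector_derivative g' t) (at t)" by blast
  with mult show ?case
    by (intro bexI[of _ "\<lambda>t. f t * g' t + f' t * g t"])
      (auto intro: smooth_algebra.add smooth_algebra.mult has_vector_derivative_mult)
qed

lemma smooth_algebra_smooth: "f \<in> smooth_algebra \<Longrightarrow> smooth f"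
  by (rule smooth_coinduct[OF _ smooth_algebra_derivative])

lemma smooth_add: "smooth f \<Longrightarrow> smooth g \<Longrightarrow> smooth (\<lambda>t. f t + g t)"
  and smooth_mult: "smooth f \<Longrightarrow> smooth g \<Longrightarrow> smooth (\<lambda>t. f t * g t)"
  by (auto intro!: smooth_algebra_smooth intro: smooth_algebra.intros)

lemma smooth_exp: "smooth (\<lambda>t. c * exp (a * of_real t))"
proof (rule smooth_coinduct[of _ "range (\<lambda>c t. c * exp (a * of_real t))"])
  fix g :: "real \<Rightarrow> complex" assume "g \<in> range (\<lambda>c t. c * exp (a * of_real t))"
  then obtain c where g: "g = (\<lambda>t. c * exp (a * of_real t))" by blast
  have *: "(g has_vector_derivative (c * a) * exp (a * of_real t)) (at t)" for t
  proof -
    have "((\<lambda>z. c * exp (a * z)) has_field_derivative (c * a) * exp (a * of_real t)) (at (of_real t))"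
      by (auto intro!: derivative_eq_intros)
    then show ?thesis
      unfolding g by (rule has_vector_derivative_real_field)
  qed
  show "\<exists>g'\<in>range (\<lambda>c t. c * exp (a * of_real t)). \<forall>t. (g has_vector_derivative g' t) (at t)"
  proof (rule bexI)
    show "\<forall>t. (g has_vector_derivative (\<lambda>t. (c * a) * exp (a * of_real t)) t) (at t)"
      using * by simp
  qed (rule rangeI)
qed auto

lemma smooth_const: "smooth (\<lambda>t. c)"
  using smooth_exp[of c 0] by simp

lemma smooth_diff: "smooth f \<Longrightarrow> smooth g \<Longrightarrow> smooth (\<lambda>t. f t - g t)"
  using smooth_add[of f "\<lambda>t. -1 * g t"] smooth_mult[OF smooth_const[of "-1"], of g] by simp

lemma affine_has_vector_derivative:
  assumes "smooth f"
  shows "((\<lambda>t. f (a * t + b)) has_vector_derivative of_real a * derivf f (a * t + b)) (at t)"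
proof -
  have "((\<lambda>t. a * t + b) has_vector_derivative a) (at t)"
    by (auto intro!: derivative_eq_intros simp flip: has_real_derivative_iff_has_vector_derivative)
  from vector_diff_chain_at[OF this smooth_has_derivative[OF assms]]
  show ?thesis by (simp add: o_def scaleR_conv_of_real)
qed

lemma smooth_affine:
  assumes "smooth f"
  shows "smooth (\<lambda>t. f (a * t + b))"
proof (rule smooth_coinduct[of _ "{\<lambda>t. c * h (a * t + b) | c h. smooth h}"])
  show "(\<lambda>t. f (a * t + b)) \<in> {\<lambda>t. c * h (a * t + b) | c h. smooth h}"
    using assms by (intro CollectI exI[of _ 1] exI[of _ f]) simp
  fix g :: "real \<Rightarrow> complex" assume "g \<in> {\<lambda>t. c * h (a * t + b) | c h. smooth h}"
  then obtain c h where h: "smooth h" and g: "g = (\<lambda>t. c * h (a * t + b))" by blast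
  have *: "(g has_vector_derivative (c * of_real a) * derivf h (a * t + b)) (at t)" for t
    using has_vector_derivative_mult_right[OF affine_has_vector_derivative[OF h, of a b t], of c]
    by (simp add: g mult.assoc)
  show "\<exists>g'\<in>{\<lambda>t. c * h (a * t + b) | c h. smooth h}. \<forall>t. (g has_vector_derivative g' t) (at t)"
  proof (rule bexI)
    show "\<forall>t. (g has_vector_derivative (\<lambda>t. (c * of_real a) * derivf h (a * t + b)) t) (at t)"
      using * by simp
  qed (intro CollectI exI[of _ "c * of_real a"] exI[of _ "derivf h"] conjI refl smooth_derivf h)
qed

text \<open>For fixed \<open>h\<close>, the quotients \<open>f / h ^ k\<close> with smooth \<open>f\<close> are closed under differentiation.\<close>

lemma smooth_divide:
  assumes f: "smooth f" and h: "smooth h" and nz: "\<And>t. h t \<noteq> 0"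
  shows "smooth (\<lambda>t. f t / h t)"
proof (rule smooth_coinduct[of _ "{\<lambda>t. f t / h t ^ k | f k. smooth f}"])
  show "(\<lambda>t. f t / h t) \<in> {\<lambda>t. f t / h t ^ k | f k. smooth f}"
    using f by (intro CollectI exI[of _ f] exI[of _ 1]) simp
  fix g :: "real \<Rightarrow> complex" assume "g \<in> {\<lambda>t. f t / h t ^ k | f k. smooth f}"
  then obtain f k where f: "smooth f" and g: "g = (\<lambda>t. f t / h t ^ k)" by blast
  let ?f' = "\<lambda>t. derivf f t * h t - of_nat k * (f t * derivf h t)"
  have *: "(g has_vector_derivative ?f' t / h t ^ Suc k) (at t)" for t
  proof -
    have "((\<lambda>z. z ^ k) has_field_derivative of_nat k * h t ^ (k - 1)) (at (h t))"
      by (auto intro!: derivative_eq_intros)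
    from field_vector_diff_chain_at[OF smooth_has_derivative[OF h] this]
    have pow: "((\<lambda>t. h t ^ k) has_vector_derivative derivf h t * (of_nat k * h t ^ (k - 1))) (at t)"
      by (simp add: o_def)
    have "((\<lambda>z. inverse z) has_field_derivative - (inverse (h t ^ k) ^ Suc (Suc 0))) (at (h t ^ k))"
      using nz by (intro DERIV_inverse) simp
    from field_vector_diff_chain_at[OF pow this]
    have "((\<lambda>t. inverse (h t ^ k)) has_vector_derivative
        derivf h t * (of_nat k * h t ^ (k - 1)) * - (inverse (h t ^ k) ^ Suc (Suc 0))) (at t)"
      by (simp add: o_def)
    from has_vector_derivative_mult[OF smooth_has_derivative[OF f] this]
    have "(g has_vector_derivative f t * (derivf h t * (of_nat k * h t ^ (k - 1))
        * - (inverse (h t ^ k) ^ Suc (Suc 0))) + derivf f t * inverse (h t ^ k)) (at t)"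
      by (simp add: g divide_inverse)
    moreover have "f t * (derivf h t * (of_nat k * h t ^ (k - 1)) * - (inverse (h t ^ k) ^ Suc (Suc 0)))
        + derivf f t * inverse (h t ^ k) = ?f' t / h t ^ Suc k"
      using nz[of t] by (cases k) (simp_all add: field_simps)
    ultimately show ?thesis by simp
  qed
  have "smooth ?f'"
    by (intro smooth_diff smooth_mult smooth_const smooth_derivf f h)
  then have "(\<lambda>t. ?f' t / h t ^ Suc k) \<in> {\<lambda>t. f t / h t ^ k | f k. smooth f}"
    by (intro CollectI exI[of _ ?f'] exI[of _ "Suc k"] conjI refl)
  then show "\<exists>g'\<in>{\<lambda>t. f t / h t ^ k | f k. smooth f}. \<forall>t. (g has_vector_derivative g' t) (at t)"
    using * by (rule_tac bexI) simp_all
qed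

text \<open>With \<open>p = 1\<close> this is the standard function that is flat at the origin; the factor \<open>p (1 / x)\<close> makes
  the family closed under differentiation.\<close>

definition flat :: "real poly \<Rightarrow> real \<Rightarrow> real"
  where "flat p x = (if x > 0 then poly p (1 / x) * exp (- (1 / x)) else 0)"

lemma poly_exp_tendsto_0: "((\<lambda>x::real. poly p x * exp (- x)) \<longlongrightarrow> 0) at_top"
proof -
  have "((\<lambda>x::real. \<Sum>i\<le>degree p. coeff p i * (x ^ i / exp x)) \<longlongrightarrow> (\<Sum>i\<le>degree p. coeff p i * 0)) at_top"
    by (intro tendsto_sum tendsto_mult tendsto_const tendsto_power_div_exp_0)
  then show ?thesis
    by (simp add: poly_altdef sum_distrib_right exp_minus divide_inverse mult.assoc)
qed

lemma flat_tendsto_0: "(flat p \<longlongrightarrow> 0) (at 0)"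
proof -
  have "((\<lambda>x. poly p (1 / x) * exp (- (1 / x))) \<longlongrightarrow> 0) (at_right 0)"
    using filterlim_compose[OF poly_exp_tendsto_0 filterlim_inverse_at_top_right]
    by (simp add: divide_inverse)
  then have "(flat p \<longlongrightarrow> 0) (at_right 0)"
    by (rule Lim_transform_eventually) (auto simp: flat_def eventually_at_filter)
  moreover have "(flat p \<longlongrightarrow> 0) (at_left 0)"
    by (rule Lim_transform_eventually[OF tendsto_const])
      (auto simp: flat_def eventually_at_filter)
  ultimately show ?thesis
    by (simp add: filterlim_split_at)
qed

lemma flat_has_derivative:
  "(flat p has_real_derivative flat (monom 1 2 * (p - pderiv p)) x) (at x)"
proof -
  consider "x > 0" | "x < 0" | "x = 0" by linarith
  then show ?thesis
  proof cases
    case 1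
    have inv: "((\<lambda>x. 1 / x) has_real_derivative - (1 / x\<^sup>2)) (at x)"
      using 1 by (auto intro!: derivative_eq_intros simp: power2_eq_square)
    have "((\<lambda>x. poly p (1 / x) * exp (- (1 / x))) has_real_derivative
        poly p (1 / x) * (exp (- (1 / x)) * - (- (1 / x\<^sup>2))) +
        poly (pderiv p) (1 / x) * - (1 / x\<^sup>2) * exp (- (1 / x))) (at x)"
      by (intro DERIV_mult' DERIV_chain2[OF DERIV_exp] DERIV_minus inv DERIV_chain2[OF poly_DERIV inv])
    moreover have "poly p (1 / x) * (exp (- (1 / x)) * - (- (1 / x\<^sup>2))) +
        poly (pderiv p) (1 / x) * - (1 / x\<^sup>2) * exp (- (1 / x)) = flat (monom 1 2 * (p - pderiv p)) x"
      using 1 by (simp add: flat_def poly_monom power_divide algebra_simps)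
    ultimately have d: "((\<lambda>x. poly p (1 / x) * exp (- (1 / x))) has_real_derivative
        flat (monom 1 2 * (p - pderiv p)) x) (at x)"
      by simp
    have e: "\<forall>\<^sub>F y in nhds x. poly p (1 / y) * exp (- (1 / y)) = flat p y"
      using eventually_nhds_in_open[of "{0<..}" x] 1 by (auto simp: flat_def elim: eventually_mono)
    show ?thesis
      by (rule DERIV_cong_ev[OF refl e refl, THEN iffD1, OF d])
  next
    case 2
    have d: "((\<lambda>x. 0) has_real_derivative flat (monom 1 2 * (p - pderiv p)) x) (at x)"
      using 2 by (simp add: flat_def)
    have e: "\<forall>\<^sub>F y in nhds x. 0 = flat p y"
      using eventually_nhds_in_open[of "{..<0}" x] 2 by (auto simp: flat_def elim: eventually_mono)
    show ?thesis
      by (rule DERIV_cong_ev[OF refl e refl, THEN iffD1, OF d])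
  next
    case 3
    have z: "flat q 0 = 0" for q
      by (simp add: flat_def)
    have "flat p h / h = flat (monom 1 1 * p) h" for h
      by (simp add: flat_def poly_monom)
    then show ?thesis
      using flat_tendsto_0[of "monom 1 1 * p"] 3 by (simp add: DERIV_def z)
  qed
qed

lemma smooth_flat: "smooth (\<lambda>t. of_real (flat p t))"
proof (rule smooth_coinduct[of _ "range (\<lambda>p t. of_real (flat p t))"])
  fix g :: "real \<Rightarrow> complex" assume "g \<in> range (\<lambda>p t. of_real (flat p t))"
  then obtain p where g: "g = (\<lambda>t. of_real (flat p t))" by blast
  have *: "(g has_vector_derivative of_real (flat (monom 1 2 * (p - pderiv p)) t)) (at t)" for t
    unfolding g by (intro has_vector_derivative_of_real flat_has_derivative)
  show "\<exists>g'\<in>range (\<lambda>p t. complex_of_real (flat p t)). \<forall>t. (g has_vector_derivative g' t) (at t)"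
  proof (rule bexI)
    show "\<forall>t. (g has_vector_derivative (\<lambda>t. of_real (flat (monom 1 2 * (p - pderiv p)) t)) t) (at t)"
      using * by simp
  qed (rule rangeI)
qed auto

lemma smooth_step_exists:
  "\<exists>s::real \<Rightarrow> real. smooth (\<lambda>t. of_real (s t)) \<and> (\<forall>t. 0 \<le> s t \<and> s t \<le> 1) \<and>
    (\<forall>t\<le>0. s t = 0) \<and> (\<forall>t\<ge>1. s t = 1)"
proof -
  let ?e = "flat 1"
  have nonneg: "?e t \<ge> 0" for t by (simp add: flat_def)
  have pos: "?e t + ?e (1 - t) > 0" for t
    using nonneg[of t] nonneg[of "1 - t"] by (cases "t > 0") (auto simp: flat_def add_pos_nonneg add_nonneg_pos)
  have "smooth (\<lambda>t. of_real (?e (1 - t)))"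
    using smooth_affine[OF smooth_flat[of 1], of "-1" 1] by simp
  moreover have "of_real (?e t) + of_real (?e (1 - t)) \<noteq> (0::complex)" for t
    using pos[of t] by (simp only: of_real_add[symmetric] of_real_eq_0_iff)
  ultimately have "smooth (\<lambda>t. of_real (?e t) / (of_real (?e t) + of_real (?e (1 - t))))"
    by (intro smooth_divide smooth_add smooth_flat)
  then have "smooth (\<lambda>t. of_real (?e t / (?e t + ?e (1 - t))))"
    by simp
  moreover have "0 \<le> ?e t / (?e t + ?e (1 - t)) \<and> ?e t / (?e t + ?e (1 - t)) \<le> 1" for t
    using nonneg[of t] nonneg[of "1 - t"] pos[of t] by simp
  moreover have "?e t / (?e t + ?e (1 - t)) = 0" if "t \<le> 0" for t
    using that by (simp add: flat_def)
  moreover have "?e t / (?e t + ?e (1 - t)) = 1" if "t \<ge> 1" for t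
    using that by (simp add: flat_def)
  ultimately show ?thesis
    by (intro exI[of _ "\<lambda>t. ?e t / (?e t + ?e (1 - t))"]) blast
qed

lemma plateau_exists:
  "\<exists>\<kappa>::real \<Rightarrow> real. smooth (\<lambda>t. of_real (\<kappa> t)) \<and> (\<forall>t. 0 \<le> \<kappa> t \<and> \<kappa> t \<le> 1) \<and>
    (\<forall>t. \<bar>t\<bar> \<le> 1 \<longrightarrow> \<kappa> t = 1) \<and> (\<forall>t. \<bar>t\<bar> \<ge> 2 \<longrightarrow> \<kappa> t = 0) \<and> (\<forall>t. \<kappa> (- t) = \<kappa> t)"
proof -
  obtain s :: "real \<Rightarrow> real" where s: "smooth (\<lambda>t. of_real (s t))" "\<And>t. 0 \<le> s t" "\<And>t. s t \<le> 1"
    "\<And>t. t \<le> 0 \<Longrightarrow> s t = 0" "\<And>t. t \<ge> 1 \<Longrightarrow> s t = 1"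
    using smooth_step_exists by blast
  have "smooth (\<lambda>t. of_real (s (2 + t)) * of_real (s (2 - t)))"
    using smooth_mult[OF smooth_affine[OF s(1), of 1 2] smooth_affine[OF s(1), of "-1" 2]]
    by (simp add: add.commute)
  then have "smooth (\<lambda>t. of_real (s (2 + t) * s (2 - t)))"
    by simp
  then show ?thesis
    by (intro exI[of _ "\<lambda>t. s (2 + t) * s (2 - t)"])
      (auto simp: s abs_le_iff abs_if mult_le_one mult.commute split: if_splits)
qed

lemma test_functionsI:
  assumes "smooth \<phi>" "compact K" "K \<subseteq> I" "\<And>t. t \<notin> K \<Longrightarrow> \<phi> t = 0"
  shows "\<phi> \<in> test_functions I"
proof -
  have "support \<phi> \<subseteq> K"
    unfolding support_def using assms by (intro closure_minimal compact_imp_closed) auto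
  moreover from this have "compact (support \<phi>)"
    using assms(2) by (metis closed_Int_compact closed_closure inf.absorb1 support_def)
  ultimately show ?thesis
    using assms by (auto simp: test_functions_def)
qed

lemma zero_outside_support: "t \<notin> support \<phi> \<Longrightarrow> \<phi> t = 0"
  using closure_subset[of "{t. \<phi> t \<noteq> 0}"] by (auto simp: support_def)

lemma test_functionsD:
  assumes "\<phi> \<in> test_functions I"
  shows "smooth \<phi>" "compact (support \<phi>)" "support \<phi> \<subseteq> I"
  using assms by (auto simp: test_functions_def)

lemma test_functions_mult:
  assumes "\<phi> \<in> test_functions I" "smooth \<psi>"
  shows "(\<lambda>t. \<phi> t * \<psi> t) \<in> test_functions I"
  using test_functionsD[OF assms(1)] assms(2) zero_outside_support[of _ \<phi>]
  by (intro test_functionsI[of _ "support \<phi>"] smooth_mult) auto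

lemma test_functions_add:
  assumes "\<phi> \<in> test_functions I" "\<psi> \<in> test_functions I"
  shows "(\<lambda>t. \<phi> t + \<psi> t) \<in> test_functions I"
  using test_functionsD[OF assms(1)] test_functionsD[OF assms(2)] zero_outside_support[of _ \<phi>]
    zero_outside_support[of _ \<psi>]
  by (intro test_functionsI[of _ "support \<phi> \<union> support \<psi>"] smooth_add) auto

lemma test_functions_mono: "I \<subseteq> J \<Longrightarrow> \<phi> \<in> test_functions I \<Longrightarrow> \<phi> \<in> test_functions J"
  by (auto simp: test_functions_def)

section \<open>Decay of Fourier transforms of test functions\<close>

lemma fourier_eq_integral:
  assumes "support \<phi> \<subseteq> {a..b}"
  shows "fourier \<phi> v = integral {a..b} (\<lambda>t. exp (- \<i> * of_real v * of_real t) * \<phi> t)"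
proof -
  have "\<phi> t = 0" if "t \<notin> {a..b}" for t
    using that assms zero_outside_support by blast
  then have eq: "(\<lambda>t. exp (- \<i> * of_real v * of_real t) * \<phi> t) =
      (\<lambda>t. if t \<in> {a..b} then exp (- \<i> * of_real v * of_real t) * \<phi> t else 0)"
    by auto
  show ?thesis
    unfolding fourier_def by (rule trans[OF arg_cong[where f="integral UNIV", OF eq] integral_restrict_UNIV])
qed

lemma compact_support_bounds:
  assumes "compact (support \<phi>)"
  obtains a b where "a < b" "support \<phi> \<subseteq> {a<..<b}"
proof -
  obtain B where B: "\<And>t. t \<in> support \<phi> \<Longrightarrow> \<bar>t\<bar> \<le> B"
    using compact_imp_bounded[OF assms] by (auto simp: bounded_iff)
  have "support \<phi> \<subseteq> {- \<bar>B\<bar> - 1<..<\<bar>B\<bar> + 1}"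
  proof
    fix t assume "t \<in> support \<phi>"
    then show "t \<in> {- \<bar>B\<bar> - 1<..<\<bar>B\<bar> + 1}"
      using B[of t] by auto
  qed
  then show thesis
    by (intro that[of "- \<bar>B\<bar> - 1" "\<bar>B\<bar> + 1"]) auto
qed

lemma fourier_continuous:
  assumes "\<phi> \<in> test_functions I"
  shows "continuous_on UNIV (fourier \<phi>)"
proof -
  obtain a b where ab: "support \<phi> \<subseteq> {a<..<b}"
    using compact_support_bounds test_functionsD[OF assms] by metis
  have "continuous_on (UNIV \<times> cbox a b) (\<lambda>(v, t). exp (- \<i> * of_real v * of_real t) * \<phi> t)"
    unfolding case_prod_beta
    by (intro continuous_intros continuous_on_compose2[OF smooth_imp_continuous_on[OF test_functionsD(1)[OF assms], of UNIV]]) auto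
  moreover have "fourier \<phi> = (\<lambda>v. integral (cbox a b) (\<lambda>t. exp (- \<i> * of_real v * of_real t) * \<phi> t))"
    unfolding box_real by (intro ext fourier_eq_integral) (use ab in \<open>auto simp: subset_eq less_imp_le\<close>)
  ultimately show ?thesis
    using integral_continuous_on_param[of UNIV a b "\<lambda>v t. exp (- \<i> * of_real v * of_real t) * \<phi> t"] by simp
qed

lemma norm_exp_imaginary [simp]: "cmod (exp (- (\<i> * of_real v * of_real t))) = 1"
  by (simp add: norm_exp_eq_Re)

text \<open>A function that varies on the scale \<open>1 / s\<close> has a second derivative about \<open>s\<^sup>2\<close> times as large as
  itself. Both terms on the right are then of the same size, and if the interval has length about
  \<open>1 / s\<close>, division by \<open>s\<^sup>2 + v\<^sup>2\<close> bounds the \<open>L\<^sup>1\<close> norm of the transform by a multiple of \<open>B0\<close>.\<close>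

lemma fourier_decay:
  assumes \<phi>: "smooth \<phi>" and supp: "support \<phi> \<subseteq> {a<..<b}" and "a \<le> b"
    and B0: "\<And>t. t \<in> {a..b} \<Longrightarrow> cmod (\<phi> t) \<le> B0"
    and B2: "\<And>t. t \<in> {a..b} \<Longrightarrow> cmod (derivf (derivf \<phi>) t) \<le> B2"
  shows "(s\<^sup>2 + v\<^sup>2) * cmod (fourier \<phi> v) \<le> (b - a) * (s\<^sup>2 * B0 + B2)"
proof -
  let ?e = "\<lambda>t::real. exp (- \<i> * of_real v * of_real t)"
  have four: "fourier \<phi> v = integral {a..b} (\<lambda>t. ?e t * \<phi> t)"
    using supp by (intro fourier_eq_integral) (auto simp: subset_eq less_imp_le)
  have cont: "continuous_on {a..b} (\<lambda>t. ?e t * f t)" if "smooth f" for f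
    using that by (intro continuous_intros smooth_imp_continuous_on)
  have i0: "(\<lambda>t. ?e t * \<phi> t) integrable_on {a..b}"
    by (intro integrable_continuous_real cont \<phi>)
  have i2: "(\<lambda>t. ?e t * derivf (derivf \<phi>) t) integrable_on {a..b}"
    by (intro integrable_continuous_real cont smooth_derivf \<phi>)
  have "cmod (fourier \<phi> v) \<le> B0 * (b - a)"
    unfolding four using B0 \<open>a \<le> b\<close> by (intro integral_bound cont \<phi>) (auto simp: norm_mult)
  then have 1: "s\<^sup>2 * cmod (fourier \<phi> v) \<le> s\<^sup>2 * (B0 * (b - a))"
    by (intro mult_left_mono) auto
  \<comment> \<open>Two integrations by parts at once: the derivative of this primitive has no first-order term.\<close>
  let ?g = "\<lambda>t. ?e t * (derivf \<phi> t + \<i> * of_real v * \<phi> t)"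
  have ends: "?g t = 0" if "t \<notin> support \<phi>" for t
    using nth_deriv_outside_support[OF that, of 1] zero_outside_support[OF that]
    by (simp add: nth_deriv_def)
  have e': "(?e has_vector_derivative - \<i> * of_real v * ?e t) (at t within {a..b})" for t
  proof -
    have "((\<lambda>z. exp (- \<i> * of_real v * z)) has_field_derivative - \<i> * of_real v * ?e t) (at (of_real t))"
      by (auto intro!: derivative_eq_intros)
    then show ?thesis
      by (rule has_vector_derivative_at_within[OF has_vector_derivative_real_field])
  qed
  have "(?g has_vector_derivative ?e t * derivf (derivf \<phi>) t + (of_real v)\<^sup>2 * (?e t * \<phi> t)) (at t within {a..b})" for t
  proof -
    have "(?g has_vector_derivative ?e t * (derivf (derivf \<phi>) t + \<i> * of_real v * derivf \<phi> t)
        + - \<i> * of_real v * ?e t * (derivf \<phi> t + \<i> * of_real v * \<phi> t)) (at t within {a..b})"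
      by (intro has_vector_derivative_mult e' has_vector_derivative_add has_vector_derivative_mult_right
          has_vector_derivative_at_within[OF smooth_has_derivative] smooth_derivf \<phi>)
    moreover have "?e t * (derivf (derivf \<phi>) t + \<i> * of_real v * derivf \<phi> t)
        + - \<i> * of_real v * ?e t * (derivf \<phi> t + \<i> * of_real v * \<phi> t) =
        ?e t * derivf (derivf \<phi>) t + (of_real v)\<^sup>2 * (?e t * \<phi> t) * - (\<i> * \<i>)"
      by (simp only: power2_eq_square ring_distribs ac_simps) simp
    ultimately show ?thesis by simp
  qed
  then have "((\<lambda>t. ?e t * derivf (derivf \<phi>) t + (of_real v)\<^sup>2 * (?e t * \<phi> t)) has_integral ?g b - ?g a) {a..b}"
    by (intro fundamental_theorem_of_calculus \<open>a \<le> b\<close>)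
  moreover have "?g b = 0" "?g a = 0"
    using supp by (intro ends; auto)+
  ultimately have "integral {a..b} (\<lambda>t. ?e t * derivf (derivf \<phi>) t + (of_real v)\<^sup>2 * (?e t * \<phi> t)) = 0"
    by (simp add: integral_unique)
  then have "integral {a..b} (\<lambda>t. ?e t * derivf (derivf \<phi>) t) = - ((of_real v)\<^sup>2 * fourier \<phi> v)"
    unfolding integral_add[OF i2 integrable_on_mult_right[OF i0]] integral_mult_right four
    by (simp only: eq_neg_iff_add_eq_0)
  moreover have "cmod (integral {a..b} (\<lambda>t. ?e t * derivf (derivf \<phi>) t)) \<le> B2 * (b - a)"
    using B2 \<open>a \<le> b\<close> by (intro integral_bound cont smooth_derivf \<phi>) (auto simp: norm_mult)
  ultimately have 2: "v\<^sup>2 * cmod (fourier \<phi> v) \<le> B2 * (b - a)"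
    by (simp add: norm_mult norm_power)
  from 1 2 show ?thesis
    by (simp add: algebra_simps)
qed

lemma test_function_fourier_bound:
  assumes "\<phi> \<in> test_functions I"
  obtains c where "c > 0" "\<And>v. cmod (fourier \<phi> v) \<le> c / (1 + v\<^sup>2)"
proof -
  have \<phi>: "smooth \<phi>"
    using test_functionsD[OF assms] by blast
  obtain a b where ab: "a < b" "support \<phi> \<subseteq> {a<..<b}"
    using compact_support_bounds test_functionsD[OF assms] by metis
  have bnd: "\<exists>B. \<forall>t\<in>{a..b}. cmod (f t) \<le> B" if "smooth f" for f
  proof -
    have "bounded (f ` {a..b})"
      using that by (intro compact_imp_bounded compact_continuous_image smooth_imp_continuous_on) auto
    then show ?thesis by (auto simp: bounded_iff)
  qed
  obtain B0 where B0: "\<And>t. t \<in> {a..b} \<Longrightarrow> cmod (\<phi> t) \<le> B0"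
    using bnd[OF \<phi>] by blast
  obtain B2 where B2: "\<And>t. t \<in> {a..b} \<Longrightarrow> cmod (derivf (derivf \<phi>) t) \<le> B2"
    using bnd[OF smooth_derivf[OF smooth_derivf[OF \<phi>]]] by blast
  define c where "c = \<bar>(b - a) * (B0 + B2)\<bar> + 1"
  show thesis
  proof (rule that)
    show "c > 0" by (simp add: c_def)
    fix v
    have "(1 + v\<^sup>2) * cmod (fourier \<phi> v) \<le> c"
      using fourier_decay[OF \<phi> ab(2) less_imp_le[OF ab(1)] B0 B2, of 1 v] by (simp add: c_def)
    then show "cmod (fourier \<phi> v) \<le> c / (1 + v\<^sup>2)"
      by (simp add: pos_le_divide_eq add_pos_nonneg mult.commute)
  qed
qed

lemma fourier_modulation:
  "fourier (\<lambda>\<xi>. \<phi> \<xi> * exp (\<i> * of_real h * of_real \<xi>)) v = fourier \<phi> (v - h)"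
proof -
  have "exp (- \<i> * of_real v * of_real t) * exp (\<i> * of_real h * of_real t) =
      exp (- \<i> * of_real (v - h) * of_real t)" for t
    by (subst exp_add[symmetric]) (simp add: algebra_simps)
  then show ?thesis
    unfolding fourier_def by (intro arg_cong[where f="integral UNIV"] ext) (simp add: mult.left_commute)
qed

lemma fourier_dilation:
  assumes "(\<lambda>t. exp (- \<i> * of_real (n * v) * of_real t) * \<phi> t) integrable_on UNIV" "n > 0"
  shows "fourier (\<lambda>\<xi>. \<phi> (\<xi> / n)) v = of_real n * fourier \<phi> (n * v)"
proof -
  from has_integral_affine_UNIV[OF integrable_integral[OF assms(1)], of "1 / n" 0]
  have "((\<lambda>t. exp (- \<i> * of_real (n * v) * of_real (1 / n * t)) * \<phi> (1 / n * t))
      has_integral n *\<^sub>R fourier \<phi> (n * v)) UNIV"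
    using assms(2) by (simp add: fourier_def)
  moreover have "- \<i> * of_real (n * v) * of_real (1 / n * t) = - \<i> * of_real v * of_real t" for t :: real
    using assms(2) by simp
  ultimately show ?thesis
    unfolding fourier_def by (simp add: integral_unique scaleR_conv_of_real)
qed

lemma test_function_kernel_integrable:
  assumes "\<phi> \<in> test_functions I"
  shows "(\<lambda>t. exp (- \<i> * of_real v * of_real t) * \<phi> t) integrable_on UNIV"
proof -
  obtain a b where ab: "support \<phi> \<subseteq> {a<..<b}"
    using compact_support_bounds test_functionsD[OF assms] by metis
  have "(\<lambda>t. exp (- \<i> * of_real v * of_real t) * \<phi> t) integrable_on {a..b}"
    using test_functionsD(1)[OF assms] by (intro integrable_continuous_real continuous_intros smooth_imp_continuous_on)
  then show ?thesis
    by (rule integrable_on_superset) (use ab zero_outside_support[of _ \<phi>] in force)+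
qed

lemma fourier_add:
  assumes "\<phi> \<in> test_functions I" "\<psi> \<in> test_functions J"
  shows "fourier (\<lambda>t. \<phi> t + \<psi> t) v = fourier \<phi> v + fourier \<psi> v"
  unfolding fourier_def using test_function_kernel_integrable[OF assms(1)] test_function_kernel_integrable[OF assms(2)]
  by (simp add: ring_distribs integral_add)

section \<open>Laplace transforms of orbits and the resolvent\<close>

definition laplace :: "(real \<Rightarrow> 'a::complex_banach) \<Rightarrow> complex \<Rightarrow> 'a"
  where "laplace F \<mu> = integral {0..} (\<lambda>u. exp (- (\<mu> * of_real u)) *\<^sub>C F u)"

lemma laplace_integrable:
  fixes F :: "real \<Rightarrow> 'a::complex_banach"
  assumes F: "continuous_on {0..} F" "\<And>u. u \<ge> 0 \<Longrightarrow> norm (F u) \<le> B" and \<mu>: "Re \<mu> > 0"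
  shows "h \<ge> 0 \<Longrightarrow> (\<lambda>u. exp (- (\<mu> * of_real u)) *\<^sub>C F u) integrable_on {h..}"
    and "norm (laplace F \<mu>) \<le> B / Re \<mu>"
proof -
  have bnd: "((\<lambda>u. B * exp (- Re \<mu> * u)) has_integral B * (exp (- Re \<mu> * h) / Re \<mu>)) {h..}" for h
    by (rule has_integral_mult_right[OF has_integral_exp_minus_to_infinity[OF \<mu>]])
  have le: "norm (exp (- (\<mu> * of_real u)) *\<^sub>C F u) \<le> B * exp (- Re \<mu> * u)" if "u \<in> {0..}" for u
    using F(2)[of u] that by (simp add: norm_scaleC norm_exp_eq_Re mult.commute mult_right_mono)
  show int: "(\<lambda>u. exp (- (\<mu> * of_real u)) *\<^sub>C F u) integrable_on {h..}" if "h \<ge> 0" for h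
    using bnd[of h] that
    by (intro integrable_dominated[OF _ _ _ le])
      (auto intro!: continuous_intros continuous_on_subset[OF F(1)] simp: has_integral_iff is_interval_ci)
  show "norm (laplace F \<mu>) \<le> B / Re \<mu>"
    unfolding laplace_def using integral_norm_bound_integral[OF int[OF order_refl] _ le] bnd[of 0]
    by (simp add: has_integral_iff)
qed

locale bounded_C0_semigroup =
  fixes T :: "real \<Rightarrow> 'a::complex_banach \<Rightarrow> 'a" and C :: real
  assumes C0: "C0_semigroup T" and C_pos: "C > 0"
    and norm_T: "\<And>t x. t \<ge> 0 \<Longrightarrow> norm (T t x) \<le> C * norm x"
begin

lemma T_linear: "t \<ge> 0 \<Longrightarrow> bounded_linear (T t)"
  and T_scaleC: "t \<ge> 0 \<Longrightarrow> T t (c *\<^sub>C x) = c *\<^sub>C T t x"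
  and T_0 [simp]: "T 0 x = x"
  and T_add: "s \<ge> 0 \<Longrightarrow> t \<ge> 0 \<Longrightarrow> T (s + t) x = T s (T t x)"
  and T_right_continuous: "((\<lambda>t. T t x) \<longlongrightarrow> x) (at_right 0)"
  using C0 by (auto simp: C0_semigroup_def bounded_clinear_def)

lemma T_diff: "t \<ge> 0 \<Longrightarrow> T t (x - y) = T t x - T t y"
  by (rule linear_diff[OF bounded_linear.linear[OF T_linear]])

lemma T_plus: "t \<ge> 0 \<Longrightarrow> T t (x + y) = T t x + T t y"
  by (rule linear_add[OF bounded_linear.linear[OF T_linear]])

lemma T_scaleR: "t \<ge> 0 \<Longrightarrow> T t (r *\<^sub>R x) = r *\<^sub>R T t x"
  by (rule linear_scale[OF bounded_linear.linear[OF T_linear]])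

lemma T_commute: "s \<ge> 0 \<Longrightarrow> t \<ge> 0 \<Longrightarrow> T s (T t x) = T t (T s x)"
  by (metis T_add add.commute)

lemma norm_T_diff:
  assumes "s \<ge> 0" "t \<ge> 0"
  shows "norm (T s x - T t x) \<le> C * norm (T \<bar>s - t\<bar> x - x)"
proof -
  have *: "norm (T s x - T t x) \<le> C * norm (T (s - t) x - x)" if "s \<ge> t" "t \<ge> 0" for s t
  proof -
    have "T s x - T t x = T t (T (s - t) x - x)"
      using that T_add[of t "s - t" x] by (simp add: T_diff)
    with that show ?thesis by (simp add: norm_T)
  qed
  show ?thesis
    using *[of s t] *[of t s] assms by (cases "s \<ge> t") (auto simp: norm_minus_commute abs_if)
qed

lemma T_near_0: "((\<lambda>t. T \<bar>t\<bar> x) \<longlongrightarrow> x) (nhds 0)"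
proof -
  have "((\<lambda>t. T \<bar>t\<bar> x) \<longlongrightarrow> x) (at_right 0)"
    using T_right_continuous by (rule Lim_transform_eventually) (auto simp: eventually_at_filter)
  moreover have "((\<lambda>t. T (- t) x) \<longlongrightarrow> x) (at_left 0)"
    using T_right_continuous[of x] by (simp add: filterlim_at_left_to_right)
  then have "((\<lambda>t. T \<bar>t\<bar> x) \<longlongrightarrow> x) (at_left 0)"
    by (rule Lim_transform_eventually) (auto simp: eventually_at_filter)
  ultimately have "((\<lambda>t. T \<bar>t\<bar> x) \<longlongrightarrow> T \<bar>0\<bar> x) (at 0)"
    by (simp add: filterlim_split_at)
  then show ?thesis
    using tendsto_at_iff_tendsto_nhds[of "\<lambda>t. T \<bar>t\<bar> x" 0] by simp
qed

text \<open>The orbit is continued to the left by its initial value so that it is continuous on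
  the whole line.\<close>

definition orb :: "'a \<Rightarrow> real \<Rightarrow> 'a"
  where "orb x u = T (max u 0) x"

lemma orb_nonneg: "u \<ge> 0 \<Longrightarrow> orb x u = T u x"
  by (simp add: orb_def max_def)

lemma norm_orb: "norm (orb x u) \<le> C * norm x"
  by (simp add: orb_def norm_T)

lemma orb_diff: "orb (x - y) u = orb x u - orb y u"
  by (simp add: orb_def T_diff)

lemma orb_scaleC: "orb (c *\<^sub>C x) u = c *\<^sub>C orb x u"
  by (simp add: orb_def T_scaleC)

lemma continuous_orb: "continuous_on S (orb x)"
proof -
  have "(orb x \<longlongrightarrow> orb x u) (at u)" for u
  proof -
    have "((\<lambda>v. max v 0 - max u 0) \<longlongrightarrow> max u 0 - max u 0) (at u)"
      by (intro tendsto_intros)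
    then have "((\<lambda>v. T \<bar>max v 0 - max u 0\<bar> x) \<longlongrightarrow> x) (at u)"
      by (intro filterlim_compose[OF T_near_0]) simp
    then have "((\<lambda>v. C * norm (T \<bar>max v 0 - max u 0\<bar> x - x)) \<longlongrightarrow> 0) (at u)"
      by (auto intro!: tendsto_eq_intros)
    then have "((\<lambda>v. orb x v - orb x u) \<longlongrightarrow> 0) (at u)"
      by (rule Lim_null_comparison[rotated]) (simp add: orb_def norm_T_diff)
    then show ?thesis
      by (simp add: LIM_zero_iff)
  qed
  then show ?thesis
    by (simp add: continuous_at_imp_continuous_on continuous_at)
qed

definition Res :: "complex \<Rightarrow> 'a \<Rightarrow> 'a"
  where "Res \<mu> x = laplace (orb x) \<mu>"

lemma Res_integrable:
  assumes "Re \<mu> > 0"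
  shows "(\<lambda>u. exp (- (\<mu> * of_real u)) *\<^sub>C orb x u) integrable_on {0..}"
  by (rule laplace_integrable(1)[OF continuous_orb norm_orb assms order_refl])

lemma norm_Res:
  assumes "Re \<mu> > 0"
  shows "norm (Res \<mu> x) \<le> C * norm x / Re \<mu>"
  unfolding Res_def by (rule laplace_integrable(2)[OF continuous_orb norm_orb assms])

lemma Res_diff: "Re \<mu> > 0 \<Longrightarrow> Res \<mu> (x - y) = Res \<mu> x - Res \<mu> y"
  unfolding Res_def laplace_def orb_diff scaleC.diff_right
  by (intro integral_diff Res_integrable)

lemma Res_scaleC: "Re \<mu> > 0 \<Longrightarrow> Res \<mu> (c *\<^sub>C x) = c *\<^sub>C Res \<mu> x"
  using integral_linear[OF Res_integrable[of \<mu> x] bounded_linear_scaleC_right[of c]]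
  by (simp add: Res_def laplace_def orb_scaleC o_def scaleC_scaleC mult.commute)

lemma bounded_linear_Res:
  assumes "Re \<mu> > 0"
  shows "bounded_linear (Res \<mu>)"
proof (rule bounded_linear_intro)
  show "Res \<mu> (x + y) = Res \<mu> x + Res \<mu> y" for x y
    using Res_diff[OF assms, of x "0 - y"] Res_diff[OF assms, of 0 y] Res_diff[OF assms, of 0 0] by simp
  show "Res \<mu> (r *\<^sub>R x) = r *\<^sub>R Res \<mu> x" for r x
    unfolding scaleR_scaleC by (rule Res_scaleC[OF assms])
  show "norm (Res \<mu> x) \<le> norm x * (C / Re \<mu>)" for x
    using norm_Res[OF assms, of x] by (simp add: mult.commute)
qed

lemma bounded_clinear_Res:
  assumes "Re \<mu> > 0" "bounded_linear h" "\<And>c x. h (c *\<^sub>C x) = c *\<^sub>C h x"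
    "\<And>t x. t \<ge> 0 \<Longrightarrow> h (T t x) = T t (h x)"
  shows "h (Res \<mu> x) = Res \<mu> (h x)"
  using integral_linear[OF Res_integrable[OF assms(1)] assms(2), of x]
  by (simp add: Res_def laplace_def orb_def o_def assms(3,4))

lemma Res_T_commute: "Re \<mu> > 0 \<Longrightarrow> t \<ge> 0 \<Longrightarrow> T t (Res \<mu> x) = Res \<mu> (T t x)"
  by (intro bounded_clinear_Res T_linear T_scaleC T_commute)

lemma Res_commute: "Re \<mu> > 0 \<Longrightarrow> Re \<nu> > 0 \<Longrightarrow> Res \<nu> (Res \<mu> x) = Res \<mu> (Res \<nu> x)"
  by (intro bounded_clinear_Res bounded_linear_Res Res_scaleC) (simp_all add: Res_T_commute)

text \<open>Shifting the Laplace integral: the orbit of \<open>Res \<mu> x\<close> is differentiable from the right, and its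
  derivative at \<open>0\<close> can be read off.\<close>

lemma T_Res:
  assumes \<mu>: "Re \<mu> > 0" and h: "h \<ge> 0"
  shows "T h (Res \<mu> x) = exp (\<mu> * of_real h) *\<^sub>C
    (Res \<mu> x - integral {0..h} (\<lambda>u. exp (- (\<mu> * of_real u)) *\<^sub>C orb x u))"
proof -
  let ?f = "\<lambda>u. exp (- (\<mu> * of_real u)) *\<^sub>C orb x u"
  let ?J = "integral {0..h} ?f"
  have int: "?f integrable_on {h..}" "?f integrable_on {0..h}"
    by (rule laplace_integrable(1)[OF continuous_orb norm_orb \<mu> h])
      (auto intro!: integrable_continuous_real continuous_intros continuous_orb)
  have un: "{0..h} \<union> {h..} = {0..}" and neg: "negligible ({0..h} \<inter> {h..})"
    using h by (auto simp: Int_atLeastAtMost)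
  have "(?f has_integral ?J + integral {h..} ?f) ({0..h} \<union> {h..})"
    by (intro has_integral_Un integrable_integral int neg)
  then have tail: "integral {h..} ?f = Res \<mu> x - ?J"
    unfolding un Res_def laplace_def by (simp add: integral_unique)
  let ?g = "\<lambda>u. if u \<in> {h..} then ?f u else 0"
  have "?g integrable_on UNIV"
    using int(1) by (simp only: integrable_restrict_UNIV)
  then have "integral UNIV (\<lambda>u. ?g (u + h)) = integral UNIV ?g"
    by (rule integral_shift_UNIV(2))
  also have "\<dots> = integral {h..} ?f"
    by (rule integral_restrict_UNIV)
  finally have "integral UNIV (\<lambda>u. ?g (u + h)) = integral {h..} ?f" .
  moreover have "?g (u + h) = (if u \<in> {0..} then exp (- (\<mu> * of_real h)) *\<^sub>C
      (exp (- (\<mu> * of_real u)) *\<^sub>C orb (T h x) u) else 0)" for u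
    using h by (auto simp: orb_nonneg T_add scaleC_scaleC ring_distribs exp_add[symmetric] minus_diff_commute)
  ultimately have "integral {0..} (\<lambda>u. exp (- (\<mu> * of_real h)) *\<^sub>C
      (exp (- (\<mu> * of_real u)) *\<^sub>C orb (T h x) u)) = Res \<mu> x - ?J"
    by (simp only: integral_restrict_UNIV tail)
  then have "exp (- (\<mu> * of_real h)) *\<^sub>C Res \<mu> (T h x) = Res \<mu> x - ?J"
    using integral_linear[OF Res_integrable[OF \<mu>, of "T h x"] bounded_linear_scaleC_right[of "exp (- (\<mu> * of_real h))"]]
    by (simp add: Res_def laplace_def o_def)
  then have "exp (\<mu> * of_real h) *\<^sub>C (exp (- (\<mu> * of_real h)) *\<^sub>C Res \<mu> (T h x)) =
      exp (\<mu> * of_real h) *\<^sub>C (Res \<mu> x - ?J)"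
    by simp
  then show ?thesis
    using Res_T_commute[OF \<mu> h] by (simp add: scaleC_scaleC exp_add[symmetric])
qed

lemma Res_derivative:
  assumes \<mu>: "Re \<mu> > 0"
  shows "((\<lambda>h. (T h (Res \<mu> x) - Res \<mu> x) /\<^sub>R h) \<longlongrightarrow> \<mu> *\<^sub>C Res \<mu> x - x) (at_right 0)"
proof -
  let ?f = "\<lambda>u. exp (- (\<mu> * of_real u)) *\<^sub>C orb x u"
  let ?D = "\<lambda>h. exp (\<mu> * of_real h) *\<^sub>C (Res \<mu> x - integral {0..h} ?f)"
  have "((\<lambda>z. exp (\<mu> * z)) has_field_derivative \<mu>) (at (of_real 0))"
    by (auto intro!: derivative_eq_intros)
  then have 1: "((\<lambda>h. exp (\<mu> * of_real h)) has_vector_derivative \<mu>) (at 0 within {0..1})"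
    by (rule has_vector_derivative_at_within[OF has_vector_derivative_real_field])
  have "((\<lambda>h. integral {0..h} ?f) has_vector_derivative ?f 0) (at 0 within {0..1})"
    by (rule integral_has_vector_derivative) (auto intro!: continuous_intros continuous_orb)
  then have 2: "((\<lambda>h. Res \<mu> x - integral {0..h} ?f) has_vector_derivative 0 - x) (at 0 within {0..1})"
    by (intro has_vector_derivative_diff has_vector_derivative_const) (simp add: orb_def)
  have "(?D has_vector_derivative
      exp (\<mu> * of_real 0) *\<^sub>C (0 - x) + \<mu> *\<^sub>C (Res \<mu> x - integral {0..0} ?f)) (at 0 within {0..1})"
    by (rule scaleC.has_vector_derivative[OF 1 2])
  then have "(?D has_vector_derivative \<mu> *\<^sub>C Res \<mu> x - x) (at 0 within {0..1})"
    by simp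
  then have "((\<lambda>h. (?D h - ?D 0 - h *\<^sub>R (\<mu> *\<^sub>C Res \<mu> x - x)) /\<^sub>R \<bar>h\<bar>) \<longlongrightarrow> 0) (at_right 0)"
    by (simp add: has_vector_derivative_def has_derivative_at_within at_within_Icc_at_right)
  then have "((\<lambda>h. (T h (Res \<mu> x) - Res \<mu> x) /\<^sub>R h - (\<mu> *\<^sub>C Res \<mu> x - x)) \<longlongrightarrow> 0) (at_right 0)"
    by (rule Lim_transform_eventually)
      (auto simp: eventually_at_filter T_Res[OF \<mu>] scaleR_diff_right intro!: always_eventually)
  then show ?thesis
    by (simp add: LIM_zero_iff)
qed

lemma generator_eqI: "((\<lambda>h. (T h y - y) /\<^sub>R h) \<longlongrightarrow> z) (at_right 0) \<Longrightarrow> generator T y = Some z"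
  unfolding generator_def by (auto simp: tendsto_Lim)

lemma generatorD:
  assumes "generator T y = Some z"
  shows "((\<lambda>h. (T h y - y) /\<^sub>R h) \<longlongrightarrow> z) (at_right 0)"
proof -
  obtain w where w: "((\<lambda>h. (T h y - y) /\<^sub>R h) \<longlongrightarrow> w) (at_right 0)"
    using assms by (auto simp: generator_def split: if_splits)
  with generator_eqI[OF w] assms show ?thesis by simp
qed

text \<open>The Laplace transform is continuous and commutes with the semigroup, so it may be applied to the
  difference quotients that define the generator.\<close>

lemma Res_left_inverse:
  assumes \<mu>: "Re \<mu> > 0" and y: "generator T y = Some z"
  shows "Res \<mu> (\<mu> *\<^sub>C y - z) = y"
proof -
  have "((\<lambda>h. Res \<mu> ((T h y - y) /\<^sub>R h)) \<longlongrightarrow> Res \<mu> z) (at_right 0)"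
    by (rule bounded_linear.tendsto[OF bounded_linear_Res[OF \<mu>] generatorD[OF y]])
  then have "((\<lambda>h. (T h (Res \<mu> y) - Res \<mu> y) /\<^sub>R h) \<longlongrightarrow> Res \<mu> z) (at_right 0)"
    by (rule Lim_transform_eventually)
      (auto simp: eventually_at_filter Res_T_commute[OF \<mu>] Res_diff[OF \<mu>]
        linear_scale[OF bounded_linear.linear[OF bounded_linear_Res[OF \<mu>]]] intro!: always_eventually)
  then have "Res \<mu> z = \<mu> *\<^sub>C Res \<mu> y - y"
    using Res_derivative[OF \<mu>, of y] tendsto_unique trivial_limit_at_right_real by blast
  then show ?thesis
    by (simp add: Res_diff[OF \<mu>] Res_scaleC[OF \<mu>])
qed

lemma resolvent_eq_Res:
  assumes \<mu>: "Re \<mu> > 0"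
  shows "resolvent (generator T) \<mu> x = Res \<mu> x"
  unfolding resolvent_def
proof (rule inv_into_f_eq)
  have gen: "generator T (Res \<mu> x) = Some (\<mu> *\<^sub>C Res \<mu> x - x)"
    by (rule generator_eqI[OF Res_derivative[OF \<mu>]])
  then show "Res \<mu> x \<in> dom (generator T)" "\<mu> *\<^sub>C Res \<mu> x - the (generator T (Res \<mu> x)) = x"
    by auto
  show "inj_on (\<lambda>x. \<mu> *\<^sub>C x - the (generator T x)) (dom (generator T))"
  proof (rule inj_on_inverseI[where g="Res \<mu>"])
    fix y assume "y \<in> dom (generator T)"
    then show "Res \<mu> (\<mu> *\<^sub>C y - the (generator T y)) = y"
      using Res_left_inverse[OF \<mu>] by force
  qed
qed

end

section \<open>Abel means\<close>

lemma Cauchy_imp_tendsto: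
  fixes f :: "'i \<Rightarrow> 'b::banach"
  assumes "F \<noteq> bot"
    and "\<And>e. e > 0 \<Longrightarrow> \<exists>P. eventually P F \<and> (\<forall>x y. P x \<and> P y \<longrightarrow> dist (f x) (f y) < e)"
  shows "\<exists>l. (f \<longlongrightarrow> l) F"
proof -
  have 1: "cauchy_filter (filtermap f F)"
    using assms(2) by (simp add: cauchy_filter_metric_filtermap)
  have 2: "filtermap f F \<noteq> bot" "filtermap f F \<le> principal UNIV"
    using assms(1) by (simp_all add: filtermap_bot_iff)
  obtain l where "filtermap f F \<le> nhds l"
    using complete_uniform[THEN iffD1, OF complete_UNIV, rule_format, OF 2(2) 2(1) 1] by (elim bexE)
  then show ?thesis
    unfolding filterlim_def by (rule exI)
qed

lemma relatively_compact_subset: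
  fixes A :: "'b::metric_space set"
  shows "A \<subseteq> K \<Longrightarrow> compact K \<Longrightarrow> compact (closure A)"
  using compact_Int_closed[of K "closure A"] closure_minimal[of A K] compact_imp_closed[of K]
  by (simp add: inf.absorb2)

context bounded_C0_semigroup
begin

definition abel :: "real \<Rightarrow> real \<Rightarrow> 'a \<Rightarrow> 'a"
  where "abel \<xi> \<alpha> x = \<alpha> *\<^sub>R Res (of_real \<alpha> + \<i> * of_real \<xi>) x"

text \<open>The rotation moves the frequency \<open>\<xi>\<close> to \<open>0\<close>, so that \<open>abel \<xi>\<close> are the Abel means of the rotated
  semigroup at zero frequency.\<close>

definition rot :: "real \<Rightarrow> real \<Rightarrow> 'a \<Rightarrow> 'a"
  where "rot \<xi> t x = exp (- (\<i> * of_real \<xi> * of_real t)) *\<^sub>C T t x"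

lemma norm_abel:
  assumes "\<alpha> > 0"
  shows "norm (abel \<xi> \<alpha> x) \<le> C * norm x"
  using norm_Res[of "of_real \<alpha> + \<i> * of_real \<xi>" x] assms by (simp add: abel_def field_simps)

lemma abel_diff: "\<alpha> > 0 \<Longrightarrow> abel \<xi> \<alpha> (x - y) = abel \<xi> \<alpha> x - abel \<xi> \<alpha> y"
  by (simp add: abel_def Res_diff scaleR_diff_right)

lemma abel_rot_commute:
  assumes "\<alpha> > 0" "t \<ge> 0"
  shows "rot \<xi> t (abel \<xi> \<alpha> x) = abel \<xi> \<alpha> (rot \<xi> t x)"
  using assms by (simp add: abel_def rot_def T_scaleR Res_T_commute Res_scaleC scaleC.scaleR_right)

lemma abel_commute:
  assumes "\<alpha> > 0" "\<beta> > 0"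
  shows "abel \<xi> \<alpha> (abel \<xi> \<beta> x) = abel \<xi> \<beta> (abel \<xi> \<alpha> x)"
  using assms by (simp add: abel_def scaleR_scaleC Res_scaleC scaleC_scaleC mult.commute
      Res_commute[of "of_real \<alpha> + \<i> * of_real \<xi>" "of_real \<beta> + \<i> * of_real \<xi>"])

text \<open>For a fixed time the bound vanishes with \<open>\<alpha>\<close>: Abel means over long times hardly notice a shift.\<close>

lemma rot_abel_diff:
  assumes \<alpha>: "\<alpha> > 0" and t: "t \<ge> 0"
  shows "norm (rot \<xi> t (abel \<xi> \<alpha> x) - abel \<xi> \<alpha> x)
    \<le> C * norm x * ((exp (\<alpha> * t) - 1) + exp (\<alpha> * t) * (\<alpha> * t))"
proof -
  let ?\<mu> = "of_real \<alpha> + \<i> * of_real \<xi> :: complex"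
  let ?J = "integral {0..t} (\<lambda>u. exp (- (?\<mu> * of_real u)) *\<^sub>C orb x u)"
  have \<mu>: "Re ?\<mu> > 0" using \<alpha> by simp
  have e: "exp (- (\<i> * of_real \<xi> * of_real t)) * exp (?\<mu> * of_real t) = of_real (exp (\<alpha> * t))"
    by (simp add: exp_add[symmetric] exp_of_real[symmetric] ring_distribs)
  have R: "rot \<xi> t (Res ?\<mu> x) = exp (\<alpha> * t) *\<^sub>R (Res ?\<mu> x - ?J)"
    unfolding rot_def T_Res[OF \<mu> t] scaleC_scaleC e scaleR_scaleC ..
  have eq: "rot \<xi> t (abel \<xi> \<alpha> x) - abel \<xi> \<alpha> x =
      (exp (\<alpha> * t) - 1) *\<^sub>R abel \<xi> \<alpha> x - (exp (\<alpha> * t) * \<alpha>) *\<^sub>R ?J"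
  proof -
    have "rot \<xi> t (abel \<xi> \<alpha> x) = \<alpha> *\<^sub>R rot \<xi> t (Res ?\<mu> x)"
      using t by (simp add: abel_def rot_def T_scaleR scaleC.scaleR_right)
    also have "\<dots> = \<alpha> *\<^sub>R exp (\<alpha> * t) *\<^sub>R (Res ?\<mu> x - ?J)"
      by (simp only: R)
    finally show ?thesis
      by (simp add: abel_def scaleR_diff_right scaleR_diff_left right_diff_distrib mult.commute)
  qed
  have "norm (exp (- (?\<mu> * of_real u)) *\<^sub>C orb x u) \<le> C * norm x" if "u \<ge> 0" for u
    using mult_mono[OF _ norm_orb[of x u], of "exp (- (\<alpha> * u))" 1] that \<alpha>
    by (simp add: norm_scaleC norm_exp_eq_Re)
  then have J: "norm ?J \<le> C * norm x * (t - 0)"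
    using t by (intro integral_bound) (auto intro!: continuous_intros continuous_orb)
  have "norm (rot \<xi> t (abel \<xi> \<alpha> x) - abel \<xi> \<alpha> x) \<le>
      (exp (\<alpha> * t) - 1) * norm (abel \<xi> \<alpha> x) + (exp (\<alpha> * t) * \<alpha>) * norm ?J"
    unfolding eq using \<alpha> t by (intro norm_triangle_le_diff add_mono) auto
  also have "\<dots> \<le> (exp (\<alpha> * t) - 1) * (C * norm x) + (exp (\<alpha> * t) * \<alpha>) * (C * norm x * (t - 0))"
    using \<alpha> t norm_abel[OF \<alpha>] J by (intro add_mono mult_left_mono) auto
  finally show ?thesis
    by (simp add: algebra_simps)
qed

lemma rot_abel_tendsto:
  assumes "t \<ge> 0"
  shows "((\<lambda>\<alpha>. rot \<xi> t (abel \<xi> \<alpha> x) - abel \<xi> \<alpha> x) \<longlongrightarrow> 0) (at_right 0)"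
proof (rule Lim_null_comparison)
  show "\<forall>\<^sub>F \<alpha> in at_right 0. norm (rot \<xi> t (abel \<xi> \<alpha> x) - abel \<xi> \<alpha> x)
      \<le> C * norm x * ((exp (\<alpha> * t) - 1) + exp (\<alpha> * t) * (\<alpha> * t))"
    using rot_abel_diff[OF _ assms] by (auto simp: eventually_at_filter)
  show "((\<lambda>\<alpha>. C * norm x * ((exp (\<alpha> * t) - 1) + exp (\<alpha> * t) * (\<alpha> * t))) \<longlongrightarrow> 0) (at_right 0)"
    by (auto intro!: tendsto_eq_intros)
qed

lemma abel_limit_eigenvector:
  assumes lim: "((\<lambda>\<alpha>. abel \<xi> \<alpha> x) \<longlongrightarrow> y) (at_right 0)" and t: "t \<ge> 0"
  shows "T t y = exp (\<i> * of_real \<xi> * of_real t) *\<^sub>C y"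
proof -
  have "((\<lambda>\<alpha>. rot \<xi> t (abel \<xi> \<alpha> x)) \<longlongrightarrow> rot \<xi> t y) (at_right 0)"
    unfolding rot_def by (intro tendsto_intros bounded_linear.tendsto[OF T_linear[OF t]] lim)
  then have "((\<lambda>\<alpha>. rot \<xi> t (abel \<xi> \<alpha> x) - abel \<xi> \<alpha> x) \<longlongrightarrow> rot \<xi> t y - y) (at_right 0)"
    by (intro tendsto_diff lim)
  then have "rot \<xi> t y - y = 0"
    using rot_abel_tendsto[OF t] tendsto_unique trivial_limit_at_right_real by blast
  then have "exp (\<i> * of_real \<xi> * of_real t) *\<^sub>C rot \<xi> t y = exp (\<i> * of_real \<xi> * of_real t) *\<^sub>C y"
    by simp
  then show ?thesis
    by (simp add: rot_def scaleC_scaleC exp_add[symmetric])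
qed

lemma abel_almost_fixed:
  assumes \<alpha>: "\<alpha> > 0" and "\<And>t. t \<ge> 0 \<Longrightarrow> norm (rot \<xi> t y - y) \<le> d"
  shows "norm (abel \<xi> \<alpha> y - y) \<le> d"
proof -
  let ?\<mu> = "of_real \<alpha> + \<i> * of_real \<xi> :: complex"
  let ?F = "\<lambda>u. exp (- (\<i> * of_real \<xi> * of_real u)) *\<^sub>C orb y u - y"
  have F: "continuous_on {0..} ?F" "\<And>u. u \<ge> 0 \<Longrightarrow> norm (?F u) \<le> d"
    using assms(2) by (auto intro!: continuous_intros continuous_orb simp: rot_def orb_nonneg)
  have "exp (- (of_real \<alpha> * of_real u)) *\<^sub>C y = exp (- \<alpha> * u) *\<^sub>R y" for u
    by (simp add: scaleR_scaleC exp_of_real[symmetric])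
  then have y: "((\<lambda>u. exp (- (of_real \<alpha> * of_real u)) *\<^sub>C y) has_integral (1 / \<alpha>) *\<^sub>R y) {0..}"
    using has_integral_scaleR_left[OF has_integral_exp_minus_to_infinity[OF \<alpha>, of 0], of y] by simp
  have "((\<lambda>u. exp (- (?\<mu> * of_real u)) *\<^sub>C orb y u - exp (- (of_real \<alpha> * of_real u)) *\<^sub>C y)
      has_integral Res ?\<mu> y - (1 / \<alpha>) *\<^sub>R y) {0..}"
    unfolding Res_def laplace_def using \<alpha>
    by (intro has_integral_diff integrable_integral Res_integrable y) auto
  moreover have "exp (- (?\<mu> * of_real u)) *\<^sub>C orb y u - exp (- (of_real \<alpha> * of_real u)) *\<^sub>C y =
      exp (- (of_real \<alpha> * of_real u)) *\<^sub>C ?F u" for u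
    by (simp add: scaleC.diff_right scaleC_scaleC exp_add[symmetric] ring_distribs)
  ultimately have "laplace ?F (of_real \<alpha>) = Res ?\<mu> y - (1 / \<alpha>) *\<^sub>R y"
    by (simp add: laplace_def integral_unique)
  then have "norm (Res ?\<mu> y - (1 / \<alpha>) *\<^sub>R y) \<le> d / \<alpha>"
    using laplace_integrable(2)[OF F, of "of_real \<alpha>"] \<alpha> by simp
  then have "\<alpha> * norm (Res ?\<mu> y - (1 / \<alpha>) *\<^sub>R y) \<le> d"
    using \<alpha> by (simp add: pos_le_divide_eq mult.commute)
  moreover have "abel \<xi> \<alpha> y - y = \<alpha> *\<^sub>R (Res ?\<mu> y - (1 / \<alpha>) *\<^sub>R y)"
    using \<alpha> by (simp add: abel_def scaleR_diff_right)
  ultimately show ?thesis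
    using \<alpha> by simp
qed

text \<open>Compactness gives finitely many times at which the rotated orbit comes close to each of its
  points. As Abel means commute with the rotated semigroup, invariance at these finitely many times
  becomes invariance at all times, up to a uniform error.\<close>

lemma abel_almost_invariant:
  assumes cpt: "compact (closure ((\<lambda>t. T t x) ` {0..}))" and e: "e > 0"
  shows "\<forall>\<^sub>F \<beta> in at_right 0. \<forall>t\<ge>0. norm (rot \<xi> t (abel \<xi> \<beta> x) - abel \<xi> \<beta> x) \<le> e"
proof -
  define d where "d = e / (C + 1)"
  have d: "d > 0" "C * d + d = e"
  proof -
    show "d > 0" using e C_pos by (simp add: d_def)
    have "d * (C + 1) = e" using C_pos by (simp add: d_def)
    then show "C * d + d = e" by (simp add: algebra_simps)
  qed
  let ?O = "(\<lambda>t. rot \<xi> t x) ` {0..}"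
  have "?O \<subseteq> (\<lambda>(c, y). c *\<^sub>C y) ` (sphere 0 1 \<times> closure ((\<lambda>t. T t x) ` {0..}))"
  proof
    fix z assume "z \<in> ?O"
    then obtain t where t: "t \<ge> 0" "z = rot \<xi> t x" by auto
    have "T t x \<in> closure ((\<lambda>t. T t x) ` {0..})"
      using t(1) closure_subset by fastforce
    moreover have "exp (- (\<i> * of_real \<xi> * of_real t)) \<in> sphere 0 1"
      by (simp add: norm_exp_eq_Re)
    ultimately show "z \<in> (\<lambda>(c, y). c *\<^sub>C y) ` (sphere 0 1 \<times> closure ((\<lambda>t. T t x) ` {0..}))"
      unfolding t(2) rot_def by (intro image_eqI[of _ _ "(_, _)"]) auto
  qed
  moreover have "compact ((\<lambda>(c, y). c *\<^sub>C y) ` (sphere 0 1 \<times> closure ((\<lambda>t. T t x) ` {0..})))"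
    unfolding case_prod_beta
    by (intro compact_continuous_image compact_Times cpt compact_sphere continuous_intros)
  ultimately have 1: "compact (closure ?O)"
    by (rule relatively_compact_subset)
  have 2: "closure ?O \<subseteq> (\<Union>t\<in>{0..}. ball (rot \<xi> t x) d)"
    using d(1) by (force simp: closure_approachable)
  obtain I where I: "I \<subseteq> {0..}" "finite I" "closure ?O \<subseteq> (\<Union>t\<in>I. ball (rot \<xi> t x) d)"
    by (rule compactE_image[OF 1 open_ball 2])
  have "\<forall>\<^sub>F \<beta> in at_right 0. \<forall>t\<in>I. norm (rot \<xi> t (abel \<xi> \<beta> x) - abel \<xi> \<beta> x) < d"
    using I(1) d(1) tendstoD[OF rot_abel_tendsto[of _ \<xi> x], of _ d]
    by (intro eventually_ball_finite I(2)) (auto simp: dist_norm)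
  moreover have "\<forall>\<^sub>F \<beta> in at_right (0::real). \<beta> > 0"
    by (rule eventually_at_right_less)
  ultimately show ?thesis
  proof eventually_elim
    case (elim \<beta>)
    show ?case
    proof (intro allI impI)
      fix t :: real assume "t \<ge> 0"
      then have "rot \<xi> t x \<in> closure ?O"
        using closure_subset[of ?O] by force
      then obtain s where s: "s \<in> I" "norm (rot \<xi> s x - rot \<xi> t x) < d"
        using I(3) by (auto simp: dist_norm)
      then have "s \<ge> 0" using I(1) by auto
      have "norm (abel \<xi> \<beta> (rot \<xi> t x - rot \<xi> s x)) \<le> C * norm (rot \<xi> t x - rot \<xi> s x)"
        using elim by (intro norm_abel) auto
      also have "\<dots> \<le> C * d"
        using s(2) C_pos by (intro mult_left_mono) (auto simp: norm_minus_commute)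
      finally have "norm (rot \<xi> t (abel \<xi> \<beta> x) - rot \<xi> s (abel \<xi> \<beta> x)) \<le> C * d"
        using elim \<open>t \<ge> 0\<close> \<open>s \<ge> 0\<close> by (simp add: abel_rot_commute abel_diff)
      moreover have "norm (rot \<xi> s (abel \<xi> \<beta> x) - abel \<xi> \<beta> x) < d"
        using elim s(1) by blast
      ultimately show "norm (rot \<xi> t (abel \<xi> \<beta> x) - abel \<xi> \<beta> x) \<le> e"
        using norm_diff_triangle_le[OF _ less_imp_le] d(2) by metis
    qed
  qed
qed

text \<open>The mean ergodic theorem. A mean that is almost fixed by the rotated semigroup is almost fixed by
  every other mean. Since the means commute, two of them with small parameters are therefore both
  close to their product, hence to each other.\<close>

lemma abel_convergent:
  assumes cpt: "compact (closure ((\<lambda>t. T t x) ` {0..}))"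
  shows "\<exists>l. ((\<lambda>\<alpha>. abel \<xi> \<alpha> x) \<longlongrightarrow> l) (at_right 0)"
proof (rule Cauchy_imp_tendsto)
  fix e :: real assume "e > 0"
  let ?P = "\<lambda>\<beta>. \<beta> > 0 \<and> (\<forall>t\<ge>0. norm (rot \<xi> t (abel \<xi> \<beta> x) - abel \<xi> \<beta> x) \<le> e / 3)"
  have "eventually ?P (at_right 0)"
    using abel_almost_invariant[OF cpt, of "e / 3" \<xi>] \<open>e > 0\<close>
    by (intro eventually_conj eventually_at_right_less) auto
  moreover have "dist (abel \<xi> \<alpha> x) (abel \<xi> \<beta> x) < e" if "?P \<alpha>" "?P \<beta>" for \<alpha> \<beta>
  proof -
    have "norm (abel \<xi> \<alpha> (abel \<xi> \<beta> x) - abel \<xi> \<beta> x) \<le> e / 3"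
      "norm (abel \<xi> \<beta> (abel \<xi> \<alpha> x) - abel \<xi> \<alpha> x) \<le> e / 3"
      by (rule abel_almost_fixed; use that in blast)+
    then have "norm (abel \<xi> \<alpha> (abel \<xi> \<beta> x) - abel \<xi> \<beta> x) \<le> e / 3"
      "norm (abel \<xi> \<alpha> (abel \<xi> \<beta> x) - abel \<xi> \<alpha> x) \<le> e / 3"
      using abel_commute[of \<alpha> \<beta>] that by auto
    then show ?thesis
      using \<open>e > 0\<close> norm_triangle_ineq4[of "abel \<xi> \<alpha> (abel \<xi> \<beta> x) - abel \<xi> \<beta> x" "abel \<xi> \<alpha> (abel \<xi> \<beta> x) - abel \<xi> \<alpha> x"]
      unfolding diff_diff_eq2 by (simp add: dist_norm)
  qed
  ultimately show "\<exists>P. eventually P (at_right 0) \<and> (\<forall>\<alpha> \<beta>. P \<alpha> \<and> P \<beta> \<longrightarrow>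
      dist (abel \<xi> \<alpha> x) (abel \<xi> \<beta> x) < e)"
    by blast
qed simp

section \<open>Vectors with relatively compact orbits\<close>

definition ap_vectors :: "'a set"
  where "ap_vectors = {x. compact (closure ((\<lambda>t. T t x) ` {0..}))}"

text \<open>Total boundedness of the orbit itself, which is easier to handle than compactness of its closure.\<close>

lemma ap_vectors_iff_finite_nets:
  "x \<in> ap_vectors \<longleftrightarrow> (\<forall>e>0. \<exists>k. finite k \<and> (\<forall>t\<ge>0. \<exists>z\<in>k. norm (T t x - z) < e))"
proof
  assume "x \<in> ap_vectors"
  then have tb: "\<forall>e>0. \<exists>k. finite k \<and> closure ((\<lambda>t. T t x) ` {0..}) \<subseteq> (\<Union>z\<in>k. ball z e)"
    by (simp add: ap_vectors_def compact_eq_totally_bounded)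
  show "\<forall>e>0. \<exists>k. finite k \<and> (\<forall>t\<ge>0. \<exists>z\<in>k. norm (T t x - z) < e)"
  proof (intro allI impI)
    fix e :: real assume "e > 0"
    then obtain k where k: "finite k" "closure ((\<lambda>t. T t x) ` {0..}) \<subseteq> (\<Union>z\<in>k. ball z e)"
      using tb by blast
    have "\<exists>z\<in>k. norm (T t x - z) < e" if "t \<ge> 0" for t
    proof -
      have "T t x \<in> closure ((\<lambda>t. T t x) ` {0..})"
        using that closure_subset by fastforce
      then have "T t x \<in> (\<Union>z\<in>k. ball z e)"
        by (rule subsetD[OF k(2)])
      then show ?thesis
        by (auto simp: dist_norm norm_minus_commute)
    qed
    with k(1) show "\<exists>k. finite k \<and> (\<forall>t\<ge>0. \<exists>z\<in>k. norm (T t x - z) < e)" by blast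
  qed
next
  assume nets: "\<forall>e>0. \<exists>k. finite k \<and> (\<forall>t\<ge>0. \<exists>z\<in>k. norm (T t x - z) < e)"
  have "\<exists>k. finite k \<and> closure ((\<lambda>t. T t x) ` {0..}) \<subseteq> (\<Union>z\<in>k. ball z e)" if "e > 0" for e
  proof -
    obtain k where k: "finite k" "\<And>t. t \<ge> 0 \<Longrightarrow> \<exists>z\<in>k. norm (T t x - z) < e / 2"
      using nets \<open>e > 0\<close> half_gt_zero by metis
    have "(\<lambda>t. T t x) ` {0..} \<subseteq> (\<Union>z\<in>k. cball z (e / 2))"
      using k(2) by (force simp: dist_norm norm_minus_commute)
    then have "closure ((\<lambda>t. T t x) ` {0..}) \<subseteq> (\<Union>z\<in>k. cball z (e / 2))"
      using k(1) by (intro closure_minimal closed_UN) auto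
    also have "\<dots> \<subseteq> (\<Union>z\<in>k. ball z e)"
      using \<open>e > 0\<close> by force
    finally show ?thesis using k(1) by blast
  qed
  then show "x \<in> ap_vectors"
    by (simp add: ap_vectors_def compact_eq_totally_bounded complete_eq_closed)
qed

lemma ap_vectors_add:
  assumes "x \<in> ap_vectors" "y \<in> ap_vectors"
  shows "x + y \<in> ap_vectors"
  unfolding ap_vectors_iff_finite_nets
proof (intro allI impI)
  fix e :: real assume "e > 0"
  then obtain k l where k: "finite k" "\<And>t. t \<ge> 0 \<Longrightarrow> \<exists>z\<in>k. norm (T t x - z) < e / 2"
    and l: "finite l" "\<And>t. t \<ge> 0 \<Longrightarrow> \<exists>z\<in>l. norm (T t y - z) < e / 2"
    using assms half_gt_zero unfolding ap_vectors_iff_finite_nets by metis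
  have "\<exists>z\<in>(\<lambda>(a, b). a + b) ` (k \<times> l). norm (T t (x + y) - z) < e" if t: "t \<ge> 0" for t
  proof -
    obtain a b where ab: "a \<in> k" "norm (T t x - a) < e / 2" "b \<in> l" "norm (T t y - b) < e / 2"
      using k(2)[OF t] l(2)[OF t] by blast
    have "norm (T t (x + y) - (a + b)) < e"
      using norm_triangle_ineq[of "T t x - a" "T t y - b"] ab t by (simp add: T_plus algebra_simps)
    with ab show ?thesis by force
  qed
  then show "\<exists>k. finite k \<and> (\<forall>t\<ge>0. \<exists>z\<in>k. norm (T t (x + y) - z) < e)"
    using k(1) l(1) by (intro exI[of _ "(\<lambda>(a, b). a + b) ` (k \<times> l)"]) auto
qed

lemma ap_vectors_scaleC:
  assumes "x \<in> ap_vectors"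
  shows "c *\<^sub>C x \<in> ap_vectors"
proof -
  have "(\<lambda>t. T t (c *\<^sub>C x)) ` {0..} \<subseteq> (\<lambda>y. c *\<^sub>C y) ` closure ((\<lambda>t. T t x) ` {0..})"
    using closure_subset[of "(\<lambda>t. T t x) ` {0..}"] by (force simp: T_scaleC)
  moreover have "compact ((\<lambda>y. c *\<^sub>C y) ` closure ((\<lambda>t. T t x) ` {0..}))"
    using assms by (intro compact_continuous_image continuous_intros) (simp add: ap_vectors_def)
  ultimately show ?thesis
    unfolding ap_vectors_def by (auto intro: relatively_compact_subset)
qed

lemma zero_in_ap_vectors: "0 \<in> ap_vectors"
proof -
  have "T t 0 = 0" if "t \<ge> 0" for t
    using that linear_0[OF bounded_linear.linear[OF T_linear]] by blast
  then show ?thesis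
    unfolding ap_vectors_iff_finite_nets by (intro allI impI exI[of _ "{0}"]) auto
qed

lemma eigenvector_in_ap_vectors:
  assumes "\<And>t. t \<ge> 0 \<Longrightarrow> T t y = exp (\<i> * of_real \<xi> * of_real t) *\<^sub>C y"
  shows "y \<in> ap_vectors"
proof -
  have "(\<lambda>t. T t y) ` {0..} \<subseteq> (\<lambda>c. c *\<^sub>C y) ` sphere 0 1"
    using assms by (force simp: norm_exp_eq_Re)
  moreover have "compact ((\<lambda>c. c *\<^sub>C y) ` sphere 0 1)"
    by (intro compact_continuous_image continuous_intros compact_sphere)
  ultimately show ?thesis
    unfolding ap_vectors_def by (auto intro: relatively_compact_subset)
qed

text \<open>A bounded piece of an orbit is compact, so only its distance from the almost periodic
  vectors at late times matters.\<close>

lemma ap_vectorsI_late: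
  assumes "\<And>e. e > 0 \<Longrightarrow> \<exists>s\<ge>0. \<exists>z\<in>ap_vectors. norm (T s x - z) < e"
  shows "x \<in> ap_vectors"
  unfolding ap_vectors_iff_finite_nets
proof (intro allI impI)
  fix e :: real assume "e > 0"
  then have "e / (2 * C) > 0" using C_pos by simp
  then obtain s z where s: "s \<ge> 0" "z \<in> ap_vectors" "norm (T s x - z) < e / (2 * C)"
    using assms by blast
  obtain k where k: "finite k" "\<And>t. t \<ge> 0 \<Longrightarrow> \<exists>w\<in>k. norm (T t z - w) < e / 2"
    using s(2) \<open>e > 0\<close> half_gt_zero unfolding ap_vectors_iff_finite_nets by metis
  have "compact (orb x ` {0..s})"
    by (intro compact_continuous_image continuous_orb) simp
  then obtain l where l: "finite l" "orb x ` {0..s} \<subseteq> (\<Union>w\<in>l. ball w e)"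
    using \<open>e > 0\<close> unfolding compact_eq_totally_bounded by blast
  have "\<exists>w\<in>k \<union> l. norm (T t x - w) < e" if t: "t \<ge> 0" for t
  proof (cases "t \<le> s")
    case True
    then have "T t x \<in> orb x ` {0..s}"
      using t by (auto simp: orb_nonneg image_iff intro!: bexI[of _ t])
    then show ?thesis
      using l(2) by (force simp: dist_norm norm_minus_commute)
  next
    case False
    then obtain w where w: "w \<in> k" "norm (T (t - s) z - w) < e / 2"
      using k(2)[of "t - s"] by auto
    have "T t x = T (t - s) (T s x)"
      using False s(1) T_add[of "t - s" s x] by simp
    then have "norm (T t x - T (t - s) z) \<le> C * norm (T s x - z)"
      using False norm_T[of "t - s" "T s x - z"] by (simp add: T_diff)
    also have "\<dots> < e / 2"
      using s(3) C_pos by (simp add: field_simps)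
    finally show ?thesis
      using w norm_triangle_ineq[of "T t x - T (t - s) z" "T (t - s) z - w"] by force
  qed
  then show "\<exists>k. finite k \<and> (\<forall>t\<ge>0. \<exists>w\<in>k. norm (T t x - w) < e)"
    using k(1) l(1) by (intro exI[of _ "k \<union> l"]) auto
qed

end

section \<open>Integrals against quadratically decaying kernels\<close>

lemma kernel_integral:
  fixes F :: "real \<Rightarrow> 'a::complex_banach"
  assumes k: "continuous_on UNIV k" "\<And>v. cmod (k v) \<le> c / (s\<^sup>2 + v\<^sup>2)" "s > 0"
    and F: "continuous_on UNIV F" "\<And>u. norm (F u) \<le> B"
  shows "(\<lambda>u. k (u - t) *\<^sub>C F u) integrable_on UNIV"
    and "norm (integral UNIV (\<lambda>u. k (u - t) *\<^sub>C F u)) \<le> c * B * pi / s"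
proof -
  have g: "((\<lambda>u. c * B / (s\<^sup>2 + (u - t)\<^sup>2)) has_integral c * B * pi / s) UNIV"
    using has_integral_affine_UNIV[OF Poisson_weight_has_integral[OF k(3), of "c * B"], of 1 "- t"] by simp
  have le: "norm (k (u - t) *\<^sub>C F u) \<le> c * B / (s\<^sup>2 + (u - t)\<^sup>2)" for u
    using mult_mono[OF k(2)[of "u - t"] F(2)[of u]] order_trans[OF norm_ge_zero k(2)[of "u - t"]]
    by (simp add: norm_scaleC)
  show int: "(\<lambda>u. k (u - t) *\<^sub>C F u) integrable_on UNIV"
    using g by (intro integrable_dominated[OF _ _ _ le])
      (auto intro!: continuous_intros F(1) continuous_on_compose2[OF k(1)] simp: has_integral_iff)
  show "norm (integral UNIV (\<lambda>u. k (u - t) *\<^sub>C F u)) \<le> c * B * pi / s"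
    using integral_norm_bound_integral[OF int _ le] g by (simp add: has_integral_iff)
qed

lemma weighted_integral_tendsto_0:
  fixes g :: "nat \<Rightarrow> real \<Rightarrow> real"
  assumes g: "\<And>n. continuous_on UNIV (g n)" "\<And>n v. \<bar>g n v\<bar> \<le> B" "\<And>v. (\<lambda>n. g n v) \<longlonglongrightarrow> 0"
  shows "\<And>n. (\<lambda>v. g n v / (1 + v\<^sup>2)) integrable_on UNIV"
    and "(\<lambda>n. integral UNIV (\<lambda>v. g n v / (1 + v\<^sup>2))) \<longlonglongrightarrow> 0"
proof -
  have w: "(\<lambda>v::real. B / (1 + v\<^sup>2)) integrable_on UNIV"
    using Poisson_weight_has_integral[of 1 B] by (auto simp: has_integral_iff)
  have pos: "1 + v\<^sup>2 > 0" "1 + v\<^sup>2 \<noteq> 0" for v :: real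
    using zero_le_power2[of v] by linarith+
  have le: "norm (g n v / (1 + v\<^sup>2)) \<le> B / (1 + v\<^sup>2)" for n v
    using g(2)[of n v] pos(1)[of v] by (simp add: divide_right_mono abs_of_pos)
  have lim: "(\<lambda>n. g n v / (1 + v\<^sup>2)) \<longlonglongrightarrow> 0" for v
    using tendsto_divide[OF g(3) tendsto_const, of "1 + v\<^sup>2" v] pos(2)[of v] by simp
  show int: "(\<lambda>v. g n v / (1 + v\<^sup>2)) integrable_on UNIV" for n
    by (intro integrable_dominated[OF _ _ _ le w]) (auto intro!: continuous_intros g(1) simp: pos)
  show "(\<lambda>n. integral UNIV (\<lambda>v. g n v / (1 + v\<^sup>2))) \<longlonglongrightarrow> 0"
    using dominated_convergence(2)[of "\<lambda>n v. g n v / (1 + v\<^sup>2)" UNIV "\<lambda>v. B / (1 + v\<^sup>2)" "\<lambda>_. 0", OF int w le lim]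
    by simp
qed

lemma kernel_integral_tendsto_0:
  fixes G :: "nat \<Rightarrow> real \<Rightarrow> 'a::complex_banach"
  assumes k: "continuous_on UNIV k" "\<And>v. cmod (k v) \<le> c / (1 + v\<^sup>2)"
    and G: "\<And>n. continuous_on UNIV (G n)" "\<And>n v. norm (G n v) \<le> B" "\<And>v. (\<lambda>n. G n v) \<longlonglongrightarrow> 0"
  shows "(\<lambda>n. integral UNIV (\<lambda>v. k v *\<^sub>C G n v)) \<longlonglongrightarrow> 0"
proof (rule Lim_null_comparison)
  let ?g = "\<lambda>n v. c * norm (G n v)"
  have "c \<ge> 0" using order_trans[OF norm_ge_zero k(2)[of 0]] by simp
  then have g: "\<And>n. continuous_on UNIV (?g n)" "\<And>n v. \<bar>?g n v\<bar> \<le> c * B" "\<And>v. (\<lambda>n. ?g n v) \<longlonglongrightarrow> 0"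
    using G by (auto intro!: continuous_intros mult_left_mono tendsto_mult_right_zero tendsto_norm_zero simp: abs_mult)
  note w = weighted_integral_tendsto_0[of ?g, OF g]
  show "(\<lambda>n. integral UNIV (\<lambda>v. ?g n v / (1 + v\<^sup>2))) \<longlonglongrightarrow> 0"
    by (rule w(2))
  have int: "(\<lambda>v. k v *\<^sub>C G n v) integrable_on UNIV" for n
    using kernel_integral(1)[of k c 1 "G n" B 0] k G by simp
  have le: "norm (k v *\<^sub>C G n v) \<le> ?g n v / (1 + v\<^sup>2)" for n v
    using mult_right_mono[OF k(2)[of v] norm_ge_zero[of "G n v"]] by (simp add: norm_scaleC)
  show "\<forall>\<^sub>F n in sequentially. norm (integral UNIV (\<lambda>v. k v *\<^sub>C G n v)) \<le> integral UNIV (\<lambda>v. ?g n v / (1 + v\<^sup>2))"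
    by (intro always_eventually allI integral_norm_bound_integral int w(1) le)
qed

lemma kernel_integral_tendsto_0_at_top:
  fixes G :: "real \<Rightarrow> 'a::complex_banach"
  assumes k: "continuous_on UNIV k" "\<And>v. cmod (k v) \<le> c / (1 + v\<^sup>2)"
    and G: "continuous_on UNIV G" "\<And>v. norm (G v) \<le> B" "(G \<longlongrightarrow> 0) at_top"
  shows "((\<lambda>t. integral UNIV (\<lambda>u. k (u - t) *\<^sub>C G u)) \<longlongrightarrow> 0) at_top"
proof (rule tendsto_at_topI_sequentially)
  fix X :: "nat \<Rightarrow> real" assume X: "filterlim X at_top sequentially"
  have shift: "integral UNIV (\<lambda>u. k (u - t) *\<^sub>C G u) = integral UNIV (\<lambda>v. k v *\<^sub>C G (v + t))" for t
    using integral_shift_UNIV(2)[OF kernel_integral(1)[of k c 1 G B t], of t] k G by simp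
  have "(\<lambda>n. G (v + X n)) \<longlonglongrightarrow> 0" for v
    by (rule filterlim_compose[OF G(3) filterlim_tendsto_add_at_top[OF tendsto_const X]])
  then show "(\<lambda>n. integral UNIV (\<lambda>u. k (u - X n) *\<^sub>C G u)) \<longlonglongrightarrow> 0"
    unfolding shift
    by (intro kernel_integral_tendsto_0[OF k, where B=B])
      (auto intro!: continuous_on_compose2[OF G(1)] continuous_intros G(2))
qed

section \<open>The boundary values of a Laplace transform\<close>

lemma laplace_tail:
  fixes H :: "real \<Rightarrow> 'a::banach"
  assumes H: "continuous_on {0..} H" "\<And>u. u \<ge> 0 \<Longrightarrow> norm (H u) \<le> K * exp (- \<alpha> * u)" and "\<alpha> > 0" "n \<ge> 0"
  shows "H integrable_on {0..}" "norm (integral {0..n} H - integral {0..} H) \<le> K * (exp (- \<alpha> * n) / \<alpha>)"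
proof -
  have bnd: "((\<lambda>u. K * exp (- \<alpha> * u)) has_integral K * (exp (- \<alpha> * h) / \<alpha>)) {h..}" for h
    by (rule has_integral_mult_right[OF has_integral_exp_minus_to_infinity[OF \<open>\<alpha> > 0\<close>]])
  have le: "norm (H u) \<le> K * exp (- \<alpha> * u)" if "u \<in> {h..}" "h \<ge> 0" for u h
    using H(2)[of u] that by simp
  have int: "H integrable_on {h..}" if "h \<ge> 0" for h
    using bnd[of h] that
    by (intro integrable_dominated[OF _ _ _ le]) (auto intro!: continuous_on_subset[OF H(1)] simp: has_integral_iff is_interval_ci)
  show "H integrable_on {0..}"
    by (simp add: int)
  have "H integrable_on {0..n}"
    by (intro integrable_continuous_real continuous_on_subset[OF H(1)]) auto
  then have "(H has_integral integral {0..n} H + integral {n..} H) ({0..n} \<union> {n..})"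
    using int[OF \<open>n \<ge> 0\<close>] \<open>n \<ge> 0\<close> by (intro has_integral_Un integrable_integral) (auto simp: max_absorb2)
  moreover have "{0..n} \<union> {n..} = {0..}" using \<open>n \<ge> 0\<close> by auto
  ultimately have "integral {0..n} H - integral {0..} H = - integral {n..} H"
    by (simp add: integral_unique)
  moreover have "norm (integral {n..} H) \<le> integral {n..} (\<lambda>u. K * exp (- \<alpha> * u))"
    using int[OF \<open>n \<ge> 0\<close>] bnd[of n] \<open>n \<ge> 0\<close> by (intro integral_norm_bound_integral le) (auto simp: has_integral_iff)
  ultimately show "norm (integral {0..n} H - integral {0..} H) \<le> K * (exp (- \<alpha> * n) / \<alpha>)"
    by (simp only: integral_unique[OF bnd] norm_minus_cancel)
qed

lemma laplace_tail_tendsto: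
  fixes \<alpha> :: real
  assumes "\<alpha> > 0"
  shows "(\<lambda>n. K * (exp (- \<alpha> * real n) / \<alpha>)) \<longlonglongrightarrow> 0"
proof -
  have "(\<lambda>n. K * (exp (- \<alpha>) ^ n / \<alpha>)) \<longlonglongrightarrow> K * (0 / \<alpha>)"
    using assms by (intro tendsto_intros LIMSEQ_realpow_zero) auto
  then show ?thesis
    by (simp add: exp_of_nat_mult[symmetric] mult.commute)
qed

text \<open>Fubini's theorem is only needed for continuous integrands on rectangles: the Laplace integral is
  truncated first, and the truncation error is uniform in \<open>\<xi>\<close>.\<close>

lemma laplace_Fubini:
  fixes F :: "real \<Rightarrow> 'a::complex_banach"
  assumes F: "continuous_on {0..} F" "\<And>u. u \<ge> 0 \<Longrightarrow> norm (F u) \<le> B"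
    and \<phi>: "\<phi> \<in> test_functions I" and \<alpha>: "\<alpha> > 0"
  shows "integral UNIV (\<lambda>\<xi>. \<phi> \<xi> *\<^sub>C laplace F (of_real \<alpha> + \<i> * of_real \<xi>)) =
    integral {0..} (\<lambda>u. (of_real (exp (- \<alpha> * u)) * fourier \<phi> u) *\<^sub>C F u)"
proof -
  obtain a b where ab: "a < b" "support \<phi> \<subseteq> {a<..<b}"
    using compact_support_bounds test_functionsD[OF \<phi>] by metis
  have cont_\<phi>: "continuous_on S \<phi>" for S
    by (rule smooth_imp_continuous_on[OF test_functionsD(1)[OF \<phi>]])
  obtain P where P: "\<And>\<xi>. \<xi> \<in> {a..b} \<Longrightarrow> cmod (\<phi> \<xi>) \<le> P"
    using compact_imp_bounded[OF compact_continuous_image[OF cont_\<phi> compact_Icc]] by (force simp: bounded_iff)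
  obtain c where c: "c > 0" "\<And>v. cmod (fourier \<phi> v) \<le> c / (1 + v\<^sup>2)"
    using test_function_fourier_bound[OF \<phi>] by metis
  have c1: "cmod (fourier \<phi> v) \<le> c" for v
  proof -
    have "c / (1 + v\<^sup>2) \<le> c / 1"
      using c(1) by (intro divide_left_mono) (auto simp: add_pos_nonneg)
    with c(2)[of v] show ?thesis by simp
  qed
  have B: "B \<ge> 0"
    using order_trans[OF norm_ge_zero F(2)[of 0]] by simp
  let ?h = "\<lambda>\<xi> u. exp (- ((of_real \<alpha> + \<i> * of_real \<xi>) * of_real u)) *\<^sub>C F u"
  let ?H = "\<lambda>u. (of_real (exp (- \<alpha> * u)) * fourier \<phi> u) *\<^sub>C F u"
  have h_cont: "continuous_on {0..} (?h \<xi>)" for \<xi>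
    by (intro continuous_intros F)
  have h_le: "norm (?h \<xi> u) \<le> B * exp (- \<alpha> * u)" if "u \<ge> 0" for \<xi> u
    using F(2)[OF that] by (simp add: norm_scaleC norm_exp_eq_Re mult.commute mult_right_mono)
  have H_cont: "continuous_on {0..} ?H"
    by (intro continuous_intros F continuous_on_subset[OF fourier_continuous[OF \<phi>]]) auto
  have H_le: "norm (?H u) \<le> (c * B) * exp (- \<alpha> * u)" if "u \<ge> 0" for u
    using mult_mono[OF c1[of u] F(2)[OF that]] c(1) by (simp add: norm_scaleC norm_mult mult.commute mult_left_mono)
  \<comment> \<open>truncate the inner integral, and let the truncation tend to infinity\<close>
  let ?f = "\<lambda>n \<xi>. \<phi> \<xi> *\<^sub>C integral {0..real n} (?h \<xi>)"
  let ?g = "\<lambda>\<xi>. \<phi> \<xi> *\<^sub>C laplace F (of_real \<alpha> + \<i> * of_real \<xi>)"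
  have joint: "continuous_on ({a..b} \<times> {0..real n}) (\<lambda>(\<xi>, u). ?h \<xi> u)" for n
    unfolding case_prod_beta
    by (intro continuous_intros continuous_on_compose2[OF F(1)]) auto
  have f_cont: "continuous_on {a..b} (?f n)" for n
    using integral_continuous_on_param[of "{a..b}" 0 "real n" ?h] joint[of n] cont_\<phi>
    by (intro continuous_intros) (simp_all add: box_real)
  have unif: "uniform_limit {a..b} ?f ?g sequentially"
  proof (rule uniform_limitI)
    fix e :: real assume "e > 0"
    have "(\<lambda>n. P * (B * (exp (- \<alpha> * real n) / \<alpha>))) \<longlonglongrightarrow> P * 0"
      by (intro tendsto_mult tendsto_const laplace_tail_tendsto \<alpha>)
    then have "\<forall>\<^sub>F n in sequentially. P * (B * (exp (- \<alpha> * real n) / \<alpha>)) < e"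
      using \<open>e > 0\<close> by (intro order_tendstoD(2)) auto
    then show "\<forall>\<^sub>F n in sequentially. \<forall>\<xi>\<in>{a..b}. dist (?f n \<xi>) (?g \<xi>) < e"
    proof (rule eventually_mono, intro ballI)
      fix n \<xi> assume n: "P * (B * (exp (- \<alpha> * real n) / \<alpha>)) < e" and \<xi>: "\<xi> \<in> {a..b}"
      have "dist (?f n \<xi>) (?g \<xi>) = cmod (\<phi> \<xi>) * norm (integral {0..real n} (?h \<xi>) - integral {0..} (?h \<xi>))"
        by (simp add: dist_norm laplace_def scaleC.diff_right[symmetric] norm_scaleC)
      also have "\<dots> \<le> P * (B * (exp (- \<alpha> * real n) / \<alpha>))"
        using P[OF \<xi>] laplace_tail(2)[OF h_cont h_le \<alpha>, of "real n" \<xi>] order_trans[OF norm_ge_zero P[OF \<xi>]]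
        by (intro mult_mono) auto
      finally show "dist (?f n \<xi>) (?g \<xi>) < e"
        using n by simp
    qed
  qed
  obtain I J where IJ: "\<And>n. (?f n has_integral I n) {a..b}" "(?g has_integral J) {a..b}" "I \<longlonglongrightarrow> J"
    by (rule uniform_limit_integral[OF unif f_cont sequentially_bot], rule that)
  have I_eq: "I n = integral {0..real n} ?H" for n
  proof -
    have inner: "integral {a..b} (\<lambda>\<xi>. \<phi> \<xi> *\<^sub>C ?h \<xi> u) = ?H u" for u
    proof -
      have "bounded_linear (\<lambda>z. (of_real (exp (- \<alpha> * u)) * z) *\<^sub>C F u)"
        by (intro bounded_linear_compose[OF scaleC.bounded_linear_left bounded_linear_mult_right])
      moreover have "(\<lambda>\<xi>. exp (- \<i> * of_real u * of_real \<xi>) * \<phi> \<xi>) integrable_on {a..b}"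
        by (intro integrable_continuous_real continuous_intros cont_\<phi>)
      ultimately have "integral {a..b} ((\<lambda>z. (of_real (exp (- \<alpha> * u)) * z) *\<^sub>C F u) \<circ>
          (\<lambda>\<xi>. exp (- \<i> * of_real u * of_real \<xi>) * \<phi> \<xi>)) =
          (of_real (exp (- \<alpha> * u)) * integral {a..b} (\<lambda>\<xi>. exp (- \<i> * of_real u * of_real \<xi>) * \<phi> \<xi>)) *\<^sub>C F u"
        by (rule integral_linear[rotated])
      moreover have "integral {a..b} (\<lambda>\<xi>. exp (- \<i> * of_real u * of_real \<xi>) * \<phi> \<xi>) = fourier \<phi> u"
        using ab by (intro fourier_eq_integral[symmetric]) (auto simp: subset_eq less_imp_le)
      moreover have "of_real (exp (- \<alpha> * u)) * (exp (- \<i> * of_real u * of_real \<xi>) * \<phi> \<xi>) =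
          \<phi> \<xi> * exp (- ((of_real \<alpha> + \<i> * of_real \<xi>) * of_real u))" for \<xi>
      proof -
        have "exp (- ((of_real \<alpha> + \<i> * of_real \<xi>) * of_real u)) =
            of_real (exp (- \<alpha> * u)) * exp (- \<i> * of_real u * of_real \<xi>)"
          unfolding exp_of_real[symmetric] exp_add[symmetric] by (simp add: algebra_simps)
        then show ?thesis by simp
      qed
      then have "((\<lambda>z. (of_real (exp (- \<alpha> * u)) * z) *\<^sub>C F u) \<circ>
          (\<lambda>\<xi>. exp (- \<i> * of_real u * of_real \<xi>) * \<phi> \<xi>)) = (\<lambda>\<xi>. \<phi> \<xi> *\<^sub>C ?h \<xi> u)"
        by (intro ext) (simp only: o_def scaleC_scaleC)
      ultimately show ?thesis by simp
    qed
    have "I n = integral {a..b} (?f n)"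
      by (rule integral_unique[OF IJ(1), symmetric])
    also have "\<dots> = integral {a..b} (\<lambda>\<xi>. integral {0..real n} (\<lambda>u. \<phi> \<xi> *\<^sub>C ?h \<xi> u))"
    proof (intro arg_cong[where f="integral {a..b}"] ext)
      fix \<xi>
      have "?h \<xi> integrable_on {0..real n}"
        by (intro integrable_continuous_real continuous_on_subset[OF h_cont]) auto
      from integral_linear[OF this bounded_linear_scaleC_right[of "\<phi> \<xi>"]]
      show "?f n \<xi> = integral {0..real n} (\<lambda>u. \<phi> \<xi> *\<^sub>C ?h \<xi> u)"
        by (simp add: o_def)
    qed
    also have "\<dots> = integral {0..real n} (\<lambda>u. integral {a..b} (\<lambda>\<xi>. \<phi> \<xi> *\<^sub>C ?h \<xi> u))"
    proof -
      have "continuous_on (cbox (a, 0) (b, real n)) (\<lambda>(\<xi>, u). \<phi> \<xi> *\<^sub>C ?h \<xi> u)"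
        unfolding case_prod_beta
        by (intro continuous_intros continuous_on_compose2[OF F(1)] continuous_on_compose2[OF cont_\<phi>[of UNIV]])
          (auto simp: mem_box cbox_Pair_eq)
      from integral_swap_continuous[OF this] show ?thesis
        by simp
    qed
    also have "\<dots> = integral {0..real n} ?H"
      by (simp only: inner)
    finally show ?thesis .
  qed
  have "(\<lambda>n. integral {0..real n} ?H) \<longlonglongrightarrow> integral {0..} ?H"
    by (rule LIM_zero_cancel, rule Lim_null_comparison[OF always_eventually laplace_tail_tendsto[OF \<alpha>, of "c * B"]])
      (intro allI laplace_tail(2) H_cont H_le \<alpha> of_nat_0_le_iff)
  then have "J = integral {0..} ?H"
    by (rule LIMSEQ_unique[OF IJ(3)[unfolded I_eq[abs_def]]])
  moreover have "integral UNIV ?g = J"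
  proof -
    have "\<phi> x = 0" if "x \<notin> {a..b}" for x
      using that ab zero_outside_support[of x \<phi>] by force
    then have "(?g has_integral J) UNIV"
      by (intro has_integral_on_superset[OF IJ(2)]) (auto simp: scaleC.zero_left)
    then show ?thesis by (rule integral_unique)
  qed
  ultimately show ?thesis by simp
qed

text \<open>On the imaginary axis the Laplace transform of \<open>F\<close> becomes the Fourier transform of \<open>F\<close>
  extended by \<open>0\<close> to the left.\<close>

lemma laplace_boundary_value:
  fixes F :: "real \<Rightarrow> 'a::complex_banach"
  assumes F: "continuous_on {0..} F" "\<And>u. u \<ge> 0 \<Longrightarrow> norm (F u) \<le> B" and \<phi>: "\<phi> \<in> test_functions I"
  shows "((\<lambda>\<alpha>. integral UNIV (\<lambda>\<xi>. \<phi> \<xi> *\<^sub>C laplace F (of_real \<alpha> + \<i> * of_real \<xi>))) \<longlongrightarrow>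
    integral {0..} (\<lambda>u. fourier \<phi> u *\<^sub>C F u)) (at_right 0)"
  unfolding tendsto_at_iff_sequentially
proof (intro allI impI)
  fix X :: "nat \<Rightarrow> real" assume X: "\<forall>n. X n \<in> {0<..} - {0}" "X \<longlonglongrightarrow> 0"
  obtain c where c: "c > 0" "\<And>v. cmod (fourier \<phi> v) \<le> c / (1 + v\<^sup>2)"
    using test_function_fourier_bound[OF \<phi>] by metis
  have B: "B \<ge> 0"
    using order_trans[OF norm_ge_zero F(2)[of 0]] by simp
  let ?H = "\<lambda>u. fourier \<phi> u *\<^sub>C F u"
  let ?E = "\<lambda>n u. (of_real (exp (- X n * u)) * fourier \<phi> u) *\<^sub>C F u"
  let ?g = "\<lambda>n u. c * B * (1 - exp (- X n * \<bar>u\<bar>))"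
  have pos: "1 + u\<^sup>2 > 0" for u :: real
    using zero_le_power2[of u] by linarith
  have X_pos: "X n > 0" for n using X(1) by auto
  have g: "\<And>n. continuous_on UNIV (?g n)" "\<And>n v. \<bar>?g n v\<bar> \<le> c * B" "\<And>v. (\<lambda>n. ?g n v) \<longlonglongrightarrow> 0"
  proof -
    show "continuous_on UNIV (?g n)" for n by (intro continuous_intros)
    show "\<bar>?g n v\<bar> \<le> c * B" for n v
    proof -
      have "0 \<le> 1 - exp (- X n * \<bar>v\<bar>)" "1 - exp (- X n * \<bar>v\<bar>) \<le> 1" "0 \<le> c * B"
        using X_pos[of n] B c(1) by auto
      from mult_left_mono[OF this(2,3)] mult_nonneg_nonneg[OF this(3,1)] show ?thesis
        by (simp only: abs_of_nonneg mult_1_right)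
    qed
    have "(\<lambda>n. ?g n v) \<longlonglongrightarrow> c * B * (1 - exp (- 0 * \<bar>v\<bar>))" for v
      by (intro tendsto_intros X(2))
    then show "(\<lambda>n. ?g n v) \<longlonglongrightarrow> 0" for v by simp
  qed
  note w = weighted_integral_tendsto_0[of ?g, OF g]
  have w0: "(\<lambda>u::real. c * B / (1 + u\<^sup>2)) integrable_on {0..}"
  proof -
    have "(\<lambda>u::real. c * B / (1 + u\<^sup>2)) absolutely_integrable_on UNIV"
      using Poisson_weight_has_integral[of 1 "c * B"] B c(1) less_imp_le[OF pos]
      by (intro nonnegative_absolutely_integrable_1) (auto simp: has_integral_iff)
    then have "(\<lambda>u::real. c * B / (1 + u\<^sup>2)) absolutely_integrable_on {0..}"
      by (rule set_integrable_subset) auto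
    then show ?thesis
      by (rule set_lebesgue_integral_eq_integral(1))
  qed
  have H_le: "norm (?H u) \<le> c * B / (1 + u\<^sup>2)" if "u \<in> {0..}" for u
    using mult_mono[OF c(2)[of u] F(2)[of u]] that c(1) pos[of u] by (simp add: norm_scaleC)
  have cont: "continuous_on {0..} ?H" "continuous_on {0..} (?E n)" for n
    by (intro continuous_intros F continuous_on_subset[OF fourier_continuous[OF \<phi>]]; simp)+
  have int_H: "?H integrable_on {0..}"
    by (rule integrable_dominated[OF cont(1) _ _ H_le w0]) (auto simp: is_interval_ci)
  have E_eq: "?E n u = of_real (exp (- X n * u)) *\<^sub>C ?H u" for n u
    by (simp add: scaleC_scaleC)
  have E_le: "norm (?E n u) \<le> c * B / (1 + u\<^sup>2)" if "u \<in> {0..}" for n u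
    using mult_mono[OF _ H_le[OF that], of "exp (- X n * u)" 1] X_pos[of n] that
    unfolding E_eq by (simp add: norm_scaleC)
  have int_E: "?E n integrable_on {0..}" for n
    by (rule integrable_dominated[OF cont(2) _ _ E_le w0]) (auto simp: is_interval_ci)
  have diff_le: "norm (?E n u - ?H u) \<le> ?g n u / (1 + u\<^sup>2)" if "u \<in> {0..}" for n u
  proof -
    have "?E n u - ?H u = (of_real (exp (- X n * u)) - 1) *\<^sub>C ?H u"
      unfolding E_eq by (simp add: scaleC.diff_left)
    moreover have "cmod (of_real (exp (- X n * u)) - 1) = 1 - exp (- X n * \<bar>u\<bar>)"
    proof -
      have "of_real (exp (- X n * u)) - 1 = (of_real (exp (- X n * u) - 1) :: complex)" by simp
      then show ?thesis using that X_pos[of n] by (simp only: norm_of_real) (simp add: abs_if zero_less_mult_iff)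
    qed
    ultimately show ?thesis
      using mult_left_mono[OF H_le[OF that], of "1 - exp (- X n * \<bar>u\<bar>)"] X_pos[of n]
      by (simp add: norm_scaleC mult.commute mult.left_commute)
  qed
  have "norm (integral {0..} (?E n) - integral {0..} ?H) \<le> integral UNIV (\<lambda>u. ?g n u / (1 + u\<^sup>2))" for n
  proof -
    have g_le: "norm (?g n u / (1 + u\<^sup>2)) \<le> c * B / (1 + u\<^sup>2)" for u
      unfolding real_norm_def abs_divide abs_of_pos[OF pos]
      by (rule divide_right_mono[OF g(2) less_imp_le[OF pos]])
    have "continuous_on {0..} (\<lambda>u. ?g n u / (1 + u\<^sup>2))"
      by (intro continuous_intros) (use pos in \<open>auto simp: less_imp_neq[THEN not_sym]\<close>)
    then have i0: "(\<lambda>u. ?g n u / (1 + u\<^sup>2)) integrable_on {0..}"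
      by (rule integrable_dominated[OF _ _ _ g_le w0]) (simp_all add: is_interval_ci)
    have "norm (integral {0..} (\<lambda>u. ?E n u - ?H u)) \<le> integral {0..} (\<lambda>u. ?g n u / (1 + u\<^sup>2))"
      by (intro integral_norm_bound_integral integrable_diff int_E int_H i0 diff_le)
    also have "\<dots> \<le> integral UNIV (\<lambda>u. ?g n u / (1 + u\<^sup>2))"
      using B c(1) X_pos[of n] pos by (intro integral_subset_le i0 w(1)) (auto intro!: divide_nonneg_pos mult_nonneg_nonneg)
    finally show ?thesis
      using integral_diff[OF int_E int_H] by simp
  qed
  then have "(\<lambda>n. integral {0..} (?E n)) \<longlonglongrightarrow> integral {0..} ?H"
    by (intro LIM_zero_cancel[of "\<lambda>n. integral {0..} (?E n)"] Lim_null_comparison[OF always_eventually w(2)]) auto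
  then show "((\<lambda>\<alpha>. integral UNIV (\<lambda>\<xi>. \<phi> \<xi> *\<^sub>C laplace F (of_real \<alpha> + \<i> * of_real \<xi>))) \<circ> X)
      \<longlonglongrightarrow> integral {0..} ?H"
    unfolding o_def by (simp only: laplace_Fubini[OF F \<phi> X_pos])
qed

section \<open>Nonvanishing of the integral of a Fourier transform\<close>

lemma has_integral_reflect_UNIV:
  fixes f :: "real \<Rightarrow> 'b::banach"
  assumes "(f has_integral I) UNIV"
  shows "((\<lambda>x. f (- x)) has_integral I) UNIV"
  unfolding has_integral_UNIV_iff
proof (intro allI impI)
  fix e :: real assume "e > 0"
  then obtain B where B: "B > 0" "\<forall>a b. a \<le> - B \<and> B \<le> b \<longrightarrow>
      (\<exists>z. (f has_integral z) {a..b} \<and> norm (z - I) < e)"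
    using has_integral_UNIV_iff[THEN iffD1, OF assms, rule_format, OF \<open>e > 0\<close>] by (elim exE conjE)
  show "\<exists>B>0. \<forall>a b. a \<le> - B \<and> B \<le> b \<longrightarrow> (\<exists>z. ((\<lambda>x. f (- x)) has_integral z) {a..b} \<and> norm (z - I) < e)"
  proof (intro exI[of _ B] conjI B(1) allI impI)
    fix a b :: real assume "a \<le> - B \<and> B \<le> b"
    then have "- b \<le> - B \<and> B \<le> - a" by simp
    then obtain z where z: "(f has_integral z) {- b..- a}" "norm (z - I) < e"
      using B(2)[rule_format, OF \<open>- b \<le> - B \<and> B \<le> - a\<close>] by (elim exE conjE)
    have "((\<lambda>x. f (- x)) has_integral z) {a..b}"
      using has_integral_reflect_lemma_real[OF z(1)] by simp
    with z(2) show "\<exists>z. ((\<lambda>x. f (- x)) has_integral z) {a..b} \<and> norm (z - I) < e"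
      by (intro exI conjI)
  qed
qed

lemma fourier_even:
  assumes "\<And>t. \<phi> (- t) = \<phi> t" "\<phi> \<in> test_functions I"
  shows "fourier \<phi> (- v) = fourier \<phi> v"
proof -
  have "((\<lambda>t. exp (- \<i> * of_real v * of_real (- t)) * \<phi> (- t)) has_integral fourier \<phi> v) UNIV"
    unfolding fourier_def
    by (intro has_integral_reflect_UNIV[of "\<lambda>t. exp (- \<i> * of_real v * of_real t) * \<phi> t"]
        integrable_integral test_function_kernel_integrable[OF assms(2)])
  then show ?thesis
    using assms(1) unfolding fourier_def by (simp add: integral_unique)
qed

text \<open>Fourier inversion at the origin, reduced to what is needed. Integrating the transform against
  \<open>exp (- \<alpha> * u)\<close> over the right half-line gives a number whose real part is a Poisson integral of \<open>\<kappa>\<close>,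
  and this stays bounded below as \<open>\<alpha>\<close> tends to \<open>0\<close>. The left half-line contributes the same amount,
  since the transform is even.\<close>

lemma integral_fourier_nonzero:
  fixes \<kappa> :: "real \<Rightarrow> real"
  assumes \<kappa>: "(\<lambda>t. of_real (\<kappa> t)) \<in> test_functions I" "\<And>t. \<kappa> t \<ge> 0" "\<And>t. \<bar>t\<bar> \<le> 1 \<Longrightarrow> \<kappa> t = 1"
    "\<And>t. \<kappa> (- t) = \<kappa> t"
  shows "integral UNIV (fourier (\<lambda>t. of_real (\<kappa> t))) \<noteq> 0"
proof -
  let ?\<phi> = "\<lambda>t. complex_of_real (\<kappa> t)"
  obtain c where c: "c > 0" "\<And>v. cmod (fourier ?\<phi> v) \<le> c / (1 + v\<^sup>2)"
    using test_function_fourier_bound[OF \<kappa>(1)] by metis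
  obtain a b where ab: "support ?\<phi> \<subseteq> {a<..<b}"
    using compact_support_bounds test_functionsD[OF \<kappa>(1)] by metis
  have four_int: "fourier ?\<phi> integrable_on UNIV"
    using kernel_integral(1)[of "fourier ?\<phi>" c 1 "\<lambda>_. 1::complex" 1 0] c(2) fourier_continuous[OF \<kappa>(1)]
    by (simp add: scaleC_complex_def)
  define J where "J = integral {0..} (fourier ?\<phi>)"
  have one: "continuous_on {0..} (\<lambda>_. 1::complex)" "\<And>u. u \<ge> 0 \<Longrightarrow> norm (1::complex) \<le> 1"
    by auto
  have laplace_one: "laplace (\<lambda>_. 1) \<mu> = 1 / \<mu>" if "Re \<mu> > 0" for \<mu>
  proof -
    have "((\<lambda>u. exp (- (\<mu> * of_real u))) has_integral 1 / \<mu>) {0..}"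
    proof -
      have "(\<lambda>n. integral {0..real n} (\<lambda>u. exp (- (\<mu> * of_real u)))) \<longlonglongrightarrow> integral {0..} (\<lambda>u. exp (- (\<mu> * of_real u)))"
        by (rule LIM_zero_cancel, rule Lim_null_comparison[OF always_eventually laplace_tail_tendsto[OF that, of 1]])
          (intro allI laplace_tail(2) that; auto intro!: continuous_intros simp: norm_exp_eq_Re)
      moreover have "integral {0..real n} (\<lambda>u. exp (- (\<mu> * of_real u))) = 1 / \<mu> - exp (- (\<mu> * of_real (real n))) / \<mu>" for n
      proof -
        have "((\<lambda>u. - exp (- (\<mu> * of_real u)) / \<mu>) has_vector_derivative exp (- (\<mu> * of_real u))) (at u within {0..real n})" for u
        proof -
          have "((\<lambda>z. - exp (- (\<mu> * z)) / \<mu>) has_field_derivative exp (- (\<mu> * of_real u))) (at (of_real u))"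
            using that by (auto intro!: derivative_eq_intros)
          then show ?thesis
            by (rule has_vector_derivative_at_within[OF has_vector_derivative_real_field])
        qed
        then have "((\<lambda>u. exp (- (\<mu> * of_real u))) has_integral
            - exp (- (\<mu> * of_real (real n))) / \<mu> - - exp (- (\<mu> * of_real 0)) / \<mu>) {0..real n}"
          by (intro fundamental_theorem_of_calculus) auto
        then show ?thesis by (simp add: integral_unique)
      qed
      moreover have "(\<lambda>n. 1 / \<mu> - exp (- (\<mu> * of_real (real n))) / \<mu>) \<longlonglongrightarrow> 1 / \<mu> - 0 / \<mu>"
      proof (intro tendsto_intros)
        have "(\<lambda>n. exp (- Re \<mu>) ^ n) \<longlonglongrightarrow> 0"
          using that by (intro LIMSEQ_realpow_zero) auto
        then show "(\<lambda>n. exp (- (\<mu> * of_real (real n)))) \<longlonglongrightarrow> 0"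
          by (intro tendsto_norm_zero_cancel[of "\<lambda>n. exp (- (\<mu> * of_real (real n)))"])
            (simp add: norm_exp_eq_Re exp_of_nat_mult[symmetric] mult.commute)
      qed (use that in auto)
      ultimately have "integral {0..} (\<lambda>u. exp (- (\<mu> * of_real u))) = 1 / \<mu>"
        using LIMSEQ_unique by fastforce
      moreover have "(\<lambda>u. exp (- (\<mu> * of_real u))) integrable_on {0..}"
        by (rule laplace_tail(1)[where K=1, OF _ _ that order_refl]) (auto intro!: continuous_intros simp: norm_exp_eq_Re)
      ultimately show ?thesis by (simp add: has_integral_iff)
    qed
    then show ?thesis
      by (simp add: laplace_def scaleC_complex_def integral_unique)
  qed
  have "((\<lambda>\<alpha>. integral UNIV (\<lambda>\<xi>. ?\<phi> \<xi> *\<^sub>C laplace (\<lambda>_. 1::complex) (of_real \<alpha> + \<i> * of_real \<xi>))) \<longlongrightarrow> J) (at_right 0)"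
    using laplace_boundary_value[OF one \<kappa>(1)] by (simp add: J_def scaleC_complex_def)
  moreover have "\<forall>\<^sub>F \<alpha> in at_right 0. Re (integral UNIV (\<lambda>\<xi>. ?\<phi> \<xi> *\<^sub>C laplace (\<lambda>_. 1::complex) (of_real \<alpha> + \<i> * of_real \<xi>))) \<ge> pi / 2"
  proof -
    have "Re (integral UNIV (\<lambda>\<xi>. ?\<phi> \<xi> *\<^sub>C laplace (\<lambda>_. 1::complex) (of_real \<alpha> + \<i> * of_real \<xi>))) \<ge> pi / 2"
      if \<alpha>: "0 < \<alpha>" "\<alpha> < 1" for \<alpha>
    proof -
      let ?f = "\<lambda>\<xi>. ?\<phi> \<xi> * (1 / (of_real \<alpha> + \<i> * of_real \<xi>))"
      have nz: "of_real \<alpha> + \<i> * of_real \<xi> \<noteq> (0::complex)" for \<xi>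
        using \<alpha> by (simp add: complex_eq_iff)
      have "?f integrable_on {a..b}"
        using nz smooth_imp_continuous_on[OF test_functionsD(1)[OF \<kappa>(1)]]
        by (intro integrable_continuous_real continuous_intros) auto
      then have int: "?f integrable_on UNIV"
        by (rule integrable_on_superset) (use ab zero_outside_support[of _ ?\<phi>] in force)+
      have Re_f: "Re (?f \<xi>) = \<kappa> \<xi> * (\<alpha> / (\<alpha>\<^sup>2 + \<xi>\<^sup>2))" for \<xi>
        by (simp add: Re_divide)
      have intR: "(\<lambda>\<xi>. \<kappa> \<xi> * (\<alpha> / (\<alpha>\<^sup>2 + \<xi>\<^sup>2))) integrable_on UNIV"
        and eqR: "Re (integral UNIV ?f) = integral UNIV (\<lambda>\<xi>. \<kappa> \<xi> * (\<alpha> / (\<alpha>\<^sup>2 + \<xi>\<^sup>2)))"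
        using integrable_linear[OF int bounded_linear_Re] integral_linear[OF int bounded_linear_Re]
        by (simp_all only: o_def Re_f)
      have "((\<lambda>\<xi>. \<alpha> / (\<alpha>\<^sup>2 + \<xi>\<^sup>2)) has_integral arctan (1 / \<alpha>) - arctan (- 1 / \<alpha>)) {-1..1}"
      proof (rule fundamental_theorem_of_calculus)
        fix \<xi> :: real
        have "((\<lambda>\<xi>. arctan (\<xi> / \<alpha>)) has_real_derivative inverse (1 + (\<xi> / \<alpha>)\<^sup>2) * (1 / \<alpha>)) (at \<xi> within {-1..1})"
          using \<alpha> by (auto intro!: derivative_eq_intros)
        moreover have "inverse (1 + (\<xi> / \<alpha>)\<^sup>2) * (1 / \<alpha>) = \<alpha> / (\<alpha>\<^sup>2 + \<xi>\<^sup>2)"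
          using \<alpha> by (simp add: divide_simps power2_eq_square)
        ultimately show "((\<lambda>\<xi>. arctan (\<xi> / \<alpha>)) has_vector_derivative \<alpha> / (\<alpha>\<^sup>2 + \<xi>\<^sup>2)) (at \<xi> within {-1..1})"
          by (simp add: has_real_derivative_iff_has_vector_derivative)
      qed auto
      then have mid: "((\<lambda>\<xi>. \<kappa> \<xi> * (\<alpha> / (\<alpha>\<^sup>2 + \<xi>\<^sup>2))) has_integral arctan (1 / \<alpha>) - arctan (- 1 / \<alpha>)) {-1..1}"
        by (rule has_integral_eq[rotated]) (auto simp: \<kappa>(3) abs_le_iff)
      have "pi / 4 \<le> arctan (1 / \<alpha>)"
        using \<alpha> arctan_monotone'[of 1 "1 / \<alpha>"] by (simp add: arctan_one)
      then have "pi / 2 \<le> arctan (1 / \<alpha>) - arctan (- 1 / \<alpha>)"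
        by (simp add: arctan_minus)
      also have "\<dots> = integral {-1..1} (\<lambda>\<xi>. \<kappa> \<xi> * (\<alpha> / (\<alpha>\<^sup>2 + \<xi>\<^sup>2)))"
        using mid by (simp add: integral_unique)
      also have "\<dots> \<le> integral UNIV (\<lambda>\<xi>. \<kappa> \<xi> * (\<alpha> / (\<alpha>\<^sup>2 + \<xi>\<^sup>2)))"
        using mid intR \<kappa>(2) \<alpha> by (intro integral_subset_le) (auto simp: has_integral_iff)
      also have "\<dots> = Re (integral UNIV (\<lambda>\<xi>. ?\<phi> \<xi> *\<^sub>C laplace (\<lambda>_. 1::complex) (of_real \<alpha> + \<i> * of_real \<xi>)))"
      proof -
        have "Re (of_real \<alpha> + \<i> * of_real \<xi>) > 0" for \<xi>
          using \<alpha> by simp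
        then show ?thesis
          by (simp only: eqR[symmetric] scaleC_complex_def laplace_one)
      qed
      finally show ?thesis .
    qed
    then show ?thesis
      using eventually_at_right_real[of 0 "1::real"] by (auto elim!: eventually_mono)
  qed
  ultimately have "Re J \<ge> pi / 2"
    by (intro tendsto_lowerbound[OF tendsto_Re]) auto
  then have "Re J > 0"
    using pi_gt_zero by linarith
  then have "J \<noteq> 0"
    by auto
  let ?p = "\<lambda>u. if u \<in> {0..} then fourier ?\<phi> u else 0"
  have "fourier ?\<phi> integrable_on {0..}"
  proof (rule integrable_dominated)
    have "(\<lambda>u::real. c / (1 + u\<^sup>2)) absolutely_integrable_on UNIV"
      using Poisson_weight_has_integral[of 1 c] c(1)
      by (intro nonnegative_absolutely_integrable_1) (auto simp: has_integral_iff add_nonneg_pos)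
    then have "(\<lambda>u::real. c / (1 + u\<^sup>2)) absolutely_integrable_on {0..}"
      by (rule set_integrable_subset) auto
    then show "(\<lambda>u::real. c / (1 + u\<^sup>2)) integrable_on {0..}"
      by (rule set_lebesgue_integral_eq_integral(1))
  qed (auto intro: c(2) continuous_on_subset[OF fourier_continuous[OF \<kappa>(1)]] simp: is_interval_ci)
  then have p: "(?p has_integral J) UNIV"
    unfolding has_integral_restrict_UNIV J_def by (rule integrable_integral)
  have "((\<lambda>u. ?p u + ?p (- u)) has_integral J + J) UNIV"
    by (intro has_integral_add p has_integral_reflect_UNIV[OF p])
  then have "(fourier ?\<phi> has_integral J + J) UNIV"
    by (rule has_integral_spike[OF negligible_sing[of 0], rotated])
      (auto simp: fourier_even[OF _ \<kappa>(1)] \<kappa>(4))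
  with \<open>J \<noteq> 0\<close> show ?thesis
    by (simp add: integral_unique)
qed

section \<open>Smeared orbits\<close>

text \<open>The left half-line recedes from the kernel as \<open>t\<close> grows. The continuous ramp in the proof
  dominates the indicator function of the half-line, which keeps all integrands of the dominated
  convergence argument continuous.\<close>

lemma kernel_left_tendsto_0:
  fixes F :: "real \<Rightarrow> 'a::complex_banach"
  assumes k: "continuous_on UNIV k" "\<And>v. cmod (k v) \<le> c / (1 + v\<^sup>2)"
    and F: "continuous_on UNIV F" "\<And>u. norm (F u) \<le> B"
  shows "((\<lambda>t. integral UNIV (\<lambda>u. k (u - t) *\<^sub>C F u) - integral {0..} (\<lambda>u. k (u - t) *\<^sub>C F u)) \<longlongrightarrow> 0) at_top"
proof (rule tendsto_at_topI_sequentially)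
  fix X :: "nat \<Rightarrow> real" assume X: "filterlim X at_top sequentially"
  let ?r = "\<lambda>u::real. max 0 (min 1 (1 - u))"
  let ?g = "\<lambda>n v. c * B * ?r (v + X n)"
  have c: "c \<ge> 0" "B \<ge> 0"
    using order_trans[OF norm_ge_zero k(2)[of 0]] order_trans[OF norm_ge_zero F(2)[of 0]] by simp_all
  have g: "\<And>n. continuous_on UNIV (?g n)" "\<And>n v. \<bar>?g n v\<bar> \<le> c * B" "\<And>v. (\<lambda>n. ?g n v) \<longlonglongrightarrow> 0"
  proof -
    show "continuous_on UNIV (?g n)" for n by (intro continuous_intros)
    show "\<bar>?g n v\<bar> \<le> c * B" for n v
      using c mult_left_mono[of "?r (v + X n)" 1 "c * B"] by (simp add: abs_mult)
    show "(\<lambda>n. ?g n v) \<longlonglongrightarrow> 0" for v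
    proof (rule Lim_transform_eventually[OF tendsto_const])
      have "\<forall>\<^sub>F n in sequentially. X n > 1 - v"
        by (rule filterlim_at_top_dense[THEN iffD1, OF X, rule_format])
      then show "\<forall>\<^sub>F n in sequentially. 0 = ?g n v"
        by eventually_elim auto
    qed
  qed
  note w = weighted_integral_tendsto_0[of ?g, OF g]
  show "(\<lambda>n. integral UNIV (\<lambda>u. k (u - X n) *\<^sub>C F u) - integral {0..} (\<lambda>u. k (u - X n) *\<^sub>C F u)) \<longlonglongrightarrow> 0"
  proof (rule Lim_null_comparison[OF always_eventually w(2)], intro allI)
    fix n
    let ?h = "\<lambda>u. k (u - X n) *\<^sub>C F u"
    let ?b = "\<lambda>u. ?g n (u - X n) / (1 + (u - X n)\<^sup>2)"
    have int: "?h integrable_on UNIV"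
      using kernel_integral(1)[of k c 1 F B "X n"] k F by simp
    have int0: "(\<lambda>u. if u \<in> {0..} then ?h u else 0) integrable_on UNIV"
    proof -
      have dom: "(\<lambda>u. c * B / (1 + (u - X n)\<^sup>2)) absolutely_integrable_on UNIV"
        using has_integral_affine_UNIV[OF Poisson_weight_has_integral[of 1 "c * B"], of 1 "- X n"] c
        by (intro nonnegative_absolutely_integrable_1) (auto simp: has_integral_iff add_nonneg_nonneg)
      have dom0: "(\<lambda>u. c * B / (1 + (u - X n)\<^sup>2)) integrable_on {0..}"
        by (intro set_lebesgue_integral_eq_integral(1) set_integrable_subset[OF dom]) auto
      have h_le: "norm (?h u) \<le> c * B / (1 + (u - X n)\<^sup>2)" for u
        using mult_mono[OF k(2)[of "u - X n"] F(2)[of u]] c by (simp add: norm_scaleC)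
      have "continuous_on {0..} ?h"
        by (intro continuous_intros continuous_on_compose2[OF k(1)] continuous_on_subset[OF F(1)]) auto
      then have "?h integrable_on {0..}"
        by (rule integrable_dominated[OF _ _ _ h_le dom0]) (simp_all add: is_interval_ci)
      then show ?thesis
        by (simp only: integrable_restrict_UNIV)
    qed
    have int': "(\<lambda>u. ?h u - (if u \<in> {0..} then ?h u else 0)) integrable_on UNIV"
      by (rule integrable_diff[OF int int0])
    have eq: "integral UNIV ?h - integral {0..} ?h = integral UNIV (\<lambda>u. ?h u - (if u \<in> {0..} then ?h u else 0))"
      unfolding integral_diff[OF int int0] by (simp only: integral_restrict_UNIV)
    have b: "?b integrable_on UNIV" "integral UNIV ?b = integral UNIV (\<lambda>v. ?g n v / (1 + v\<^sup>2))"
      using integral_shift_UNIV[OF w(1)[of n], of "- X n"] by simp_all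
    have "norm (?h u - (if u \<in> {0..} then ?h u else 0)) \<le> ?b u" for u
    proof (cases "u \<ge> 0")
      case True
      then show ?thesis using c by (simp add: add_nonneg_nonneg)
    next
      case False
      then show ?thesis
        using mult_mono[OF k(2)[of "u - X n"] F(2)[of u]] c by (simp add: norm_scaleC min_def)
    qed
    then have "norm (integral UNIV ?h - integral {0..} ?h) \<le> integral UNIV ?b"
      unfolding eq by (intro integral_norm_bound_integral int' b(1))
    then show "norm (integral UNIV ?h - integral {0..} ?h) \<le> integral UNIV (\<lambda>v. ?g n v / (1 + v\<^sup>2))"
      by (simp only: b(2))
  qed
qed

lemma C0_functions_bounded:
  assumes "g \<in> C0_functions"
  obtains B where "\<And>u. norm (g u) \<le> B"
proof -
  have g: "continuous_on UNIV g" "(g \<longlongrightarrow> 0) at_infinity"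
    using assms by (auto simp: C0_functions_def)
  obtain b where b: "\<And>u. norm u \<ge> b \<Longrightarrow> norm (g u) < 1"
    using tendstoD[OF g(2), of 1] by (auto simp: eventually_at_infinity)
  have "bounded (g ` cball 0 b)"
    by (intro compact_imp_bounded compact_continuous_image continuous_on_subset[OF g(1)]) auto
  then obtain B where "\<forall>u\<in>cball 0 b. norm (g u) \<le> B"
    by (auto simp: bounded_iff)
  then have B: "norm (g u) \<le> B" if "norm u \<le> b" for u
    using that by simp
  show thesis
  proof (rule that)
    fix u
    show "norm (g u) \<le> max B 1"
      using b[of u] B[of u] by (cases "norm u \<le> b") (auto simp: le_max_iff_disj)
  qed
qed

context bounded_C0_semigroup
begin

text \<open>With the frequency-side factor \<open>exp (\<i> * t * \<xi>)\<close> moved to the time side, this is the Fourier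
  transform of the orbit tested against \<open>\<phi> \<xi> * exp (\<i> * t * \<xi>)\<close>; equivalently, up to the factor
  \<open>2 * pi\<close>, the orbit filtered to the frequencies in the support of \<open>\<phi>\<close>.\<close>

definition smear :: "(real \<Rightarrow> complex) \<Rightarrow> 'a \<Rightarrow> real \<Rightarrow> 'a"
  where "smear \<phi> x t = integral UNIV (\<lambda>u. fourier \<phi> (u - t) *\<^sub>C orb x u)"

text \<open>Distances to the almost periodic vectors do the work of a norm in the quotient of the space by
  these vectors, without forming the quotient.\<close>

definition asymptotically_ap :: "(real \<Rightarrow> 'a) \<Rightarrow> bool"
  where "asymptotically_ap F \<longleftrightarrow> (\<forall>e>0. \<forall>\<^sub>F t in at_top. \<exists>z\<in>ap_vectors. norm (F t - z) < e)"

lemma asymptotically_ap_approx: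
  assumes "\<And>e. e > 0 \<Longrightarrow> \<exists>G. asymptotically_ap G \<and> (\<forall>\<^sub>F t in at_top. norm (F t - G t) < e)"
  shows "asymptotically_ap F"
  unfolding asymptotically_ap_def
proof (intro allI impI)
  fix e :: real assume "e > 0"
  then obtain G where G: "asymptotically_ap G" "\<forall>\<^sub>F t in at_top. norm (F t - G t) < e / 2"
    using assms[of "e / 2"] by auto
  have "\<forall>\<^sub>F t in at_top. \<exists>z\<in>ap_vectors. norm (G t - z) < e / 2"
    by (rule G(1)[unfolded asymptotically_ap_def, rule_format, OF half_gt_zero[OF \<open>e > 0\<close>]])
  with G(2) show "\<forall>\<^sub>F t in at_top. \<exists>z\<in>ap_vectors. norm (F t - z) < e"
  proof eventually_elim
    case (elim t)
    then show ?case
      using norm_diff_triangle_less[of "F t" "G t" "e / 2" _ "e / 2"] by fastforce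
  qed
qed

lemma asymptotically_ap_add:
  assumes "asymptotically_ap F" "asymptotically_ap G"
  shows "asymptotically_ap (\<lambda>t. F t + G t)"
  unfolding asymptotically_ap_def
proof (intro allI impI)
  fix e :: real assume "e > 0"
  have "\<forall>\<^sub>F t in at_top. \<exists>z\<in>ap_vectors. norm (F t - z) < e / 2"
    "\<forall>\<^sub>F t in at_top. \<exists>z\<in>ap_vectors. norm (G t - z) < e / 2"
    by (rule assms[unfolded asymptotically_ap_def, rule_format, OF half_gt_zero[OF \<open>e > 0\<close>]])+
  then show "\<forall>\<^sub>F t in at_top. \<exists>z\<in>ap_vectors. norm (F t + G t - z) < e"
  proof eventually_elim
    case (elim t)
    then obtain z w where "z \<in> ap_vectors" "norm (F t - z) < e / 2" "w \<in> ap_vectors" "norm (G t - w) < e / 2"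
      by blast
    then show ?case
      using norm_triangle_ineq[of "F t - z" "G t - w"]
      by (intro bexI[of _ "z + w"] ap_vectors_add) (auto simp: algebra_simps)
  qed
qed

lemma asymptotically_ap_scaleC:
  assumes "asymptotically_ap F"
  shows "asymptotically_ap (\<lambda>t. c *\<^sub>C F t)"
  unfolding asymptotically_ap_def
proof (intro allI impI)
  fix e :: real assume "e > 0"
  then have "\<forall>\<^sub>F t in at_top. \<exists>z\<in>ap_vectors. norm (F t - z) < e / (cmod c + 1)"
    using assms by (simp add: asymptotically_ap_def add_nonneg_pos)
  then show "\<forall>\<^sub>F t in at_top. \<exists>z\<in>ap_vectors. norm (c *\<^sub>C F t - z) < e"
  proof eventually_elim
    case (elim t)
    then obtain z where z: "z \<in> ap_vectors" "norm (F t - z) < e / (cmod c + 1)"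
      by blast
    have "norm (c *\<^sub>C F t - c *\<^sub>C z) \<le> (cmod c + 1) * norm (F t - z)"
      by (simp add: scaleC.diff_right[symmetric] norm_scaleC mult_right_mono)
    also have "\<dots> < e"
      using z(2) by (simp add: pos_less_divide_eq add_nonneg_pos mult.commute)
    finally show ?case
      using ap_vectors_scaleC[OF z(1)] by blast
  qed
qed

lemma asymptotically_ap_tendsto_0:
  assumes "asymptotically_ap G" "((\<lambda>t. F t - G t) \<longlongrightarrow> 0) at_top"
  shows "asymptotically_ap F"
proof (rule asymptotically_ap_approx)
  fix e :: real assume "e > 0"
  with tendstoD[OF assms(2)] assms(1)
  show "\<exists>G. asymptotically_ap G \<and> (\<forall>\<^sub>F t in at_top. norm (F t - G t) < e)"
    by (intro exI[of _ G]) (simp add: dist_norm)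
qed

lemma asymptotically_ap_in:
  assumes "\<And>t. F t \<in> ap_vectors"
  shows "asymptotically_ap F"
proof -
  have "\<exists>z\<in>ap_vectors. norm (F t - z) < e" if "e > 0" for e t
    using assms[of t] that by (intro bexI[of _ "F t"]) auto
  then show ?thesis
    by (simp add: asymptotically_ap_def)
qed

lemma asymptotically_ap_zero: "asymptotically_ap (\<lambda>t. 0)"
  by (rule asymptotically_ap_in) (rule zero_in_ap_vectors)

lemma smear_integrable:
  assumes "\<phi> \<in> test_functions I"
  shows "(\<lambda>u. fourier \<phi> (u - t) *\<^sub>C orb x u) integrable_on UNIV"
proof -
  obtain c where "\<And>v. cmod (fourier \<phi> v) \<le> c / (1 + v\<^sup>2)"
    using test_function_fourier_bound[OF assms] by metis
  then show ?thesis
    using kernel_integral(1)[of "fourier \<phi>" c 1 "orb x" "C * norm x" t] fourier_continuous[OF assms]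
      continuous_orb norm_orb by simp
qed

lemma norm_smear:
  assumes "\<phi> \<in> test_functions I" "s > 0" "\<And>v. cmod (fourier \<phi> v) \<le> c / (s\<^sup>2 + v\<^sup>2)"
  shows "norm (smear \<phi> x t) \<le> c * (C * norm x) * pi / s"
  unfolding smear_def
  by (rule kernel_integral(2)[OF fourier_continuous[OF assms(1)] assms(3,2) continuous_orb norm_orb])

lemma smear_diff:
  assumes "\<phi> \<in> test_functions I"
  shows "smear \<phi> (x - y) t = smear \<phi> x t - smear \<phi> y t"
  unfolding smear_def orb_diff scaleC.diff_right
  by (intro integral_diff smear_integrable[OF assms])

lemma smear_scaleC:
  assumes "\<phi> \<in> test_functions I"
  shows "smear \<phi> (c *\<^sub>C x) t = c *\<^sub>C smear \<phi> x t"
  using integral_linear[OF smear_integrable[OF assms, of t x] bounded_linear_scaleC_right[of c]]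
  by (simp add: smear_def orb_scaleC o_def scaleC_scaleC mult.commute)

lemma smear_add_test:
  assumes "\<phi> \<in> test_functions I" "\<psi> \<in> test_functions J"
  shows "smear (\<lambda>\<xi>. \<phi> \<xi> + \<psi> \<xi>) x t = smear \<phi> x t + smear \<psi> x t"
  unfolding smear_def fourier_add[OF assms] scaleC.add_left
  by (intro integral_add smear_integrable[OF assms(1)] smear_integrable[OF assms(2)])

lemma smear_scale_test:
  assumes "\<phi> \<in> test_functions I"
  shows "smear (\<lambda>\<xi>. \<phi> \<xi> * c) x t = c *\<^sub>C smear \<phi> x t"
proof -
  have "fourier (\<lambda>\<xi>. \<phi> \<xi> * c) v = c * fourier \<phi> v" for v
    unfolding fourier_def by (subst integral_mult_right[symmetric]) (simp add: ac_simps)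
  then show ?thesis
    using integral_linear[OF smear_integrable[OF assms, of t x] bounded_linear_scaleC_right[of c]]
    by (simp add: smear_def o_def scaleC_scaleC)
qed

text \<open>For fixed \<open>\<phi>\<close> these vectors form a closed subspace, because smearing is bounded uniformly in
  time. All later arguments work inside such subspaces.\<close>

definition tame :: "(real \<Rightarrow> complex) \<Rightarrow> 'a set"
  where "tame \<phi> = {x. asymptotically_ap (smear \<phi> x)}"

lemma tame_diff:
  assumes "\<phi> \<in> test_functions I" "x \<in> tame \<phi>" "y \<in> tame \<phi>"
  shows "x - y \<in> tame \<phi>"
proof -
  have "asymptotically_ap (\<lambda>t. smear \<phi> x t + (- 1) *\<^sub>C smear \<phi> y t)"
    using assms by (intro asymptotically_ap_add asymptotically_ap_scaleC) (auto simp: tame_def)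
  moreover have "smear \<phi> x t + (- 1) *\<^sub>C smear \<phi> y t = smear \<phi> (x - y) t" for t
    by (simp add: smear_diff[OF assms(1)] scaleC.minus_left)
  ultimately show ?thesis
    by (simp add: tame_def)
qed

lemma tame_scaleC:
  assumes "\<phi> \<in> test_functions I" "x \<in> tame \<phi>"
  shows "c *\<^sub>C x \<in> tame \<phi>"
  using assms(2) asymptotically_ap_scaleC[of "smear \<phi> x" c]
  by (simp add: tame_def smear_scaleC[OF assms(1), abs_def])

lemma tame_closed:
  assumes \<phi>: "\<phi> \<in> test_functions I" and approx: "\<And>e. e > 0 \<Longrightarrow> \<exists>y\<in>tame \<phi>. norm (x - y) < e"
  shows "x \<in> tame \<phi>"
proof -
  obtain c where c: "c > 0" "\<And>v. cmod (fourier \<phi> v) \<le> c / (1\<^sup>2 + v\<^sup>2)"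
    using test_function_fourier_bound[OF \<phi>] by auto
  have "asymptotically_ap (smear \<phi> x)"
  proof (rule asymptotically_ap_approx)
    fix e :: real assume "e > 0"
    then obtain y where y: "y \<in> tame \<phi>" "norm (x - y) < e / (c * C * pi)"
      using approx[of "e / (c * C * pi)"] c(1) C_pos by auto
    have "norm (smear \<phi> x t - smear \<phi> y t) < e" for t
    proof -
      have "norm (smear \<phi> (x - y) t) \<le> c * (C * norm (x - y)) * pi / 1"
        by (rule norm_smear[OF \<phi> zero_less_one c(2)])
      also have "\<dots> < e"
        using y(2) c(1) C_pos by (simp add: pos_less_divide_eq algebra_simps)
      finally show ?thesis by (simp add: smear_diff[OF \<phi>])
    qed
    with y(1) show "\<exists>G. asymptotically_ap G \<and> (\<forall>\<^sub>F t in at_top. norm (smear \<phi> x t - G t) < e)"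
      by (intro exI[of _ "smear \<phi> y"]) (simp add: tame_def)
  qed
  then show ?thesis by (simp add: tame_def)
qed

lemma tame_limit:
  assumes \<phi>: "\<phi> \<in> test_functions I" and f: "(f \<longlongrightarrow> x) F" "F \<noteq> bot" "\<forall>\<^sub>F t in F. f t \<in> tame \<phi>"
  shows "x \<in> tame \<phi>"
proof (rule tame_closed[OF \<phi>])
  fix e :: real assume "e > 0"
  have "\<forall>\<^sub>F t in F. f t \<in> tame \<phi> \<and> dist (f t) x < e"
    by (intro eventually_conj f(3) tendstoD[OF f(1)] \<open>e > 0\<close>)
  then obtain t where "f t \<in> tame \<phi>" "dist (f t) x < e"
    using eventually_happens'[OF f(2)] by blast
  then show "\<exists>y\<in>tame \<phi>. norm (x - y) < e"
    by (auto simp: dist_norm norm_minus_commute)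
qed

text \<open>Every value of the smeared orbit is a scalar multiple of the eigenvector.\<close>

lemma eigenvector_tame:
  assumes \<phi>: "\<phi> \<in> test_functions I"
    and y: "\<And>t. t \<ge> 0 \<Longrightarrow> T t y = exp (\<i> * of_real \<xi> * of_real t) *\<^sub>C y"
  shows "y \<in> tame \<phi>"
proof -
  obtain c where c: "\<And>v. cmod (fourier \<phi> v) \<le> c / (1 + v\<^sup>2)"
    using test_function_fourier_bound[OF \<phi>] by metis
  let ?e = "\<lambda>u. exp (\<i> * of_real \<xi> * of_real (max u 0)) :: complex"
  have "smear \<phi> y t = integral UNIV (\<lambda>u. fourier \<phi> (u - t) * ?e u) *\<^sub>C y" for t
  proof -
    have "(\<lambda>u. fourier \<phi> (u - t) * ?e u) integrable_on UNIV"
    proof -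
      have "continuous_on UNIV ?e"
        by (intro continuous_intros)
      then show ?thesis
        using kernel_integral(1)[of "fourier \<phi>" c 1 ?e 1 t] c fourier_continuous[OF \<phi>]
        by (simp add: scaleC_complex_def norm_exp_eq_Re)
    qed
    from integral_linear[OF this scaleC.bounded_linear_left, of y]
    show ?thesis
      by (simp add: smear_def orb_def y o_def scaleC_scaleC)
  qed
  then show ?thesis
    unfolding tame_def
    by (auto intro!: asymptotically_ap_in ap_vectors_scaleC eigenvector_in_ap_vectors[OF y])
qed

lemma smear_modulation:
  "smear (\<lambda>\<xi>. \<phi> \<xi> * exp (\<i> * of_real h * of_real \<xi>)) x t = integral UNIV (\<lambda>u. fourier \<phi> (u - t - h) *\<^sub>C orb x u)"
  by (simp only: smear_def fourier_modulation)

text \<open>Moving a vector along its orbit modulates the test function, up to the effect of the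
  artificial left end of the orbit.\<close>

lemma smear_T:
  assumes \<phi>: "\<phi> \<in> test_functions I" and h: "h \<ge> 0"
  shows "((\<lambda>t. smear \<phi> (T h x) t - smear (\<lambda>\<xi>. \<phi> \<xi> * exp (\<i> * of_real h * of_real \<xi>)) x t) \<longlongrightarrow> 0) at_top"
proof -
  obtain c where c: "\<And>v. cmod (fourier \<phi> v) \<le> c / (1 + v\<^sup>2)"
    using test_function_fourier_bound[OF \<phi>] by metis
  let ?D = "\<lambda>u. orb (T h x) u - orb x (u + h)"
  have cont: "continuous_on UNIV (\<lambda>u. orb x (u + h))"
    by (intro continuous_on_compose2[OF continuous_orb[of UNIV]] continuous_intros) auto
  have int: "(\<lambda>u. fourier \<phi> (u - t) *\<^sub>C orb x (u + h)) integrable_on UNIV" for t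
    using kernel_integral(1)[of "fourier \<phi>" c 1 "\<lambda>u. orb x (u + h)" "C * norm x" t] c
      fourier_continuous[OF \<phi>] cont norm_orb by simp
  have "smear (\<lambda>\<xi>. \<phi> \<xi> * exp (\<i> * of_real h * of_real \<xi>)) x t = integral UNIV (\<lambda>u. fourier \<phi> (u - t) *\<^sub>C orb x (u + h))" for t
    unfolding smear_modulation using integral_shift_UNIV(2)[OF smear_integrable[OF \<phi>, of "t + h" x], of h]
    by (simp add: algebra_simps)
  then have eq: "smear \<phi> (T h x) t - smear (\<lambda>\<xi>. \<phi> \<xi> * exp (\<i> * of_real h * of_real \<xi>)) x t =
      integral UNIV (\<lambda>u. fourier \<phi> (u - t) *\<^sub>C ?D u)" for t
    unfolding scaleC.diff_right by (simp add: smear_def integral_diff[OF smear_integrable[OF \<phi>] int])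
  have D: "norm (?D u) \<le> C * norm (T h x) + C * norm x" for u
    using norm_orb[of "T h x" u] norm_orb[of x "u + h"] norm_triangle_ineq4[of "orb (T h x) u" "orb x (u + h)"] by linarith
  have "(?D \<longlongrightarrow> 0) at_top"
  proof (rule Lim_transform_eventually[OF tendsto_const])
    show "\<forall>\<^sub>F u in at_top. 0 = ?D u"
      using eventually_ge_at_top[of 0] by eventually_elim (use h in \<open>simp add: orb_nonneg T_add\<close>)
  qed
  then show ?thesis
    unfolding eq
    by (intro kernel_integral_tendsto_0_at_top[OF fourier_continuous[OF \<phi>] c _ D])
      (auto intro!: continuous_intros continuous_orb cont)
qed

lemma boundary_resolvent_eq:
  assumes \<phi>: "\<phi> \<in> test_functions I"
  shows "boundary_resolvent (generator T) x \<phi> = integral {0..} (\<lambda>u. fourier \<phi> u *\<^sub>C orb x u)"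
proof -
  have "((\<lambda>\<alpha>. integral UNIV (\<lambda>\<xi>. \<phi> \<xi> *\<^sub>C laplace (orb x) (of_real \<alpha> + \<i> * of_real \<xi>))) \<longlongrightarrow>
      integral {0..} (\<lambda>u. fourier \<phi> u *\<^sub>C orb x u)) (at_right 0)"
    by (rule laplace_boundary_value[OF continuous_orb norm_orb \<phi>])
  then have "((\<lambda>\<alpha>. integral UNIV (\<lambda>\<xi>. \<phi> \<xi> *\<^sub>C resolvent (generator T) (of_real \<alpha> + \<i> * of_real \<xi>) x)) \<longlongrightarrow>
      integral {0..} (\<lambda>u. fourier \<phi> u *\<^sub>C orb x u)) (at_right 0)"
    by (rule Lim_transform_eventually)
      (auto simp: eventually_at_filter resolvent_eq_Res Res_def intro!: always_eventually)
  moreover have "\<phi> \<in> schwartz"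
    using \<phi> test_functions_subset_schwartz by blast
  ultimately show ?thesis
    by (simp add: boundary_resolvent_def tendsto_Lim)
qed

text \<open>Testing with the modulated functions \<open>\<phi> \<xi> * exp (\<i> * t * \<xi>)\<close> turns the smeared orbit, up to a null
  function, into the convolution of \<open>g\<close> with an integrable kernel, which inherits the decay of \<open>g\<close>.\<close>

lemma pseudofunction_tame:
  assumes g: "g \<in> C0_functions" and \<phi>: "\<phi> \<in> test_functions I"
    and eq: "\<And>\<psi>. \<psi> \<in> test_functions I \<Longrightarrow> boundary_resolvent (generator T) x \<psi> = fourier_dist (dist_of_fun g) \<psi>"
  shows "x \<in> tame \<phi>"
proof -
  obtain c where c: "\<And>v. cmod (fourier \<phi> v) \<le> c / (1 + v\<^sup>2)"
    using test_function_fourier_bound[OF \<phi>] by metis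
  obtain B where B: "\<And>u. norm (g u) \<le> B"
    using C0_functions_bounded[OF g] by metis
  have g': "continuous_on UNIV g" "(g \<longlongrightarrow> 0) at_top"
    using g filterlim_mono[OF _ order_refl at_top_le_at_infinity] by (auto simp: C0_functions_def)
  have "integral {0..} (\<lambda>u. fourier \<phi> (u - t) *\<^sub>C orb x u) = integral UNIV (\<lambda>u. fourier \<phi> (u - t) *\<^sub>C g u)" for t
  proof -
    let ?\<psi> = "\<lambda>\<xi>. \<phi> \<xi> * exp (\<i> * of_real t * of_real \<xi>)"
    have \<psi>: "?\<psi> \<in> test_functions I"
      using test_functions_mult[OF \<phi> smooth_exp[of 1 "\<i> * of_real t"]] by simp
    then have "?\<psi> \<in> schwartz"
      using test_functions_subset_schwartz by blast
    with eq[OF \<psi>] show ?thesis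
      unfolding boundary_resolvent_eq[OF \<psi>] by (simp add: fourier_dist_def dist_of_fun_def fourier_modulation)
  qed
  moreover have "((\<lambda>t. integral UNIV (\<lambda>u. fourier \<phi> (u - t) *\<^sub>C g u)) \<longlongrightarrow> 0) at_top"
    by (rule kernel_integral_tendsto_0_at_top[OF fourier_continuous[OF \<phi>] c g'(1) B g'(2)])
  moreover have "((\<lambda>t. smear \<phi> x t - integral {0..} (\<lambda>u. fourier \<phi> (u - t) *\<^sub>C orb x u)) \<longlongrightarrow> 0) at_top"
    unfolding smear_def by (rule kernel_left_tendsto_0[OF fourier_continuous[OF \<phi>] c continuous_orb norm_orb])
  ultimately have "((\<lambda>t. (smear \<phi> x t - integral UNIV (\<lambda>u. fourier \<phi> (u - t) *\<^sub>C g u)) +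
      integral UNIV (\<lambda>u. fourier \<phi> (u - t) *\<^sub>C g u)) \<longlongrightarrow> 0 + 0) at_top"
    by (intro tendsto_add) simp_all
  then have "((\<lambda>t. smear \<phi> x t - 0) \<longlongrightarrow> 0) at_top"
    by simp
  then show ?thesis
    unfolding tame_def using asymptotically_ap_tendsto_0[OF asymptotically_ap_zero] by blast
qed

section \<open>Localisation\<close>

text \<open>A partition of unity, peeled off one ball at a time: multiplication by a plateau function that is
  \<open>1\<close> on a ball splits off a piece that lives near this ball and leaves a remainder that vanishes
  on it.\<close>

lemma tame_local_finite:
  assumes "finite A"
    and "\<And>\<xi> \<psi>. \<xi> \<in> A \<Longrightarrow> \<psi> \<in> test_functions (ball \<xi> (3 * \<rho> \<xi>)) \<Longrightarrow> x \<in> tame \<psi>" "\<And>\<xi>. \<xi> \<in> A \<Longrightarrow> \<rho> \<xi> > 0"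
    and "\<phi> \<in> test_functions UNIV" "support \<phi> \<subseteq> (\<Union>\<xi>\<in>A. ball \<xi> (\<rho> \<xi>))"
  shows "x \<in> tame \<phi>"
  using assms
proof (induction A arbitrary: \<phi> rule: finite_induct)
  case empty
  then have "\<phi> = (\<lambda>_. 0)"
    using zero_outside_support[of _ \<phi>] by auto
  moreover have "smear (\<lambda>_. 0) x = (\<lambda>_. 0)"
    by (intro ext) (simp add: smear_def fourier_def scaleC.zero_left)
  ultimately show ?case
    by (simp add: tame_def asymptotically_ap_zero)
next
  case (insert \<xi> A)
  obtain \<kappa> :: "real \<Rightarrow> real" where \<kappa>: "smooth (\<lambda>t. of_real (\<kappa> t))"
    "\<And>t. \<bar>t\<bar> \<le> 1 \<Longrightarrow> \<kappa> t = 1" "\<And>t. \<bar>t\<bar> \<ge> 2 \<Longrightarrow> \<kappa> t = 0"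
    using plateau_exists by blast
  have \<rho>: "\<rho> \<xi> > 0" using insert.prems(2) by simp
  let ?\<eta> = "\<lambda>t. complex_of_real (\<kappa> (1 / \<rho> \<xi> * t + - \<xi> / \<rho> \<xi>))"
  have \<eta>: "smooth ?\<eta>"
    by (rule smooth_affine[OF \<kappa>(1)])
  have arg: "1 / \<rho> \<xi> * t + - \<xi> / \<rho> \<xi> = (t - \<xi>) / \<rho> \<xi>" for t
    by (simp add: diff_divide_distrib)
  have near: "?\<eta> t = 1" if "dist \<xi> t \<le> \<rho> \<xi>" for t
    unfolding arg using that \<rho> by (subst \<kappa>(2)) (auto simp: dist_real_def abs_minus_commute)
  have far: "?\<eta> t = 0" if "dist \<xi> t \<ge> 2 * \<rho> \<xi>" for t
    unfolding arg using that \<rho> by (subst \<kappa>(3)) (auto simp: dist_real_def abs_minus_commute pos_le_divide_eq)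
  note supp0 = zero_outside_support[of _ \<phi>]
  have sm: "smooth \<phi>" "compact (support \<phi>)"
    using test_functionsD[OF insert.prems(3)] by auto
  have 1: "(\<lambda>t. \<phi> t * ?\<eta> t) \<in> test_functions (ball \<xi> (3 * \<rho> \<xi>))"
    using \<rho> far by (intro test_functionsI[of _ "cball \<xi> (2 * \<rho> \<xi>)"] smooth_mult sm \<eta>) auto
  let ?K = "support \<phi> - ball \<xi> (\<rho> \<xi>)"
  have K: "compact ?K"
    using sm by (simp add: compact_diff)
  have zero: "\<phi> t * (1 - ?\<eta> t) = 0" if "t \<notin> ?K" for t
    using that near[of t] supp0[of t] by (auto simp: less_imp_le)
  have 2: "(\<lambda>t. \<phi> t * (1 - ?\<eta> t)) \<in> test_functions UNIV"
    using K zero by (intro test_functionsI[of _ ?K] smooth_mult smooth_diff smooth_const sm \<eta>) auto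
  have "closure {t. \<phi> t * (1 - ?\<eta> t) \<noteq> 0} \<subseteq> ?K"
    using zero by (intro closure_minimal compact_imp_closed K) blast
  then have "support (\<lambda>t. \<phi> t * (1 - ?\<eta> t)) \<subseteq> ?K"
    by (simp only: support_def[of "\<lambda>t. \<phi> t * (1 - ?\<eta> t)"])
  then have "support (\<lambda>t. \<phi> t * (1 - ?\<eta> t)) \<subseteq> (\<Union>\<xi>\<in>A. ball \<xi> (\<rho> \<xi>))"
    using insert.prems(4) by blast
  then have "x \<in> tame (\<lambda>t. \<phi> t * (1 - ?\<eta> t))"
    using insert.prems(1,2) by (intro insert.IH[OF _ _ 2]) auto
  moreover have "x \<in> tame (\<lambda>t. \<phi> t * ?\<eta> t)"
    using insert.prems(1)[OF _ 1] by simp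
  ultimately have "asymptotically_ap (\<lambda>t. smear (\<lambda>t. \<phi> t * (1 - ?\<eta> t)) x t + smear (\<lambda>t. \<phi> t * ?\<eta> t) x t)"
    by (intro asymptotically_ap_add) (auto simp: tame_def)
  moreover have "smear (\<lambda>t. \<phi> t * (1 - ?\<eta> t)) x t + smear (\<lambda>t. \<phi> t * ?\<eta> t) x t = smear \<phi> x t" for t
    unfolding smear_add_test[OF 2 1, symmetric] by (simp add: algebra_simps)
  ultimately show ?case
    by (simp add: tame_def)
qed

lemma tame_local:
  assumes \<phi>: "\<phi> \<in> test_functions UNIV"
    and loc: "\<And>\<xi>. \<xi> \<in> support \<phi> \<Longrightarrow> \<exists>r>0. \<forall>\<psi>\<in>test_functions (ball \<xi> r). x \<in> tame \<psi>"
  shows "x \<in> tame \<phi>"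
proof -
  obtain r where r: "\<And>\<xi>. \<xi> \<in> support \<phi> \<Longrightarrow> r \<xi> > 0 \<and> (\<forall>\<psi>\<in>test_functions (ball \<xi> (r \<xi>)). x \<in> tame \<psi>)"
    using loc by metis
  have cpt: "compact (support \<phi>)"
    using test_functionsD[OF \<phi>] by auto
  have cover: "support \<phi> \<subseteq> (\<Union>\<xi>\<in>support \<phi>. ball \<xi> (r \<xi> / 3))"
    using r by force
  obtain A where A: "A \<subseteq> support \<phi>" "finite A" "support \<phi> \<subseteq> (\<Union>\<xi>\<in>A. ball \<xi> (r \<xi> / 3))"
    by (rule compactE_image[OF cpt open_ball cover])
  show ?thesis
    by (rule tame_local_finite[OF A(2) _ _ \<phi> A(3)]) (use r A(1) in auto)
qed

end

section \<open>Isolated exceptional frequencies\<close>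

text \<open>Otherwise the set would be perfect, hence uncountable.\<close>

lemma closed_countable_isolated_point:
  fixes S :: "real set"
  assumes "closed S" "countable S" "S \<noteq> {}"
  obtains \<xi> r where "\<xi> \<in> S" "r > 0" "ball \<xi> r \<inter> S = {\<xi>}"
proof -
  have "euclidean derived_set_of S \<noteq> S"
  proof
    assume "euclidean derived_set_of S = S"
    then have "(UNIV :: real set) \<lesssim> S"
      using assms(3) completely_metrizable_space_euclidean by (intro lepoll_perfect_set) auto
    then have "countable (UNIV :: real set)"
      using assms(2) countable_lepoll by blast
    then show False
      using uncountable_UNIV_real by blast
  qed
  moreover have "euclidean derived_set_of S \<subseteq> S"
    using assms(1) by (simp add: closedin_contains_derived_set[of euclidean S, simplified])
  ultimately obtain \<xi> where \<xi>: "\<xi> \<in> S" "\<xi> \<notin> euclidean derived_set_of S"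
    by blast
  then obtain U where U: "open U" "\<xi> \<in> U" "\<And>y. y \<in> S \<Longrightarrow> y \<in> U \<Longrightarrow> y = \<xi>"
    by (auto simp: in_derived_set_of)
  obtain r where r: "r > 0" "ball \<xi> r \<subseteq> U"
    using U(1,2) open_contains_ball by blast
  have "ball \<xi> r \<inter> S = {\<xi>}"
    using r U(3) \<xi>(1) by auto
  with \<xi>(1) r(1) show thesis
    by (rule that)
qed

lemma derivf_mult:
  assumes "smooth f" "smooth g"
  shows "derivf (\<lambda>t. f t * g t) = (\<lambda>t. f t * derivf g t + derivf f t * g t)"
  by (intro ext vector_derivative_at has_vector_derivative_mult smooth_has_derivative assms)

lemma derivf_mult2:
  assumes "smooth f" "smooth g"
  shows "derivf (derivf (\<lambda>t. f t * g t)) = (\<lambda>t. (f t * derivf (derivf g) t + derivf f t * derivf g t)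
    + (derivf f t * derivf g t + derivf (derivf f) t * g t))"
  unfolding derivf_mult[OF assms]
  by (intro ext vector_derivative_at has_vector_derivative_add has_vector_derivative_mult
      smooth_has_derivative smooth_derivf assms)

lemma derivf_affine:
  assumes "smooth f"
  shows "derivf (\<lambda>t. f (a * t + b)) = (\<lambda>t. of_real a * derivf f (a * t + b))"
  by (intro ext vector_derivative_at affine_has_vector_derivative assms)

lemma derivf_affine2:
  assumes "smooth f"
  shows "derivf (derivf (\<lambda>t. f (a * t + b))) = (\<lambda>t. of_real a * (of_real a * derivf (derivf f) (a * t + b)))"
  unfolding derivf_affine[OF assms]
  by (intro ext vector_derivative_at has_vector_derivative_mult_right affine_has_vector_derivative smooth_derivf assms)

lemma smooth_bounded_Icc:
  assumes "smooth f"
  obtains B where "B \<ge> 1" "\<And>t. t \<in> {a..b} \<Longrightarrow> cmod (f t) \<le> B"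
proof -
  have "bounded (f ` {a..b})"
    by (intro compact_imp_bounded compact_continuous_image smooth_imp_continuous_on assms) auto
  then obtain B where "\<forall>t\<in>{a..b}. cmod (f t) \<le> B"
    by (auto simp: bounded_iff)
  then show thesis
    by (intro that[of "max B 1"]) (auto simp: le_max_iff_disj)
qed

lemma smooth_Lipschitz_Icc:
  assumes "smooth f" "\<And>t. t \<in> {a..b} \<Longrightarrow> cmod (derivf f t) \<le> L" "s \<in> {a..b}" "t \<in> {a..b}"
  shows "cmod (f t - f s) \<le> L * \<bar>t - s\<bar>"
proof -
  have "onorm (\<lambda>h. h *\<^sub>R derivf f u) \<le> L" if "u \<in> {a..b}" for u
  proof (rule onorm_le)
    show "norm (h *\<^sub>R derivf f u) \<le> L * norm h" for h
      using mult_right_mono[OF assms(2)[OF that] abs_ge_zero[of h]] by (simp add: mult.commute)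
  qed
  moreover have "(f has_derivative (\<lambda>h. h *\<^sub>R derivf f u)) (at u within {a..b})" for u
    using has_vector_derivative_at_within[OF smooth_has_derivative[OF assms(1)], of u "{a..b}"]
    by (simp add: has_vector_derivative_def)
  ultimately show ?thesis
    using differentiable_bound[of "{a..b}" f "\<lambda>u h. h *\<^sub>R derivf f u" L t s] assms(3,4) by simp
qed

context bounded_C0_semigroup
begin

text \<open>The frequencies near which the orbits of all vectors are asymptotically almost periodic. The
  neighbourhood must not depend on the vector, because the study of a single orbit leads to the
  orbits of resolvent vectors.\<close>

definition regular :: "real set"
  where "regular = {\<xi>. \<exists>r>0. \<forall>\<phi>\<in>test_functions (ball \<xi> r). tame \<phi> = UNIV}"

lemma open_regular: "open regular"
  unfolding open_contains_ball
proof
  fix \<xi> assume "\<xi> \<in> regular"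
  then obtain r where r: "r > 0" "\<And>\<phi>. \<phi> \<in> test_functions (ball \<xi> r) \<Longrightarrow> tame \<phi> = UNIV"
    by (auto simp: regular_def)
  have "\<zeta> \<in> regular" if mem: "\<zeta> \<in> ball \<xi> r" for \<zeta>
  proof -
    obtain s where s: "s > 0" "ball \<zeta> s \<subseteq> ball \<xi> r"
      using open_contains_ball[THEN iffD1, OF open_ball, rule_format, OF mem] by blast
    then show ?thesis
      unfolding regular_def using r(2) test_functions_mono by blast
  qed
  with r(1) show "\<exists>e>0. ball \<xi> e \<subseteq> regular" by blast
qed

lemma tame_regular:
  assumes "\<phi> \<in> test_functions UNIV" "support \<phi> \<subseteq> regular"
  shows "x \<in> tame \<phi>"
proof (rule tame_local[OF assms(1)])
  fix \<xi> assume "\<xi> \<in> support \<phi>"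
  then have "\<xi> \<in> regular" using assms(2) by blast
  then show "\<exists>r>0. \<forall>\<psi>\<in>test_functions (ball \<xi> r). x \<in> tame \<psi>"
    by (auto simp: regular_def)
qed

text \<open>The neighbourhood on which the resolvent is a pseudofunction may depend on the vector; localisation
  makes it uniform.\<close>

lemma PF_complement_regular:
  assumes "\<i> * of_real \<xi> \<notin> PF_spectrum (generator T)"
  shows "\<xi> \<in> regular"
proof -
  have "\<xi> \<in> \<Union> {I. open I \<and> (\<forall>x. boundary_resolvent (generator T) x \<in> PF_loc I)}"
    using assms unfolding PF_spectrum_def by blast
  then obtain I where I: "open I" "\<xi> \<in> I" "\<And>x. boundary_resolvent (generator T) x \<in> PF_loc I"
    by blast
  obtain r where r: "r > 0" "ball \<xi> r \<subseteq> I"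
    using I(1,2) open_contains_ball by blast
  have "x \<in> tame \<phi>" if \<phi>: "\<phi> \<in> test_functions (ball \<xi> r)" for \<phi> x
  proof (rule tame_local)
    show "\<phi> \<in> test_functions UNIV"
      using \<phi> by (rule test_functions_mono[rotated]) auto
    fix \<zeta> assume "\<zeta> \<in> support \<phi>"
    then have "\<zeta> \<in> I"
      using test_functionsD(3)[OF \<phi>] r(2) by blast
    then obtain I' u where I': "open I'" "\<zeta> \<in> I'" "u \<in> PF"
      "\<And>\<psi>. \<psi> \<in> test_functions I' \<Longrightarrow> boundary_resolvent (generator T) x \<psi> = u \<psi>"
      using I(3)[of x] unfolding PF_loc_def by blast
    obtain g where g: "g \<in> C0_functions" "u = fourier_dist (dist_of_fun g)"
      using I'(3) by (auto simp: PF_def)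
    obtain s where s: "s > 0" "ball \<zeta> s \<subseteq> I'"
      using I'(1,2) open_contains_ball by blast
    have "x \<in> tame \<psi>" if "\<psi> \<in> test_functions (ball \<zeta> s)" for \<psi>
      using pseudofunction_tame[OF g(1) that] I'(4)[unfolded g(2)] test_functions_mono[OF s(2)] by blast
    with s(1) show "\<exists>r>0. \<forall>\<psi>\<in>test_functions (ball \<zeta> r). x \<in> tame \<psi>" by blast
  qed
  with r(1) show ?thesis
    unfolding regular_def by blast
qed

text \<open>Single points are sets of spectral synthesis. The part of \<open>\<psi>\<close> within distance \<open>2 / n\<close> of the zero \<open>\<xi>\<close>
  has size \<open>1 / n\<close>, and its second derivative has size \<open>n\<close>; thus its Fourier transform is bounded by
  a multiple of \<open>1 / (n\<^sup>2 + v\<^sup>2)\<close>, whose integral is of order \<open>1 / n\<close>. What remains of \<open>\<psi>\<close> is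
  supported in regular frequencies.\<close>

lemma tame_vanishing:
  assumes \<psi>: "\<psi> \<in> test_functions UNIV" and \<xi>: "\<psi> \<xi> = 0" and supp: "support \<psi> - {\<xi>} \<subseteq> regular"
  shows "x \<in> tame \<psi>"
proof -
  have sm: "smooth \<psi>" "compact (support \<psi>)"
    using test_functionsD[OF \<psi>] by auto
  obtain \<kappa>' :: "real \<Rightarrow> real" where \<kappa>': "smooth (\<lambda>t. of_real (\<kappa>' t))" "\<And>t. 0 \<le> \<kappa>' t" "\<And>t. \<kappa>' t \<le> 1"
    "\<And>t. \<bar>t\<bar> \<le> 1 \<Longrightarrow> \<kappa>' t = 1" "\<And>t. \<bar>t\<bar> \<ge> 2 \<Longrightarrow> \<kappa>' t = 0"
    using plateau_exists by blast
  define \<kappa> where "\<kappa> = (\<lambda>t. complex_of_real (\<kappa>' t))"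
  have \<kappa>: "smooth \<kappa>" "\<And>t. cmod (\<kappa> t) \<le> 1" "\<And>t. \<bar>t\<bar> \<le> 1 \<Longrightarrow> \<kappa> t = 1" "\<And>t. \<bar>t\<bar> \<ge> 2 \<Longrightarrow> \<kappa> t = 0"
    using \<kappa>' by (auto simp: \<kappa>_def)
  obtain b1 where b1: "b1 \<ge> 1" "\<And>t. t \<in> {-3..3} \<Longrightarrow> cmod (derivf \<kappa> t) \<le> b1"
    using smooth_bounded_Icc[OF smooth_derivf[OF \<kappa>(1)]] by metis
  obtain b2 where b2: "b2 \<ge> 1" "\<And>t. t \<in> {-3..3} \<Longrightarrow> cmod (derivf (derivf \<kappa>) t) \<le> b2"
    using smooth_bounded_Icc[OF smooth_derivf[OF smooth_derivf[OF \<kappa>(1)]]] by metis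
  obtain L1 where L1: "L1 \<ge> 1" "\<And>t. t \<in> {\<xi>-3..\<xi>+3} \<Longrightarrow> cmod (derivf \<psi> t) \<le> L1"
    using smooth_bounded_Icc[OF smooth_derivf[OF sm(1)]] by metis
  obtain L2 where L2: "L2 \<ge> 1" "\<And>t. t \<in> {\<xi>-3..\<xi>+3} \<Longrightarrow> cmod (derivf (derivf \<psi>) t) \<le> L2"
    using smooth_bounded_Icc[OF smooth_derivf[OF smooth_derivf[OF sm(1)]]] by metis
  define K where "K = 6 * (3 * L1 + (3 * L1 * b2 + 2 * L1 * b1 + L2))"
  have K: "K > 0"
    using b1(1) b2(1) L1(1) L2(1) by (simp add: K_def add_pos_nonneg)
  \<comment> \<open>the part of \<open>\<psi>\<close> within distance \<open>2 / n\<close> of \<open>\<xi>\<close>\<close>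
  let ?\<eta> = "\<lambda>n t. \<kappa> (n * t + (- n * \<xi>))"
  let ?\<theta> = "\<lambda>n t. \<psi> t * ?\<eta> n t"
  have \<eta>: "smooth (?\<eta> n)" for n
    by (rule smooth_affine[OF \<kappa>(1)])
  have arg: "n * t + (- n * \<xi>) = n * (t - \<xi>)" for n t :: real
    by (simp add: right_diff_distrib)
  have near: "?\<eta> n t = 1" if "n \<ge> 1" "\<bar>t - \<xi>\<bar> \<le> 1 / n" for n t
  proof -
    have "n * \<bar>t - \<xi>\<bar> \<le> 1"
      using that by (simp add: pos_le_divide_eq mult.commute)
    then show ?thesis
      unfolding arg using that(1) by (intro \<kappa>(3)) (simp add: abs_mult)
  qed
  have far: "?\<eta> n t = 0" if "n \<ge> 1" "\<bar>t - \<xi>\<bar> \<ge> 2 / n" for n t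
  proof -
    have "n * \<bar>t - \<xi>\<bar> \<ge> 2"
      using that by (simp add: pos_divide_le_eq mult.commute)
    then show ?thesis
      unfolding arg using that(1) by (intro \<kappa>(4)) (simp add: abs_mult)
  qed
  have near_part: "?\<theta> n \<in> test_functions UNIV" for n
    by (rule test_functions_mult[OF \<psi> \<eta>])
  have near_small: "norm (smear (?\<theta> n) x t) \<le> K * (C * norm x) * pi / n" if n: "n \<ge> 1" for n t
  proof -
    \<comment> \<open>the margin between \<open>2 / n\<close> and \<open>3 / n\<close> puts the support inside an open interval\<close>
    have supp_\<theta>: "support (?\<theta> n) \<subseteq> {\<xi> - 3 / n<..<\<xi> + 3 / n}"
    proof -
      have "support (?\<theta> n) \<subseteq> cball \<xi> (2 / n)"
        unfolding support_def
      proof (rule closure_minimal)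
        show "{t. ?\<theta> n t \<noteq> 0} \<subseteq> cball \<xi> (2 / n)"
        proof
          fix t assume "t \<in> {t. ?\<theta> n t \<noteq> 0}"
          then have "\<bar>t - \<xi>\<bar> < 2 / n"
            using far[OF n, of t] by force
          then show "t \<in> cball \<xi> (2 / n)"
            by (simp add: dist_real_def abs_minus_commute)
        qed
      qed simp
      also have "\<dots> \<subseteq> {\<xi> - 3 / n<..<\<xi> + 3 / n}"
      proof
        fix t assume "t \<in> cball \<xi> (2 / n)"
        moreover have "2 / n < 3 / n" using n by (simp add: divide_strict_right_mono)
        ultimately show "t \<in> {\<xi> - 3 / n<..<\<xi> + 3 / n}"
          by (simp add: dist_real_def abs_le_iff)
      qed
      finally show ?thesis .
    qed
    have bnds: "cmod (?\<theta> n t) \<le> 3 * L1 / n \<and>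
        cmod (derivf (derivf (?\<theta> n)) t) \<le> n * (3 * L1 * b2 + 2 * L1 * b1 + L2)"
      if t: "t \<in> {\<xi> - 3 / n..\<xi> + 3 / n}" for t
    proof -
      have "3 / n \<le> 3" using n by (simp add: field_simps)
      then have t3: "t \<in> {\<xi>-3..\<xi>+3}" using t by auto
      have "\<bar>t - \<xi>\<bar> \<le> 3 / n" using t by (auto simp: abs_le_iff)
      then have "n * \<bar>t - \<xi>\<bar> \<le> 3" using n by (simp add: field_simps)
      then have "\<bar>n * (t - \<xi>)\<bar> \<le> 3" using n by (simp add: abs_mult)
      then have arg3: "n * t + (- n * \<xi>) \<in> {-3..3}"
        unfolding arg by (auto simp: abs_le_iff)
      have "cmod (\<psi> t - \<psi> \<xi>) \<le> L1 * \<bar>t - \<xi>\<bar>"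
        by (rule smooth_Lipschitz_Icc[OF sm(1) L1(2) _ t3]) auto
      also have "\<dots> \<le> L1 * (3 / n)"
        using \<open>\<bar>t - \<xi>\<bar> \<le> 3 / n\<close> L1(1) by (intro mult_left_mono) auto
      finally have p0: "cmod (\<psi> t) \<le> 3 * L1 / n"
        using \<xi> by (simp add: mult.commute)
      have p1: "cmod (derivf \<psi> t) \<le> L1" and p2: "cmod (derivf (derivf \<psi>) t) \<le> L2"
        using L1(2)[OF t3] L2(2)[OF t3] by auto
      have e0: "cmod (?\<eta> n t) \<le> 1" by (rule \<kappa>(2))
      have e1: "cmod (derivf (?\<eta> n) t) \<le> n * b1"
        unfolding derivf_affine[OF \<kappa>(1), THEN fun_cong] using b1(2)[OF arg3] n by (simp add: norm_mult)
      have e2: "cmod (derivf (derivf (?\<eta> n)) t) \<le> n * (n * b2)"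
        unfolding derivf_affine2[OF \<kappa>(1), THEN fun_cong] using b2(2)[OF arg3] n by (simp add: norm_mult)
      have norm_mult_le: "cmod (p * q) \<le> P * Q" if "cmod p \<le> P" "cmod q \<le> Q" for p q P Q
        using that by (simp add: norm_mult mult_mono')
      have "cmod (?\<theta> n t) \<le> 3 * L1 / n * 1"
        by (rule norm_mult_le[OF p0 e0])
      moreover have "cmod (derivf (derivf (?\<theta> n)) t) \<le>
          (3 * L1 / n * (n * (n * b2)) + L1 * (n * b1)) + (L1 * (n * b1) + L2 * 1)"
        unfolding derivf_mult2[OF sm(1) \<eta>, THEN fun_cong]
        by (intro norm_triangle_mono norm_mult_le p0 p1 p2 e0 e1 e2)
      moreover have "(3 * L1 / n * (n * (n * b2)) + L1 * (n * b1)) + (L1 * (n * b1) + L2 * 1) \<le>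
          n * (3 * L1 * b2 + 2 * L1 * b1 + L2)"
      proof -
        have "L2 \<le> n * L2" using n L2(1) by simp
        then show ?thesis using n by (simp add: algebra_simps)
      qed
      ultimately show ?thesis by linarith
    qed
    have "cmod (fourier (?\<theta> n) v) \<le> K / (n\<^sup>2 + v\<^sup>2)" for v
    proof -
      have "(n\<^sup>2 + v\<^sup>2) * cmod (fourier (?\<theta> n) v) \<le> (\<xi> + 3 / n - (\<xi> - 3 / n)) *
          (n\<^sup>2 * (3 * L1 / n) + n * (3 * L1 * b2 + 2 * L1 * b1 + L2))"
        using n bnds by (intro fourier_decay[OF test_functionsD(1)[OF near_part] supp_\<theta>]) auto
      also have "\<dots> = K"
        using n by (simp add: K_def field_simps power2_eq_square)
      finally show ?thesis
        using n by (simp add: pos_le_divide_eq add_pos_nonneg mult.commute)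
    qed
    then show ?thesis
      using n by (intro norm_smear[OF near_part]) auto
  qed
  have far_part: "(\<lambda>t. \<psi> t * (1 - ?\<eta> n t)) \<in> test_functions UNIV" for n
    by (intro test_functions_mult[OF \<psi>] smooth_diff smooth_const \<eta>)
  have far_tame: "x \<in> tame (\<lambda>t. \<psi> t * (1 - ?\<eta> n t))" if n: "n \<ge> 1" for n
  proof (rule tame_regular[OF far_part])
    let ?S = "support \<psi> - ball \<xi> (1 / n)"
    have "closure {t. \<psi> t * (1 - ?\<eta> n t) \<noteq> 0} \<subseteq> ?S"
    proof (rule closure_minimal)
      show "{t. \<psi> t * (1 - ?\<eta> n t) \<noteq> 0} \<subseteq> ?S"
        using near[OF n] zero_outside_support[of _ \<psi>]
        by (auto simp: dist_real_def abs_minus_commute intro: less_imp_le)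
      show "closed ?S"
        using sm(2) by (intro closed_Diff compact_imp_closed) auto
    qed
    moreover have "?S \<subseteq> support \<psi> - {\<xi>}"
      using n by auto
    ultimately have "closure {t. \<psi> t * (1 - ?\<eta> n t) \<noteq> 0} \<subseteq> regular"
      using supp by blast
    then show "support (\<lambda>t. \<psi> t * (1 - ?\<eta> n t)) \<subseteq> regular"
      by (simp only: support_def[of "\<lambda>t. \<psi> t * (1 - ?\<eta> n t)"])
  qed
  have "asymptotically_ap (smear \<psi> x)"
  proof (rule asymptotically_ap_approx)
    fix e :: real assume "e > 0"
    define n where "n = K * (C * norm x) * pi / e + 1"
    have n: "n \<ge> 1"
      using K C_pos \<open>e > 0\<close> by (simp add: n_def)
    have "K * (C * norm x) * pi < n * e"
      using \<open>e > 0\<close> by (simp add: n_def field_simps)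
    then have "K * (C * norm x) * pi / n < e"
      using n by (simp add: pos_divide_less_eq mult.commute)
    moreover have "smear \<psi> x t - smear (\<lambda>t. \<psi> t * (1 - ?\<eta> n t)) x t = smear (?\<theta> n) x t" for t
    proof -
      have "smear \<psi> x t = smear (\<lambda>t. \<psi> t * (1 - ?\<eta> n t) + ?\<theta> n t) x t"
        by (simp add: right_diff_distrib)
      then show ?thesis
        unfolding smear_add_test[OF far_part near_part] by simp
    qed
    ultimately have "norm (smear \<psi> x t - smear (\<lambda>t. \<psi> t * (1 - ?\<eta> n t)) x t) < e" for t
      using near_small[OF n, of t] by simp
    then show "\<exists>G. asymptotically_ap G \<and> (\<forall>\<^sub>F t in at_top. norm (smear \<psi> x t - G t) < e)"
      using far_tame[OF n] by (intro exI[of _ "smear (\<lambda>t. \<psi> t * (1 - ?\<eta> n t)) x"]) (simp add: tame_def)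
  qed
  then show ?thesis by (simp add: tame_def)
qed

text \<open>On the frequency side the passage from \<open>z\<close> to \<open>rot \<xi> h z - z\<close> multiplies \<open>\<phi>\<close> by a function that
  vanishes at \<open>\<xi>\<close>.\<close>

lemma rot_diff_tame:
  assumes \<phi>: "\<phi> \<in> test_functions UNIV" and supp: "support \<phi> - {\<xi>} \<subseteq> regular" and h: "h \<ge> 0"
  shows "rot \<xi> h z - z \<in> tame \<phi>"
proof -
  let ?e = "exp (- (\<i> * of_real \<xi> * of_real h)) :: complex"
  let ?m = "\<lambda>\<zeta>::real. exp (\<i> * of_real h * of_real \<zeta>) :: complex"
  let ?\<psi> = "\<lambda>\<zeta>. \<phi> \<zeta> * ?m \<zeta> * ?e + \<phi> \<zeta> * (- 1)"
  have 1: "(\<lambda>\<zeta>. \<phi> \<zeta> * ?m \<zeta>) \<in> test_functions UNIV"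
    using test_functions_mult[OF \<phi> smooth_exp[of 1 "\<i> * of_real h"]] by simp
  have 2: "(\<lambda>\<zeta>. \<phi> \<zeta> * ?m \<zeta> * ?e) \<in> test_functions UNIV" "(\<lambda>\<zeta>. \<phi> \<zeta> * (- 1)) \<in> test_functions UNIV"
    by (intro test_functions_mult[OF 1] test_functions_mult[OF \<phi>] smooth_const)+
  have \<psi>: "?\<psi> \<in> test_functions UNIV"
    by (rule test_functions_add[OF 2])
  have "?m \<xi> * ?e = 1"
    unfolding exp_add[symmetric] by (simp add: algebra_simps)
  then have "?\<psi> \<xi> = 0"
    by (simp add: mult.assoc)
  moreover have "support ?\<psi> \<subseteq> support \<phi>"
    unfolding support_def by (intro closure_mono) auto
  ultimately have tame: "z \<in> tame ?\<psi>"
    using supp by (intro tame_vanishing[OF \<psi>]) auto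
  have s1: "smear ?\<psi> z t = ?e *\<^sub>C smear (\<lambda>\<zeta>. \<phi> \<zeta> * ?m \<zeta>) z t - smear \<phi> z t" for t
    by (simp only: smear_add_test[OF 2] smear_scale_test[OF 1] smear_scale_test[OF \<phi>] scaleC.minus_left scaleC_one add_uminus_conv_diff)
  have s2: "smear \<phi> (rot \<xi> h z - z) t = ?e *\<^sub>C smear \<phi> (T h z) t - smear \<phi> z t" for t
    by (simp only: rot_def smear_diff[OF \<phi>] smear_scaleC[OF \<phi>])
  have "((\<lambda>t. ?e *\<^sub>C (smear \<phi> (T h z) t - smear (\<lambda>\<zeta>. \<phi> \<zeta> * ?m \<zeta>) z t)) \<longlongrightarrow> ?e *\<^sub>C 0) at_top"
    by (intro tendsto_intros smear_T[OF \<phi> h])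
  moreover have "?e *\<^sub>C (smear \<phi> (T h z) t - smear (\<lambda>\<zeta>. \<phi> \<zeta> * ?m \<zeta>) z t) =
      smear \<phi> (rot \<xi> h z - z) t - smear ?\<psi> z t" for t
    unfolding s1 s2 by (simp add: scaleC.diff_right)
  ultimately have lim: "((\<lambda>t. smear \<phi> (rot \<xi> h z - z) t - smear ?\<psi> z t) \<longlongrightarrow> 0) at_top"
    by (simp only: scaleC.zero_right)
  have "asymptotically_ap (smear ?\<psi> z)"
    using tame by (simp only: tame_def mem_Collect_eq)
  from asymptotically_ap_tendsto_0[OF this lim] show ?thesis
    by (simp only: tame_def mem_Collect_eq)
qed

text \<open>With \<open>z = Res (\<alpha> + \<i> * \<xi>) x\<close>, the vector \<open>abel \<xi> \<alpha> x - x\<close> is the image of \<open>z\<close> under the generator of the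
  rotated semigroup, thus a limit of the difference quotients of \<open>rot \<xi> h z\<close>.\<close>

lemma abel_diff_tame:
  assumes \<phi>: "\<phi> \<in> test_functions UNIV" and supp: "support \<phi> - {\<xi>} \<subseteq> regular" and \<alpha>: "\<alpha> > 0"
  shows "abel \<xi> \<alpha> x - x \<in> tame \<phi>"
proof (rule tame_limit[OF \<phi>])
  let ?\<mu> = "of_real \<alpha> + \<i> * of_real \<xi> :: complex"
  let ?z = "Res ?\<mu> x"
  let ?e = "\<lambda>h::real. exp (- (\<i> * of_real \<xi>) * of_real h) :: complex"
  have \<mu>: "Re ?\<mu> > 0" using \<alpha> by simp
  have e1: "(?e \<longlongrightarrow> exp (- (\<i> * of_real \<xi>) * of_real 0)) (at_right 0)"
    by (intro tendsto_intros)
  have "((\<lambda>w. exp (- (\<i> * of_real \<xi>) * w)) has_field_derivative - (\<i> * of_real \<xi>)) (at 0)"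
    by (auto intro!: derivative_eq_intros)
  then have "((\<lambda>w. (exp (- (\<i> * of_real \<xi>) * w) - 1) / w) \<longlongrightarrow> - (\<i> * of_real \<xi>)) (at 0)"
    by (simp add: DERIV_def)
  moreover have "filterlim (\<lambda>h. complex_of_real h) (at 0) (at_right 0)"
    by (rule filterlim_atI) (auto intro!: tendsto_eq_intros simp: eventually_at_filter)
  ultimately have e2: "((\<lambda>h. (?e h - 1) / of_real h) \<longlongrightarrow> - (\<i> * of_real \<xi>)) (at_right 0)"
    by (rule filterlim_compose)
  have factor: "e *\<^sub>C (w *\<^sub>C (a - z)) + ((e - 1) * w) *\<^sub>C z = w *\<^sub>C (e *\<^sub>C a - z)" for e w and a z :: 'a
    by (simp add: scaleC.diff_right scaleC.diff_left left_diff_distrib right_diff_distrib scaleC_scaleC mult.commute)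
  have "((\<lambda>h. ?e h *\<^sub>C ((T h ?z - ?z) /\<^sub>R h) + ((?e h - 1) / of_real h) *\<^sub>C ?z) \<longlongrightarrow>
      exp (- (\<i> * of_real \<xi>) * of_real 0) *\<^sub>C (?\<mu> *\<^sub>C ?z - x) + (- (\<i> * of_real \<xi>)) *\<^sub>C ?z) (at_right 0)"
    by (intro tendsto_intros e1 e2 Res_derivative[OF \<mu>])
  moreover have "exp (- (\<i> * of_real \<xi>) * of_real 0) *\<^sub>C (?\<mu> *\<^sub>C ?z - x) + (- (\<i> * of_real \<xi>)) *\<^sub>C ?z = abel \<xi> \<alpha> x - x"
    by (simp add: abel_def scaleR_scaleC scaleC.add_left scaleC.minus_left)
  moreover have "?e h *\<^sub>C ((T h ?z - ?z) /\<^sub>R h) + ((?e h - 1) / of_real h) *\<^sub>C ?z =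
      of_real (1 / h) *\<^sub>C (rot \<xi> h ?z - ?z)" for h
    using factor[of "?e h" "of_real (1 / h)" "T h ?z" ?z]
    by (simp add: rot_def scaleR_scaleC inverse_eq_divide)
  ultimately show "((\<lambda>h. of_real (1 / h) *\<^sub>C (rot \<xi> h ?z - ?z)) \<longlongrightarrow> abel \<xi> \<alpha> x - x) (at_right 0)"
    by (simp only:)
  show "\<forall>\<^sub>F h in at_right 0. of_real (1 / h) *\<^sub>C (rot \<xi> h ?z - ?z) \<in> tame \<phi>"
    using eventually_at_right_less[of "0::real"]
    by eventually_elim (intro tame_scaleC[OF \<phi>] rot_diff_tame[OF \<phi> supp], simp)
qed simp

text \<open>The limit of the Abel means is an eigenvector, so the ergodic decomposition
  \<open>x = y + lim (x - abel \<xi> \<alpha> x)\<close> has tame terms only.\<close>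

lemma ergodic_tame:
  assumes \<phi>: "\<phi> \<in> test_functions UNIV" and supp: "support \<phi> - {\<xi>} \<subseteq> regular"
    and lim: "((\<lambda>\<alpha>. abel \<xi> \<alpha> x) \<longlongrightarrow> y) (at_right 0)"
  shows "x \<in> tame \<phi>"
proof (rule tame_limit[OF \<phi>])
  have y: "y \<in> tame \<phi>"
    by (rule eigenvector_tame[OF \<phi> abel_limit_eigenvector[OF lim]])
  have "((\<lambda>\<alpha>. y - (abel \<xi> \<alpha> x - x)) \<longlongrightarrow> y - (y - x)) (at_right 0)"
    by (intro tendsto_intros lim)
  then show "((\<lambda>\<alpha>. y - (abel \<xi> \<alpha> x - x)) \<longlongrightarrow> x) (at_right 0)"
    by simp
  show "\<forall>\<^sub>F \<alpha> in at_right 0. y - (abel \<xi> \<alpha> x - x) \<in> tame \<phi>"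
    using eventually_at_right_less[of "0::real"]
    by eventually_elim (intro tame_diff[OF \<phi> y] abel_diff_tame[OF \<phi> supp])
qed simp

text \<open>The set of exceptional frequencies is closed and countable. If it were not empty, it would have an
  isolated point, at which ergodicity makes all vectors of \<open>M\<close> tame; by density all vectors are tame,
  and the point is regular after all.\<close>

lemma regular_UNIV:
  assumes cnt: "countable (PF_spectrum (generator T))" and M: "closure M = UNIV"
    and erg: "\<And>\<xi> x. \<i> * of_real \<xi> \<in> PF_spectrum (generator T) \<Longrightarrow> x \<in> M \<Longrightarrow>
      \<exists>l. ((\<lambda>\<alpha>. abel \<xi> \<alpha> x) \<longlongrightarrow> l) (at_right 0)"
  shows "regular = UNIV"
proof (rule ccontr)
  assume "regular \<noteq> UNIV"
  moreover have "closed (- regular)"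
    using open_regular by (simp add: closed_def)
  moreover have "countable (- regular)"
  proof -
    have "(\<lambda>\<xi>. \<i> * complex_of_real \<xi>) ` (- regular) \<subseteq> PF_spectrum (generator T)"
      using PF_complement_regular by blast
    then have "countable ((\<lambda>\<xi>. \<i> * complex_of_real \<xi>) ` (- regular))"
      using cnt countable_subset by blast
    then show ?thesis
      by (rule countable_image_inj_on) (simp add: inj_on_def)
  qed
  ultimately obtain \<xi> r where \<xi>: "\<xi> \<in> - regular" "r > 0" "ball \<xi> r \<inter> - regular = {\<xi>}"
    using closed_countable_isolated_point[of "- regular"] by (metis Compl_UNIV_eq double_complement)
  have "x \<in> tame \<phi>" if \<phi>: "\<phi> \<in> test_functions (ball \<xi> r)" for \<phi> x
  proof -
    have \<phi>': "\<phi> \<in> test_functions UNIV"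
      using \<phi> by (rule test_functions_mono[rotated]) auto
    have supp: "support \<phi> - {\<xi>} \<subseteq> regular"
      using test_functionsD(3)[OF \<phi>] \<xi>(3) by blast
    have mem: "\<i> * of_real \<xi> \<in> PF_spectrum (generator T)"
      using \<xi>(1) PF_complement_regular by blast
    show ?thesis
    proof (rule tame_closed[OF \<phi>'])
      fix e :: real assume "e > 0"
      then obtain y where y: "y \<in> M" "dist y x < e"
        using M closure_approachable[of x M] by blast
      then have "y \<in> tame \<phi>"
        using erg[OF mem y(1)] ergodic_tame[OF \<phi>' supp] by blast
      with y(2) show "\<exists>y\<in>tame \<phi>. norm (x - y) < e"
        by (auto simp: dist_norm norm_minus_commute)
    qed
  qed
  then have "\<xi> \<in> regular"
    using \<xi>(2) unfolding regular_def by blast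
  with \<xi>(1) show False by blast
qed

section \<open>Recovering the orbit from its smearings\<close>

lemma orb_uniformly_continuous:
  assumes "e > 0"
  obtains d where "d > 0" "\<And>t w. \<bar>w\<bar> < d \<Longrightarrow> norm (orb x (t + w) - orb x t) < e"
proof -
  have "e / C > 0" using assms C_pos by simp
  then have "\<forall>\<^sub>F s in nhds 0. dist (T \<bar>s\<bar> x) x < e / C"
    by (rule tendstoD[OF T_near_0])
  then obtain d where d: "d > 0" "\<And>s. dist s 0 < d \<Longrightarrow> dist (T \<bar>s\<bar> x) x < e / C"
    by (auto simp: eventually_nhds_metric)
  show thesis
  proof (rule that[OF d(1)])
    fix t w :: real assume "\<bar>w\<bar> < d"
    then have "dist (max (t + w) 0 - max t 0) 0 < d"
      by (auto simp: dist_real_def max_def abs_if split: if_splits)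
    from d(2)[OF this] have "norm (T \<bar>max (t + w) 0 - max t 0\<bar> x - x) < e / C"
      by (simp add: dist_norm)
    then have "C * norm (T \<bar>max (t + w) 0 - max t 0\<bar> x - x) < e"
      using C_pos by (simp add: pos_less_divide_eq mult.commute)
    then show "norm (orb x (t + w) - orb x t) < e"
      using norm_T_diff[of "max (t + w) 0" "max t 0" x] by (simp add: orb_def)
  qed
qed

lemma smear_dilation:
  assumes \<phi>: "\<phi> \<in> test_functions UNIV" and n: "n > 0"
  shows "smear (\<lambda>\<xi>. \<phi> (\<xi> / n)) x t = integral UNIV (\<lambda>v. fourier \<phi> v *\<^sub>C orb x (t + v / n))"
proof -
  obtain c where c: "\<And>v. cmod (fourier \<phi> v) \<le> c / (1 + v\<^sup>2)"
    using test_function_fourier_bound[OF \<phi>] by metis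
  have "(\<lambda>v. fourier \<phi> (v - 0) *\<^sub>C orb x (t + v / n)) integrable_on UNIV"
    using c n by (intro kernel_integral(1)[of _ c 1 _ "C * norm x"] fourier_continuous[OF \<phi>])
      (auto intro!: continuous_on_compose2[OF continuous_orb[of UNIV]] continuous_intros norm_orb)
  then have "((\<lambda>v. fourier \<phi> v *\<^sub>C orb x (t + v / n)) has_integral
      integral UNIV (\<lambda>v. fourier \<phi> v *\<^sub>C orb x (t + v / n))) UNIV"
    by (simp add: integrable_integral)
  from has_integral_affine_UNIV[OF this n, of "- n * t"]
  have "((\<lambda>u. fourier \<phi> (n * (u - t)) *\<^sub>C orb x u) has_integral
      integral UNIV (\<lambda>v. fourier \<phi> v *\<^sub>C orb x (t + v / n)) /\<^sub>R n) UNIV"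
    using n by (simp add: algebra_simps add_divide_distrib diff_divide_distrib)
  from has_integral_cmul[OF this, of n]
  have "((\<lambda>u. n *\<^sub>R (fourier \<phi> (n * (u - t)) *\<^sub>C orb x u)) has_integral
      integral UNIV (\<lambda>v. fourier \<phi> v *\<^sub>C orb x (t + v / n))) UNIV"
    using n by simp
  moreover have "n *\<^sub>R (fourier \<phi> (n * (u - t)) *\<^sub>C orb x u) = fourier (\<lambda>\<xi>. \<phi> (\<xi> / n)) (u - t) *\<^sub>C orb x u" for u
    by (simp add: fourier_dilation[OF test_function_kernel_integrable[OF \<phi>] n] scaleR_scaleC scaleC_scaleC)
  ultimately show ?thesis
    by (simp add: smear_def integral_unique)
qed

text \<open>The kernels of the dilated test functions concentrate at \<open>0\<close> with constant integral, and orbits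
  are uniformly continuous. The kernel decays only quadratically, so the modulus of continuity is
  replaced by a constant plus a truncated linear function, to which dominated convergence
  applies.\<close>

lemma smear_approximates_orbit:
  assumes \<phi>: "\<phi> \<in> test_functions UNIV" and e: "e > 0"
  shows "\<exists>n>0. \<forall>t. norm (smear (\<lambda>\<xi>. \<phi> (\<xi> / n)) x t - integral UNIV (fourier \<phi>) *\<^sub>C orb x t) < e"
proof -
  obtain c where c: "c > 0" "\<And>v. cmod (fourier \<phi> v) \<le> c / (1 + v\<^sup>2)"
    using test_function_fourier_bound[OF \<phi>] by metis
  define B where "B = 2 * (C * norm x)"
  have B: "norm (orb x s - orb x t) \<le> B" for s t
    using norm_triangle_ineq4[of "orb x s" "orb x t"] norm_orb[of x s] norm_orb[of x t] by (simp add: B_def)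
  have "B \<ge> 0" using order_trans[OF norm_ge_zero B] .
  define e' where "e' = e / (2 * c * pi)"
  have e': "e' > 0" "c * e' * pi = e / 2"
    using e c(1) by (auto simp: e'_def)
  obtain d where d: "d > 0" "\<And>t w. \<bar>w\<bar> < d \<Longrightarrow> norm (orb x (t + w) - orb x t) < e'"
    using orb_uniformly_continuous[OF e'(1)] by metis
  let ?m = "\<lambda>(n::nat) v. c * min (B * \<bar>v\<bar> / (d * real (Suc n))) B"
  have modulus: "norm (orb x (t + v / real (Suc n)) - orb x t) \<le> e' + min (B * \<bar>v\<bar> / (d * real (Suc n))) B" for t v n
  proof (cases "\<bar>v / real (Suc n)\<bar> < d")
    case True
    then show ?thesis
      using d(2)[OF True, of t] \<open>B \<ge> 0\<close> d(1) by (auto simp: min_def intro: add_increasing2)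
  next
    case False
    then have "d * real (Suc n) \<le> \<bar>v\<bar>"
      by (simp add: abs_divide not_less pos_le_divide_eq)
    then have "1 \<le> \<bar>v\<bar> / (d * real (Suc n))"
      using d(1) by (simp add: pos_le_divide_eq)
    then have "B * 1 \<le> B * (\<bar>v\<bar> / (d * real (Suc n)))"
      using \<open>B \<ge> 0\<close> by (intro mult_left_mono)
    then have "min (B * \<bar>v\<bar> / (d * real (Suc n))) B = B"
      by (simp add: min_def)
    then show ?thesis
      using B[of "t + v / real (Suc n)" t] e'(1) by linarith
  qed
  have m: "\<And>n. continuous_on UNIV (?m n)" "\<And>n v. \<bar>?m n v\<bar> \<le> c * B" "\<And>v. (\<lambda>n. ?m n v) \<longlonglongrightarrow> 0"
  proof -
    show "continuous_on UNIV (?m n)" for n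
      using d(1) by (intro continuous_intros) auto
    show "\<bar>?m n v\<bar> \<le> c * B" for n v
      using c(1) \<open>B \<ge> 0\<close> d(1) by (auto simp: abs_mult intro!: mult_left_mono)
    show "(\<lambda>n. ?m n v) \<longlonglongrightarrow> 0" for v
    proof -
      have "(\<lambda>n. B * \<bar>v\<bar> / d * inverse (real (Suc n))) \<longlonglongrightarrow> B * \<bar>v\<bar> / d * 0"
        by (intro tendsto_intros LIMSEQ_inverse_real_of_nat)
      then have "(\<lambda>n. c * min (B * \<bar>v\<bar> / (d * real (Suc n))) B) \<longlonglongrightarrow> c * min 0 B"
        by (intro tendsto_intros) (simp add: divide_inverse mult.assoc)
      then show ?thesis using \<open>B \<ge> 0\<close> by simp
    qed
  qed
  note w = weighted_integral_tendsto_0[of ?m, OF m]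
  have "\<forall>\<^sub>F n in sequentially. integral UNIV (\<lambda>v. ?m n v / (1 + v\<^sup>2)) < e / 2"
    using e by (intro order_tendstoD(2)[OF w(2)]) auto
  then obtain n where n: "integral UNIV (\<lambda>v. ?m n v / (1 + v\<^sup>2)) < e / 2"
    by (auto simp: eventually_sequentially)
  let ?n = "real (Suc n)"
  have "norm (smear (\<lambda>\<xi>. \<phi> (\<xi> / ?n)) x t - integral UNIV (fourier \<phi>) *\<^sub>C orb x t) < e" for t
  proof -
    have cont: "continuous_on UNIV (\<lambda>v. orb x (t + v / ?n))"
      by (auto intro!: continuous_on_compose2[OF continuous_orb[of UNIV]] continuous_intros)
    have i1: "(\<lambda>v. fourier \<phi> v *\<^sub>C orb x (t + v / ?n)) integrable_on UNIV"
      using kernel_integral(1)[of "fourier \<phi>" c 1 "\<lambda>v. orb x (t + v / ?n)" "C * norm x" 0]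
        fourier_continuous[OF \<phi>] c(2) cont norm_orb by simp
    have i0: "fourier \<phi> integrable_on UNIV"
      using kernel_integral(1)[of "fourier \<phi>" c 1 "\<lambda>_. 1::complex" 1 0] c(2) fourier_continuous[OF \<phi>]
      by (simp add: scaleC_complex_def)
    have i2: "((\<lambda>v. fourier \<phi> v *\<^sub>C orb x t) has_integral integral UNIV (fourier \<phi>) *\<^sub>C orb x t) UNIV"
      using has_integral_linear[OF integrable_integral[OF i0] scaleC.bounded_linear_left, of "orb x t"]
      by (simp add: o_def)
    have "((\<lambda>v. fourier \<phi> v *\<^sub>C orb x (t + v / ?n) - fourier \<phi> v *\<^sub>C orb x t) has_integral
        smear (\<lambda>\<xi>. \<phi> (\<xi> / ?n)) x t - integral UNIV (fourier \<phi>) *\<^sub>C orb x t) UNIV"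
      unfolding smear_dilation[OF \<phi> of_nat_0_less_iff[THEN iffD2, OF zero_less_Suc]]
      by (intro has_integral_diff i2 integrable_integral[OF i1])
    moreover have g: "((\<lambda>v. c * e' / (1\<^sup>2 + v\<^sup>2) + ?m n v / (1 + v\<^sup>2)) has_integral
        c * e' * pi / 1 + integral UNIV (\<lambda>v. ?m n v / (1 + v\<^sup>2))) UNIV"
      by (intro has_integral_add Poisson_weight_has_integral integrable_integral w(1)) simp
    moreover have "norm (fourier \<phi> v *\<^sub>C orb x (t + v / ?n) - fourier \<phi> v *\<^sub>C orb x t) \<le>
        c * e' / (1\<^sup>2 + v\<^sup>2) + ?m n v / (1 + v\<^sup>2)" for v
    proof -
      have "norm (fourier \<phi> v *\<^sub>C orb x (t + v / ?n) - fourier \<phi> v *\<^sub>C orb x t) =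
          cmod (fourier \<phi> v) * norm (orb x (t + v / ?n) - orb x t)"
        by (simp add: scaleC.diff_right[symmetric] norm_scaleC)
      also have "\<dots> \<le> c / (1 + v\<^sup>2) * (e' + min (B * \<bar>v\<bar> / (d * ?n)) B)"
        using c(1) by (intro mult_mono c(2) modulus) (auto simp: add_nonneg_nonneg)
      also have "\<dots> = c * e' / (1\<^sup>2 + v\<^sup>2) + ?m n v / (1 + v\<^sup>2)"
        by (simp add: distrib_left)
      finally show ?thesis .
    qed
    ultimately have "norm (smear (\<lambda>\<xi>. \<phi> (\<xi> / ?n)) x t - integral UNIV (fourier \<phi>) *\<^sub>C orb x t) \<le>
        c * e' * pi / 1 + integral UNIV (\<lambda>v. ?m n v / (1 + v\<^sup>2))"
      using integral_norm_bound_integral[of _ UNIV "\<lambda>v. c * e' / (1\<^sup>2 + v\<^sup>2) + ?m n v / (1 + v\<^sup>2)"]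
      by (metis (no_types, lifting) has_integral_iff)
    with n e'(2) show ?thesis by simp
  qed
  then show ?thesis
    by (intro exI[of _ ?n]) simp
qed

text \<open>With no exceptional frequencies the orbit itself, as a uniform limit of multiples of smeared orbits,
  approaches the almost periodic vectors at late times.\<close>

lemma regular_imp_ap:
  assumes "regular = UNIV"
  shows "x \<in> ap_vectors"
proof (rule ap_vectorsI_late)
  fix e :: real assume "e > 0"
  obtain \<kappa> :: "real \<Rightarrow> real" where \<kappa>: "smooth (\<lambda>t. of_real (\<kappa> t))" "\<And>t. 0 \<le> \<kappa> t"
    "\<And>t. \<bar>t\<bar> \<le> 1 \<Longrightarrow> \<kappa> t = 1" "\<And>t. \<bar>t\<bar> \<ge> 2 \<Longrightarrow> \<kappa> t = 0" "\<And>t. \<kappa> (- t) = \<kappa> t"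
    using plateau_exists by blast
  let ?\<phi> = "\<lambda>t. complex_of_real (\<kappa> t)"
  have \<phi>: "?\<phi> \<in> test_functions UNIV"
    using \<kappa>(4) by (intro test_functionsI[of _ "cball 0 2"] \<kappa>(1)) auto
  let ?c = "integral UNIV (fourier ?\<phi>)"
  have c: "?c \<noteq> 0"
    by (rule integral_fourier_nonzero[OF \<phi> \<kappa>(2,3,5)])
  then have "cmod ?c * e / 2 > 0" using \<open>e > 0\<close> by simp
  from smear_approximates_orbit[OF \<phi> this]
  obtain n where n: "n > 0" "\<And>t. norm (smear (\<lambda>\<xi>. ?\<phi> (\<xi> / n)) x t - ?c *\<^sub>C orb x t) < cmod ?c * e / 2"
    by blast
  have "(\<lambda>\<xi>. ?\<phi> (\<xi> / n)) \<in> test_functions UNIV"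
  proof (rule test_functionsI[of _ "cball 0 (2 * n)"])
    show "smooth (\<lambda>\<xi>. ?\<phi> (\<xi> / n))"
      using smooth_affine[OF \<kappa>(1), of "1 / n" 0] by simp
    show "?\<phi> (t / n) = 0" if "t \<notin> cball 0 (2 * n)" for t
      using that n(1) \<kappa>(4)[of "t / n"] by (simp add: dist_norm pos_le_divide_eq abs_divide)
  qed auto
  then have "x \<in> tame (\<lambda>\<xi>. ?\<phi> (\<xi> / n))"
    using assms by (intro tame_regular) auto
  then have "\<forall>\<^sub>F t in at_top. \<exists>z\<in>ap_vectors. norm (smear (\<lambda>\<xi>. ?\<phi> (\<xi> / n)) x t - z) < cmod ?c * e / 2"
    using \<open>cmod ?c * e / 2 > 0\<close> unfolding tame_def asymptotically_ap_def by blast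
  then have "\<forall>\<^sub>F t in at_top. t \<ge> 0 \<and> (\<exists>z\<in>ap_vectors. norm (smear (\<lambda>\<xi>. ?\<phi> (\<xi> / n)) x t - z) < cmod ?c * e / 2)"
    by (intro eventually_conj eventually_ge_at_top)
  then obtain s z where s: "s \<ge> 0" "z \<in> ap_vectors" "norm (smear (\<lambda>\<xi>. ?\<phi> (\<xi> / n)) x s - z) < cmod ?c * e / 2"
    using eventually_happens'[OF trivial_limit_at_top_linorder] by blast
  have "norm (?c *\<^sub>C orb x s - z) < cmod ?c * e / 2 + cmod ?c * e / 2"
    using n(2)[of s] s(3) by (intro norm_diff_triangle_less) (auto simp: norm_minus_commute)
  then have "cmod ?c * norm (T s x - inverse ?c *\<^sub>C z) < cmod ?c * e"
    using c s(1) by (simp add: norm_scaleC[symmetric] scaleC.diff_right scaleC_scaleC orb_nonneg mult.commute)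
  then have "norm (T s x - inverse ?c *\<^sub>C z) < e"
    using c by simp
  with s(1) ap_vectors_scaleC[OF s(2)] show "\<exists>s\<ge>0. \<exists>z\<in>ap_vectors. norm (T s x - z) < e"
    by blast
qed

end

section \<open>Almost periodicity of bounded semigroups with countable pseudofunction spectrum\<close>

theorem corollary9p4:
  fixes T :: "real \<Rightarrow> 'a::complex_banach \<Rightarrow> 'a" and A :: "'a \<rightharpoonup> 'a"
  assumes "C0_semigroup T"
    and "bounded_semigroup T"
    and "A = generator T"
    and "countable (PF_spectrum A)"
  shows "almost_periodic T \<longleftrightarrow>
    (\<exists>M. csubspace M \<and> closure M = UNIV \<and>
      (\<forall>\<xi>::real. \<i> * of_real \<xi> \<in> PF_spectrum A \<longrightarrow>
        (\<forall>x\<in>M. \<exists>l. ((\<lambda>\<alpha>. \<alpha> *\<^sub>R resolvent A (of_real \<alpha> + \<i> * of_real \<xi>) x) \<longlongrightarrow> l) (at_right 0))))"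
proof -
  obtain K where K: "\<And>t. t \<ge> 0 \<Longrightarrow> onorm (T t) \<le> K"
    using assms(2) by (auto simp: bounded_semigroup_def bdd_above_def)
  interpret bounded_C0_semigroup T "max K 1"
  proof
    fix t :: real and x assume "t \<ge> 0"
    then have "bounded_linear (T t)"
      using assms(1) by (simp add: C0_semigroup_def bounded_clinear_def)
    then have "norm (T t x) \<le> onorm (T t) * norm x"
      by (rule onorm)
    also have "\<dots> \<le> max K 1 * norm x"
      using K[OF \<open>t \<ge> 0\<close>] by (intro mult_right_mono) auto
    finally show "norm (T t x) \<le> max K 1 * norm x" .
  qed (use assms(1) in auto)
  have abel_iff: "((\<lambda>\<alpha>. \<alpha> *\<^sub>R resolvent A (of_real \<alpha> + \<i> * of_real \<xi>) x) \<longlongrightarrow> l) (at_right 0) \<longleftrightarrow>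
      ((\<lambda>\<alpha>. abel \<xi> \<alpha> x) \<longlongrightarrow> l) (at_right 0)" for \<xi> x l
    by (intro filterlim_cong refl) (auto simp: eventually_at_filter abel_def assms(3) resolvent_eq_Res)
  show ?thesis
    unfolding abel_iff
  proof
    assume "almost_periodic T"
    then have "\<exists>l. ((\<lambda>\<alpha>. abel \<xi> \<alpha> x) \<longlongrightarrow> l) (at_right 0)" for \<xi> x
      by (intro abel_convergent) (simp add: almost_periodic_def)
    then show "\<exists>M. csubspace M \<and> closure M = UNIV \<and> (\<forall>\<xi>::real. \<i> * of_real \<xi> \<in> PF_spectrum A \<longrightarrow>
        (\<forall>x\<in>M. \<exists>l. ((\<lambda>\<alpha>. abel \<xi> \<alpha> x) \<longlongrightarrow> l) (at_right 0)))"
      by (intro exI[of _ UNIV]) (simp add: csubspace_def)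
  next
    assume "\<exists>M. csubspace M \<and> closure M = UNIV \<and> (\<forall>\<xi>::real. \<i> * of_real \<xi> \<in> PF_spectrum A \<longrightarrow>
        (\<forall>x\<in>M. \<exists>l. ((\<lambda>\<alpha>. abel \<xi> \<alpha> x) \<longlongrightarrow> l) (at_right 0)))"
    then obtain M where M: "closure M = UNIV"
      "\<And>\<xi> x. \<i> * of_real \<xi> \<in> PF_spectrum A \<Longrightarrow> x \<in> M \<Longrightarrow> \<exists>l. ((\<lambda>\<alpha>. abel \<xi> \<alpha> x) \<longlongrightarrow> l) (at_right 0)"
      by blast
    then have "regular = UNIV"
      using assms(3,4) by (intro regular_UNIV) auto
    then have "x \<in> ap_vectors" for x
      by (rule regular_imp_ap)
    then show "almost_periodic T"
      by (simp add: almost_periodic_def ap_vectors_def)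
  qed
qed

end
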